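(* Let $\varphi:(M,g)\to(N,h)$ be a $C^2$ map between Riemannian manifolds. Then $\varphi$ is an infinity-harmonic morphism if and only if it is both horizontally weakly conformal and an infinity-harmonic map. Moreover, $\varphi$ is both horizontally weakly conformal and infinity-harmonic if and only if it is a horizontally homothetic map.
   Context: A $C^2$ map $\psi:(M,g)\to(N,h)$ between Riemannian manifolds is infinity-harmonic if $\Delta_\infty(\psi):=\frac12\, d\psi(\mathrm{grad}\,|d\psi|^2)=0$, where $|d\psi|_x^2=\sum_i h(d\psi(e_i),d\psi(e_i))$ for an orthonormal basis $\{e_i\}$ of $T_xM$. An infinity-harmonic function is a real-valued infinity-harmonic map, i.e. a $C^2$ function $u$ with $\frac12 g(\mathrm{grad}\,u,\mathrm{grad}\,|\mathrm{grad}\,u|^2)=0$. A map between Riemannian manifolds is an infinity-harmonic morphism if it pulls back locally defined infinity-harmonic functions (on open subsets of the target) to infinity-harmonic functions. A map $\varphi:(M,g)\to(N,h)$ is horizontally weakly conformal with dilation $\lambda:M\to[0,\infty)$ if, apart from the points where $d\varphi=0$ (where $\lambda=0$), $d\varphi_x$ is onto and $h(d\varphi_x(X),d\varphi_x(Y))=\lambda^2(x)g_x(X,Y)$ for all horizontal vectors $X,Y$, i.e. vectors in the orthogonal complement of $\ker d\varphi_x$. Vectors in $\ker d\varphi_x$ are called vertical. A horizontally weakly conformal map whose dilation $\lambda$ has vertical gradient is called horizontally homothetic. *)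

theory Defs
  imports "HOL-Analysis.Analysis"
begin

section \<open>Differentiability of class $C^k$ on open sets of Euclidean space\<close>

fun Ck_on :: "nat \<Rightarrow> ('a::euclidean_space \<Rightarrow> 'b::real_normed_vector) \<Rightarrow> 'a set \<Rightarrow> bool" where
  "Ck_on 0 f S \<longleftrightarrow> continuous_on S f"
| "Ck_on (Suc k) f S \<longleftrightarrow>
     (\<forall>x\<in>S. f differentiable (at x)) \<and>
     (\<forall>v. Ck_on k (\<lambda>x. frechet_derivative f (at x) v) S)"

definition smooth_on :: "('a::euclidean_space \<Rightarrow> 'b::real_normed_vector) \<Rightarrow> 'a set \<Rightarrow> bool" where
  "smooth_on f S \<longleftrightarrow> (\<forall>k. Ck_on k f S)"


section \<open>Riemannian manifolds\<close>

text \<open>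
  The points of a manifold form a Hausdorff, second countable topological space (a type of the
  classes \<open>t2_space\<close> and \<open>second_countable_topology\<close>); the model space is a Euclidean
  space. A chart is a pair of its domain and its coordinate map, the values of the latter outside
  the domain being irrelevant. The atlas need not be maximal.

  As no tangent bundle is available, the tangent space at \<open>x\<close> is taken to be the model space,
  identified with it through one fixed chart around \<open>x\<close>, selected by \<open>chart_at\<close>.
  Thus the metric at \<open>x\<close> is an inner product on the model space, a vector \<open>v\<close> standing
  for the tangent vector at \<open>x\<close> with coordinates \<open>v\<close> in the chart
  \<open>chart_at M x\<close>. Since this chart varies with \<open>x\<close> in an arbitrary manner,
  smoothness of the metric is not smoothness of \<open>\<lambda>x. metric M x v w\<close>; it is expressed by
  the coordinate fields of the charts.
\<close>

type_synonym ('m, 'a) chart = "'m set \<times> ('m \<Rightarrow> 'a)"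

definition chart_inv :: "('m, 'a) chart \<Rightarrow> 'a \<Rightarrow> 'm" where
  "chart_inv c = inv_into (fst c) (snd c)"

definition smooth_atlas ::
  "('m::topological_space, 'a::euclidean_space) chart set \<Rightarrow> bool" where
  "smooth_atlas A \<longleftrightarrow>
     (\<Union>c\<in>A. fst c) = UNIV \<and>
     (\<forall>c\<in>A. open (fst c) \<and> open (snd c ` fst c) \<and>
             homeomorphism (fst c) (snd c ` fst c) (snd c) (chart_inv c)) \<and>
     (\<forall>c\<in>A. \<forall>d\<in>A. smooth_on (snd d \<circ> chart_inv c) (snd c ` (fst c \<inter> fst d)))"

record ('m, 'a) riemannian =
  charts :: "('m, 'a) chart set"
  metric :: "'m \<Rightarrow> 'a \<Rightarrow> 'a \<Rightarrow> real"

definition chart_at :: "('m, 'a) riemannian \<Rightarrow> 'm \<Rightarrow> ('m, 'a) chart" where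
  "chart_at M x = (SOME c. c \<in> charts M \<and> x \<in> fst c)"

text \<open>The tangent vector at \<open>x\<close> whose coordinates in the chart \<open>c\<close> are \<open>v\<close>.\<close>

definition coord_vector ::
  "('m, 'a::euclidean_space) riemannian \<Rightarrow> ('m, 'a) chart \<Rightarrow> 'm \<Rightarrow> 'a \<Rightarrow> 'a" where
  "coord_vector M c x = frechet_derivative (snd (chart_at M x) \<circ> chart_inv c) (at (snd c x))"

definition riemannian_manifold ::
  "('m::{t2_space, second_countable_topology}, 'a::euclidean_space) riemannian \<Rightarrow> bool" where
  "riemannian_manifold M \<longleftrightarrow>
     smooth_atlas (charts M) \<and>
     (\<forall>x. bilinear (metric M x) \<and>
          (\<forall>v w. metric M x v w = metric M x w v) \<and>
          (\<forall>v. v \<noteq> 0 \<longrightarrow> metric M x v v > 0)) \<and>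
     (\<forall>c\<in>charts M. \<forall>v w.
        smooth_on (\<lambda>p. metric M (chart_inv c p)
                          (coord_vector M c (chart_inv c p) v)
                          (coord_vector M c (chart_inv c p) w))
                  (snd c ` fst c))"


section \<open>Maps and functions of class $C^k$, differentials and gradients\<close>

definition Ck_map ::
  "nat \<Rightarrow> ('m::topological_space, 'a::euclidean_space) riemannian \<Rightarrow>
   ('n::topological_space, 'b::euclidean_space) riemannian \<Rightarrow> ('m \<Rightarrow> 'n) \<Rightarrow> bool" where
  "Ck_map k M N \<phi> \<longleftrightarrow>
     continuous_on UNIV \<phi> \<and>
     (\<forall>c\<in>charts M. \<forall>d\<in>charts N.
        Ck_on k (snd d \<circ> \<phi> \<circ> chart_inv c) (snd c ` (fst c \<inter> \<phi> -` fst d)))"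

definition Ck_fun_on ::
  "nat \<Rightarrow> ('m::topological_space, 'a::euclidean_space) riemannian \<Rightarrow> 'm set \<Rightarrow>
   ('m \<Rightarrow> real) \<Rightarrow> bool" where
  "Ck_fun_on k M U u \<longleftrightarrow>
     (\<forall>c\<in>charts M. Ck_on k (u \<circ> chart_inv c) (snd c ` (fst c \<inter> U)))"

definition tangent_map ::
  "('m, 'a::euclidean_space) riemannian \<Rightarrow> ('n, 'b::euclidean_space) riemannian \<Rightarrow>
   ('m \<Rightarrow> 'n) \<Rightarrow> 'm \<Rightarrow> 'a \<Rightarrow> 'b" where
  "tangent_map M N \<phi> x =
     frechet_derivative (snd (chart_at N (\<phi> x)) \<circ> \<phi> \<circ> chart_inv (chart_at M x))
       (at (snd (chart_at M x) x))"

definition differentiable_fun_at ::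
  "('m, 'a::euclidean_space) riemannian \<Rightarrow> ('m \<Rightarrow> real) \<Rightarrow> 'm \<Rightarrow> bool" where
  "differentiable_fun_at M f x \<longleftrightarrow>
     (f \<circ> chart_inv (chart_at M x)) differentiable (at (snd (chart_at M x) x))"

definition differential ::
  "('m, 'a::euclidean_space) riemannian \<Rightarrow> ('m \<Rightarrow> real) \<Rightarrow> 'm \<Rightarrow> 'a \<Rightarrow> real" where
  "differential M f x =
     frechet_derivative (f \<circ> chart_inv (chart_at M x)) (at (snd (chart_at M x) x))"

definition gradient ::
  "('m, 'a::euclidean_space) riemannian \<Rightarrow> ('m \<Rightarrow> real) \<Rightarrow> 'm \<Rightarrow> 'a" where
  "gradient M f x = (THE v. \<forall>w. metric M x v w = differential M f x w)"


section \<open>Infinity-harmonic maps, functions and morphisms\<close>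

definition orthonormal_basis ::
  "('m, 'a::euclidean_space) riemannian \<Rightarrow> 'm \<Rightarrow> 'a set \<Rightarrow> bool" where
  "orthonormal_basis M x E \<longleftrightarrow>
     (\<forall>e\<in>E. \<forall>f\<in>E. metric M x e f = (if e = f then 1 else 0)) \<and> span E = UNIV"

text \<open>The value does not depend on the orthonormal basis chosen.\<close>

definition norm_sq_tangent_map ::
  "('m, 'a::euclidean_space) riemannian \<Rightarrow> ('n, 'b::euclidean_space) riemannian \<Rightarrow>
   ('m \<Rightarrow> 'n) \<Rightarrow> 'm \<Rightarrow> real" where
  "norm_sq_tangent_map M N \<phi> x =
     (\<Sum>e\<in>(SOME E. orthonormal_basis M x E).
        metric N (\<phi> x) (tangent_map M N \<phi> x e) (tangent_map M N \<phi> x e))"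

definition infinity_laplacian ::
  "('m, 'a::euclidean_space) riemannian \<Rightarrow> ('n, 'b::euclidean_space) riemannian \<Rightarrow>
   ('m \<Rightarrow> 'n) \<Rightarrow> 'm \<Rightarrow> 'b" where
  "infinity_laplacian M N \<phi> x =
     (1/2) *\<^sub>R tangent_map M N \<phi> x (gradient M (norm_sq_tangent_map M N \<phi>) x)"

definition infinity_harmonic_map ::
  "('m::topological_space, 'a::euclidean_space) riemannian \<Rightarrow>
   ('n::topological_space, 'b::euclidean_space) riemannian \<Rightarrow> ('m \<Rightarrow> 'n) \<Rightarrow> bool" where
  "infinity_harmonic_map M N \<phi> \<longleftrightarrow>
     Ck_map 2 M N \<phi> \<and> (\<forall>x. infinity_laplacian M N \<phi> x = 0)"

text \<open>Real-valued functions defined on an open subset \<open>U\<close>; values outside \<open>U\<close> are irrelevant.\<close>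

definition infinity_harmonic_fun_on ::
  "('m::topological_space, 'a::euclidean_space) riemannian \<Rightarrow> 'm set \<Rightarrow> ('m \<Rightarrow> real) \<Rightarrow> bool" where
  "infinity_harmonic_fun_on M U u \<longleftrightarrow>
     open U \<and> Ck_fun_on 2 M U u \<and>
     (\<forall>x\<in>U. (1/2) * metric M x (gradient M u x)
                (gradient M (\<lambda>y. metric M y (gradient M u y) (gradient M u y)) x) = 0)"

definition infinity_harmonic_morphism ::
  "('m::topological_space, 'a::euclidean_space) riemannian \<Rightarrow>
   ('n::topological_space, 'b::euclidean_space) riemannian \<Rightarrow> ('m \<Rightarrow> 'n) \<Rightarrow> bool" where
  "infinity_harmonic_morphism M N \<phi> \<longleftrightarrow>
     (\<forall>V u. infinity_harmonic_fun_on N V u \<longrightarrow>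
            infinity_harmonic_fun_on M (\<phi> -` V) (u \<circ> \<phi>))"


section \<open>Horizontal conformality\<close>

definition vertical_space ::
  "('m, 'a::euclidean_space) riemannian \<Rightarrow> ('n, 'b::euclidean_space) riemannian \<Rightarrow>
   ('m \<Rightarrow> 'n) \<Rightarrow> 'm \<Rightarrow> 'a set" where
  "vertical_space M N \<phi> x = {v. tangent_map M N \<phi> x v = 0}"

definition horizontal_space ::
  "('m, 'a::euclidean_space) riemannian \<Rightarrow> ('n, 'b::euclidean_space) riemannian \<Rightarrow>
   ('m \<Rightarrow> 'n) \<Rightarrow> 'm \<Rightarrow> 'a set" where
  "horizontal_space M N \<phi> x = {w. \<forall>v\<in>vertical_space M N \<phi> x. metric M x w v = 0}"

definition critical_point ::
  "('m, 'a::euclidean_space) riemannian \<Rightarrow> ('n, 'b::euclidean_space) riemannian \<Rightarrow>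
   ('m \<Rightarrow> 'n) \<Rightarrow> 'm \<Rightarrow> bool" where
  "critical_point M N \<phi> x \<longleftrightarrow> tangent_map M N \<phi> x = (\<lambda>_. 0)"

definition has_dilation ::
  "('m, 'a::euclidean_space) riemannian \<Rightarrow> ('n, 'b::euclidean_space) riemannian \<Rightarrow>
   ('m \<Rightarrow> 'n) \<Rightarrow> ('m \<Rightarrow> real) \<Rightarrow> bool" where
  "has_dilation M N \<phi> dil \<longleftrightarrow>
     (\<forall>x. dil x \<ge> 0 \<and>
       (if critical_point M N \<phi> x then dil x = 0
        else surj (tangent_map M N \<phi> x) \<and>
             (\<forall>v\<in>horizontal_space M N \<phi> x. \<forall>w\<in>horizontal_space M N \<phi> x.
                metric N (\<phi> x) (tangent_map M N \<phi> x v) (tangent_map M N \<phi> x w)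
                  = (dil x)\<^sup>2 * metric M x v w)))"

definition horizontally_weakly_conformal ::
  "('m, 'a::euclidean_space) riemannian \<Rightarrow> ('n, 'b::euclidean_space) riemannian \<Rightarrow>
   ('m \<Rightarrow> 'n) \<Rightarrow> bool" where
  "horizontally_weakly_conformal M N \<phi> \<longleftrightarrow> (\<exists>dil. has_dilation M N \<phi> dil)"

text \<open>
  The dilation is uniquely determined. At a critical point it need not be differentiable; there the
  vertical space is the whole tangent space, so that verticality of the gradient is no condition.
\<close>

definition horizontally_homothetic ::
  "('m, 'a::euclidean_space) riemannian \<Rightarrow> ('n, 'b::euclidean_space) riemannian \<Rightarrow>
   ('m \<Rightarrow> 'n) \<Rightarrow> bool" where
  "horizontally_homothetic M N \<phi> \<longleftrightarrow>
     (\<exists>dil. has_dilation M N \<phi> dil \<and>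
       (\<forall>x. \<not> critical_point M N \<phi> x \<longrightarrow>
          differentiable_fun_at M dil x \<and> gradient M dil x \<in> vertical_space M N \<phi> x))"

end

theory Submission
  imports Defs
begin

text \<open>
  Write \<open>T\<close> for the differential of \<open>\<phi>\<close> at a point, \<open>T\<^sup>*\<close> for its adjoint with respect to the two
  metrics, and \<open>n\<close> for the dimension of \<open>N\<close>. Everything rests on the composition \<open>T T\<^sup>*\<close>:

  \<^item> \<open>\<phi>\<close> is horizontally weakly conformal with dilation \<open>\<lambda>\<close> iff \<open>T T\<^sup>* = \<lambda>\<^sup>2 id\<close> at every point
    (lemma \<open>has_dilation_iff\<close>);
  \<^item> \<open>grad (u \<circ> \<phi>) = T\<^sup>* (grad u)\<close>, so that \<open>|grad (u \<circ> \<phi>)|\<^sup>2 = \<lambda>\<^sup>2 |grad u|\<^sup>2\<close> for a conformal \<open>\<phi>\<close>;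
  \<^item> \<open>|d\<phi>|\<^sup>2\<close> is the trace of \<open>T T\<^sup>*\<close>, hence \<open>n \<lambda>\<^sup>2\<close> for a conformal \<open>\<phi>\<close>.

  For a horizontally weakly conformal map the infinity Laplacian is therefore \<open>n \<lambda> T (grad \<lambda>)\<close>, and
  it vanishes iff the gradient of \<open>\<lambda>\<close> is vertical; this is the second equivalence. It needs \<open>\<lambda>\<close> to be
  differentiable away from the critical points, which holds because \<open>\<lambda>\<^sup>2\<close> is the quotient of
  \<open>|grad (u \<circ> \<phi>)|\<^sup>2\<close> by \<open>|grad u|\<^sup>2\<close> for a coordinate function \<open>u\<close>. The chain rule then
  also shows that a horizontally homothetic map pulls infinity-harmonic functions back to
  infinity-harmonic functions.

  The substance lies in the remaining implication, from infinity-harmonic morphisms to horizontally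
  homothetic maps: it needs enough infinity-harmonic functions on an arbitrary target. They are found
  among the solutions of the eikonal equation \<open>|grad u|\<^sup>2 = const\<close>. Given a nonzero tangent vector \<open>\<beta>\<close> at a
  point and a number \<open>\<kappa>\<close>, the method of characteristics (lemma \<open>eikonal_solution\<close>) yields such a
  \<open>u\<close> with gradient \<open>\<beta>\<close> whose second derivative, as a quadratic form on the orthogonal complement
  of \<open>\<beta>\<close> in a chart, is \<open>\<kappa>\<close> times a fixed definite form: the initial hypersurface \<open>u = 0\<close>
  is a paraboloid of curvature \<open>\<kappa>\<close>. The value of the infinity Laplacian of \<open>u \<circ> \<phi>\<close> at a point depends on the second derivative of \<open>u\<close> only through its
  value on the vector \<open>T T\<^sup>* \<beta>\<close>. As it vanishes for every \<open>\<kappa>\<close>, this vector has no component orthogonal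
  to \<open>\<beta>\<close>. Thus every vector is an eigenvector of \<open>T T\<^sup>*\<close>, so \<open>T T\<^sup>* = \<lambda>\<^sup>2 id\<close>, and
  \<open>|grad (u \<circ> \<phi>)|\<^sup>2\<close> is a constant multiple of \<open>\<lambda>\<^sup>2\<close>; its derivative in the
  direction \<open>T\<^sup>* \<beta>\<close> vanishes for every \<open>\<beta>\<close>, which says that \<open>grad \<lambda>\<close> is vertical.

  The characteristics are the integral curves of the Hamiltonian field of \<open>H (x, p) = |p|\<^sup>2 / 2\<close>,
  with \<open>|p|\<close> the norm of the covector \<open>p\<close> at \<open>x\<close>. They
  require a local flow that depends on its initial value in a \<open>C\<^sup>1\<close> manner (lemma \<open>flow_C1\<close>). That
  the momentum along the characteristics is the differential of a function is the Gauss lemma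
  (\<open>gauss_identity\<close>).
\<close>

section \<open>Functions of class $C^k$\<close>

lemma Ck_on_Suc_has_derivative:
  assumes "Ck_on (Suc k) f S" "x \<in> S"
  shows "(f has_derivative frechet_derivative f (at x)) (at x)"
  using assms frechet_derivative_works by auto

text \<open>The predicate only looks at the points of \<open>S\<close>, but each derivative is taken in the whole space; it is
  the openness of \<open>S\<close> that makes these derivatives depend on the values on \<open>S\<close> alone.\<close>

lemma Ck_on_cong:
  assumes "open S" "\<And>x. x \<in> S \<Longrightarrow> f x = g x" "Ck_on k f S"
  shows "Ck_on k g S"
  using assms(2,3)
proof (induction k arbitrary: f g)
  case 0
  then show ?case using continuous_on_cong[of S S f g] by simp
next
  case (Suc k)
  have d: "(g has_derivative frechet_derivative f (at x)) (at x)" if "x \<in> S" for x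
    using has_derivative_transform_within_open[OF Ck_on_Suc_has_derivative[OF Suc.prems(2) that] \<open>open S\<close> that]
      Suc.prems(1) by blast
  have e: "frechet_derivative f (at x) = frechet_derivative g (at x)" if "x \<in> S" for x
    by (rule frechet_derivative_at[OF d[OF that]])
  show ?case
    unfolding Ck_on.simps
  proof (intro conjI ballI allI)
    show "g differentiable at x" if "x \<in> S" for x
      using d[OF that] differentiable_def by blast
    show "Ck_on k (\<lambda>x. frechet_derivative g (at x) v) S" for v
    proof (rule Suc.IH)
      show "frechet_derivative f (at x) v = frechet_derivative g (at x) v" if "x \<in> S" for x
        by (simp add: e that)
      show "Ck_on k (\<lambda>x. frechet_derivative f (at x) v) S" using Suc.prems(2) by simp
    qed
  qed
qed

text \<open>The usual way to raise the order: any family of linear maps that are the derivatives may serve in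
  place of the chosen one.\<close>

lemma Ck_on_SucI:
  assumes "open S" "\<And>x. x \<in> S \<Longrightarrow> (f has_derivative f' x) (at x)"
    and "\<And>v. Ck_on k (\<lambda>x. f' x v) S"
  shows "Ck_on (Suc k) f S"
  unfolding Ck_on.simps
proof (intro conjI ballI allI)
  show "f differentiable at x" if "x \<in> S" for x
    using assms(2)[OF that] differentiable_def by blast
  show "Ck_on k (\<lambda>x. frechet_derivative f (at x) v) S" for v
  proof (rule Ck_on_cong[OF assms(1) _ assms(3)])
    show "f' x v = frechet_derivative f (at x) v" if "x \<in> S" for x
      using frechet_derivative_at[OF assms(2)[OF that]] by simp
  qed
qed

lemma Ck_on_subset: "Ck_on k f T \<Longrightarrow> S \<subseteq> T \<Longrightarrow> Ck_on k f S"
proof (induction k arbitrary: f)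
  case (Suc k)
  then show ?case by (simp add: subset_iff)
qed (simp add: continuous_on_subset)

lemma Ck_on_Suc_lower: "Ck_on (Suc k) f S \<Longrightarrow> Ck_on k f S"
proof (induction k arbitrary: f)
  case 0
  then have "f differentiable_on S"
    by (simp add: differentiable_on_def differentiable_at_withinI)
  then show ?case by (simp add: differentiable_imp_continuous_on)
next
  case (Suc k)
  have "f differentiable at x" if "x \<in> S" for x using Suc.prems that by simp
  moreover have "Ck_on k (\<lambda>x. frechet_derivative f (at x) v) S" for v
    using iffD1[OF Ck_on.simps(2) Suc.prems] by (intro Suc.IH) blast
  ultimately show ?case by simp
qed

lemma Ck_on_lower: "Ck_on k f S \<Longrightarrow> j \<le> k \<Longrightarrow> Ck_on j f S"
proof (induction k)
  case (Suc k)
  then show ?case using Ck_on_Suc_lower[OF Suc.prems(1)] by (cases "j = Suc k") auto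
qed simp

lemma Ck_on_continuous_on: "Ck_on k f S \<Longrightarrow> continuous_on S f"
  using Ck_on_lower[of k f S 0] by simp

lemma Ck_on_local:
  assumes "\<And>x. x \<in> S \<Longrightarrow> \<exists>U. open U \<and> x \<in> U \<and> Ck_on k f (U \<inter> S)"
  shows "Ck_on k f S"
  using assms
proof (induction k arbitrary: f)
  case 0
  have "continuous (at x within S) f" if x: "x \<in> S" for x
  proof -
    obtain U where U: "open U" "x \<in> U" "continuous_on (U \<inter> S) f" using 0 x by auto
    then have "continuous (at x within (U \<inter> S)) f"
      using x by (simp add: continuous_on_eq_continuous_within)
    then show ?thesis
      using at_within_nhd[OF U(2,1), of "U \<inter> S" S] by (simp add: Int_ac)
  qed
  then show ?case by (simp add: continuous_on_eq_continuous_within)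
next
  case (Suc k)
  show ?case
    unfolding Ck_on.simps
  proof (intro conjI ballI allI)
    show "f differentiable at x" if "x \<in> S" for x
    proof -
      obtain U where "x \<in> U" "Ck_on (Suc k) f (U \<inter> S)" using Suc.prems \<open>x \<in> S\<close> by blast
      then show ?thesis using \<open>x \<in> S\<close> by simp
    qed
    show "Ck_on k (\<lambda>x. frechet_derivative f (at x) v) S" for v
    proof (rule Suc.IH)
      fix x assume "x \<in> S"
      then obtain U where "open U" "x \<in> U" "Ck_on (Suc k) f (U \<inter> S)" using Suc.prems by blast
      then show "\<exists>U. open U \<and> x \<in> U \<and> Ck_on k (\<lambda>x. frechet_derivative f (at x) v) (U \<inter> S)"
        by (intro exI[of _ U]) simp
    qed
  qed
qed

lemma Ck_on_const: "open S \<Longrightarrow> Ck_on k (\<lambda>x. c) S"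
proof (induction k arbitrary: c)
  case (Suc k)
  show ?case by (rule Ck_on_SucI[where f'="\<lambda>_ _. 0"]) (use Suc in simp_all)
qed simp

lemma Ck_on_bounded_linear: "open S \<Longrightarrow> bounded_linear h \<Longrightarrow> Ck_on k h S"
proof (cases k)
  case (Suc j)
  assume "open S" "bounded_linear h"
  then show ?thesis
    unfolding Suc
    by (intro Ck_on_SucI[where f'="\<lambda>_. h"] Ck_on_const bounded_linear_imp_has_derivative)
qed (simp add: linear_continuous_on)

lemma Ck_on_add:
  "open S \<Longrightarrow> Ck_on k f S \<Longrightarrow> Ck_on k g S \<Longrightarrow> Ck_on k (\<lambda>x. f x + g x) S"
proof (induction k arbitrary: f g)
  case (Suc k)
  show ?case
  proof (rule Ck_on_SucI[OF Suc.prems(1)])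
    show "((\<lambda>x. f x + g x) has_derivative
        (\<lambda>v. frechet_derivative f (at x) v + frechet_derivative g (at x) v)) (at x)" if "x \<in> S" for x
      by (intro has_derivative_add Suc.prems(2,3)[THEN Ck_on_Suc_has_derivative] that)
    show "Ck_on k (\<lambda>x. frechet_derivative f (at x) v + frechet_derivative g (at x) v) S" for v
      using Suc.prems by (intro Suc.IH) auto
  qed
qed (simp add: continuous_on_add)

lemma Ck_on_sum:
  assumes "open S" "\<And>i. i \<in> I \<Longrightarrow> Ck_on k (f i) S"
  shows "Ck_on k (\<lambda>x. \<Sum>i\<in>I. f i x) S"
  using assms(2) by (induction I rule: infinite_finite_induct)
    (auto intro: Ck_on_const Ck_on_add \<open>open S\<close>)

lemma Ck_on_bilinear:
  assumes "bounded_bilinear p" "open S"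
  shows "Ck_on k f S \<Longrightarrow> Ck_on k g S \<Longrightarrow> Ck_on k (\<lambda>x. p (f x) (g x)) S"
proof (induction k arbitrary: f g)
  case 0
  then show ?case using bounded_bilinear.continuous_on[OF assms(1)] by auto
next
  case (Suc k)
  show ?case
  proof (rule Ck_on_SucI[OF assms(2)])
    show "((\<lambda>x. p (f x) (g x)) has_derivative
        (\<lambda>v. p (f x) (frechet_derivative g (at x) v) + p (frechet_derivative f (at x) v) (g x))) (at x)"
      if "x \<in> S" for x
      by (intro bounded_bilinear.FDERIV[OF assms(1)] Suc.prems[THEN Ck_on_Suc_has_derivative] that)
    show "Ck_on k (\<lambda>x. p (f x) (frechet_derivative g (at x) v)
        + p (frechet_derivative f (at x) v) (g x)) S" for v
      using Suc.prems by (intro Ck_on_add Suc.IH assms(2) Suc.prems[THEN Ck_on_Suc_lower]) auto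
  qed
qed

lemmas Ck_on_scaleR = Ck_on_bilinear[OF bounded_bilinear_scaleR]
lemmas Ck_on_mult = Ck_on_bilinear[OF bounded_bilinear_mult]
lemmas Ck_on_inner = Ck_on_bilinear[OF bounded_bilinear_inner]

lemma Ck_on_linear_image:
  assumes "bounded_linear h" "open S" "Ck_on k f S"
  shows "Ck_on k (\<lambda>x. h (f x)) S"
  using assms(3)
proof (induction k arbitrary: f)
  case 0
  then show ?case using bounded_linear.continuous_on[OF assms(1)] by auto
next
  case (Suc k)
  show ?case
  proof (rule Ck_on_SucI[OF assms(2)])
    show "((\<lambda>x. h (f x)) has_derivative (\<lambda>v. h (frechet_derivative f (at x) v))) (at x)"
      if "x \<in> S" for x
      by (intro bounded_linear.has_derivative[OF assms(1)] Suc.prems[THEN Ck_on_Suc_has_derivative] that)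
    show "Ck_on k (\<lambda>x. h (frechet_derivative f (at x) v)) S" for v
      using Suc.prems by (intro Suc.IH) auto
  qed
qed

lemma linear_eq_sum_Basis:
  fixes h :: "'a::euclidean_space \<Rightarrow> 'b::real_vector"
  assumes "linear h"
  shows "h v = (\<Sum>b\<in>Basis. (v \<bullet> b) *\<^sub>R h b)"
  by (metis (no_types, lifting) assms euclidean_representation linear_scale linear_sum sum.cong)

lemma linear_functional_inner:
  fixes A :: "'a::euclidean_space \<Rightarrow> real"
  assumes "linear A"
  shows "(\<Sum>b\<in>Basis. A b *\<^sub>R b) \<bullet> v = A v"
  using linear_eq_sum_Basis[OF assms, of v]
  by (simp add: inner_sum_left inner_commute[of v] mult.commute)

text \<open>In an orthonormal basis \<open>D(g \<circ> f) v\<close> is the sum of the products of the coordinates of \<open>Df v\<close> with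
  the partial derivatives of \<open>g\<close> along \<open>f\<close>. The latter are again compositions, of one order less, which
  makes the induction work.\<close>

lemma Ck_on_compose:
  fixes f :: "'a::euclidean_space \<Rightarrow> 'b::euclidean_space" and g :: "'b \<Rightarrow> 'c::real_normed_vector"
  assumes "open S" "open T" "f ` S \<subseteq> T"
  shows "Ck_on k f S \<Longrightarrow> Ck_on k g T \<Longrightarrow> Ck_on k (\<lambda>x. g (f x)) S"
proof (induction k arbitrary: g)
  case 0
  then show ?case using assms(3) continuous_on_compose2 by auto
next
  case (Suc k)
  define f' where "f' x = frechet_derivative f (at x)" for x
  define g' where "g' y = frechet_derivative g (at y)" for y
  have f': "(f has_derivative f' x) (at x)" if "x \<in> S" for x
    using Ck_on_Suc_has_derivative[OF Suc.prems(1) that] by (simp add: f'_def)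
  have g': "(g has_derivative g' y) (at y)" if "y \<in> T" for y
    using Ck_on_Suc_has_derivative[OF Suc.prems(2) that] by (simp add: g'_def)
  have gf: "((\<lambda>x. g (f x)) has_derivative (\<lambda>v. \<Sum>b\<in>Basis. (f' x v \<bullet> b) *\<^sub>R g' (f x) b)) (at x)"
    if "x \<in> S" for x
  proof -
    have fx: "f x \<in> T" using that assms(3) by auto
    have "linear (g' (f x))" using g'[OF fx] has_derivative_linear by blast
    then have "(\<lambda>v. \<Sum>b\<in>Basis. (f' x v \<bullet> b) *\<^sub>R g' (f x) b) = (\<lambda>v. g' (f x) (f' x v))"
      by (simp add: linear_eq_sum_Basis[symmetric] fun_eq_iff)
    then show ?thesis
      using diff_chain_at[OF f'[OF that] g'[OF fx]] by (simp add: o_def)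
  qed
  show ?case
  proof (rule Ck_on_SucI[OF assms(1) gf])
    fix v
    show "Ck_on k (\<lambda>x. \<Sum>b\<in>Basis. (f' x v \<bullet> b) *\<^sub>R g' (f x) b) S"
    proof (intro Ck_on_sum Ck_on_scaleR assms(1) Ck_on_inner Ck_on_const)
      show "Ck_on k (\<lambda>x. f' x v) S" using Suc.prems(1) by (simp add: f'_def)
      show "Ck_on k (\<lambda>x. g' (f x) b) S" for b
        by (rule Suc.IH[OF Ck_on_Suc_lower[OF Suc.prems(1)]]) (use Suc.prems in \<open>simp add: g'_def\<close>)
    qed
  qed
qed

lemma Ck_on_Pair:
  fixes f :: "'a::euclidean_space \<Rightarrow> 'b::euclidean_space" and g :: "'a \<Rightarrow> 'c::euclidean_space"
  assumes "open S" "Ck_on k f S" "Ck_on k g S"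
  shows "Ck_on k (\<lambda>x. (f x, g x)) S"
proof -
  have "Ck_on k (\<lambda>x. (f x, 0) + (0, g x)) S"
    by (intro Ck_on_add assms(1) Ck_on_linear_image[OF _ assms(1,2)] Ck_on_linear_image[OF _ assms(1,3)]
        bounded_linear_Pair bounded_linear_ident bounded_linear_zero)
  then show ?thesis by simp
qed

text \<open>At a zero of one factor, continuity of the other factor suffices for the product rule. This is how
  the inverse of a family of linear maps is differentiated before it is known to be differentiable.\<close>

lemma has_derivative_scaleR_zero:
  fixes q :: "'a::real_normed_vector \<Rightarrow> real" and r :: "'a \<Rightarrow> 'b::real_normed_vector"
  assumes q: "(q has_derivative q') (at x)" and "q x = 0" and r: "isCont r x"
  shows "((\<lambda>y. q y *\<^sub>R r y) has_derivative (\<lambda>w. q' w *\<^sub>R r x)) (at x)"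
proof -
  have bl: "bounded_linear q'" using q has_derivative_bounded_linear by blast
  then obtain K where K: "\<And>w. norm (q' w) \<le> norm w * K" and K0: "0 \<le> K"
    using bounded_linear.nonneg_bounded by blast
  have l1: "((\<lambda>y. ((q y - q x - q' (y - x)) /\<^sub>R norm (y - x))) \<longlongrightarrow> 0) (at x)"
    using q by (simp add: has_derivative_at_within)
  have l2: "((\<lambda>y. r y - r x) \<longlongrightarrow> 0) (at x)"
    using r by (simp add: isCont_def LIM_zero)
  have l3: "((\<lambda>y. (q' (y - x) / norm (y - x)) *\<^sub>R (r y - r x)) \<longlongrightarrow> 0) (at x)"
  proof (rule tendsto_0_le[OF l2, of _ K])
    show "\<forall>\<^sub>F y in at x. norm ((q' (y - x) / norm (y - x)) *\<^sub>R (r y - r x)) \<le> norm (r y - r x) * K"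
    proof (intro always_eventually allI)
      fix y
      have "\<bar>q' (y - x)\<bar> / norm (y - x) \<le> K"
        using K[of "y - x"] order_trans[OF abs_ge_zero, of "q' (y - x)" "norm (y - x) * K"]
        by (cases "y = x") (auto simp: divide_le_eq mult.commute K0)
      then show "norm ((q' (y - x) / norm (y - x)) *\<^sub>R (r y - r x)) \<le> norm (r y - r x) * K"
        using mult_right_mono[of "\<bar>q' (y - x)\<bar> / norm (y - x)" K "norm (r y - r x)"]
        by (simp add: mult.commute)
    qed
  qed
  have "((\<lambda>y. ((q y - q x - q' (y - x)) /\<^sub>R norm (y - x)) *\<^sub>R r y
       + (q' (y - x) / norm (y - x)) *\<^sub>R (r y - r x)) \<longlongrightarrow> 0 *\<^sub>R r x + 0) (at x)"
    using l1 l3 r by (intro tendsto_add tendsto_scaleR) (auto simp: isCont_def)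
  then have "((\<lambda>y. (q y *\<^sub>R r y - q x *\<^sub>R r x - q' (y - x) *\<^sub>R r x) /\<^sub>R norm (y - x)) \<longlongrightarrow> 0) (at x)"
    by (simp add: \<open>q x = 0\<close> algebra_simps divide_inverse)
  then show ?thesis
    by (simp add: has_derivative_at_within bounded_linear_scaleR_const[OF bl])
qed

text \<open>Inversion of linear maps is smooth. From \<open>B y v - B x v = - B y ((A y - A x) (B x v))\<close> one reads off,
  first, continuity once the norms of the \<open>B y\<close> are bounded near \<open>x\<close>, and then the derivative
  \<open>- B (DA) B\<close>. As the latter is a polynomial in the entries of \<open>B\<close> and \<open>DA\<close>, the order
  of differentiability follows by induction.\<close>

lemma Ck_on_inverse_family:
  fixes A B :: "'x::euclidean_space \<Rightarrow> 'b::euclidean_space \<Rightarrow> 'b"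
  assumes "open S" and linA: "\<And>x. x \<in> S \<Longrightarrow> linear (A x)" and linB: "\<And>x. x \<in> S \<Longrightarrow> linear (B x)"
    and BA: "\<And>x v. x \<in> S \<Longrightarrow> B x (A x v) = v" and AB: "\<And>x v. x \<in> S \<Longrightarrow> A x (B x v) = v"
  shows "(\<And>v. Ck_on k (\<lambda>x. A x v) S) \<Longrightarrow> Ck_on k (\<lambda>x. B x v) S"
proof (induction k arbitrary: v)
  case 0
  have "isCont (\<lambda>y. B y v) x" if x: "x \<in> S" for x
  proof -
    obtain K where K: "K > 0" "\<And>w. norm (B x w) \<le> K * norm w"
      using linear_bounded_pos[OF linB[OF x]] by (auto simp: mult.commute)
    have contA: "isCont (\<lambda>y. A y b) x" for b
      using 0 \<open>open S\<close> x by (simp add: continuous_on_eq_continuous_at)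
    have "isCont (\<lambda>y. \<Sum>b\<in>Basis. norm (A y b - A x b)) x"
      by (intro continuous_intros contA)
    then have "((\<lambda>y. \<Sum>b\<in>Basis. norm (A y b - A x b)) \<longlongrightarrow> 0) (at x)"
      by (simp add: isCont_def)
    then have ev: "\<forall>\<^sub>F y in at x. (\<Sum>b\<in>Basis. norm (A y b - A x b)) < 1 / (2 * K)"
      by (rule order_tendstoD) (use K in simp)
    have evS: "\<forall>\<^sub>F y in at x. y \<in> S" using \<open>open S\<close> x eventually_at_topological by blast
    \<comment> \<open>If \<open>A y\<close> is close to \<open>A x\<close>, the lower bound \<open>norm u \<le> K * norm (A x u)\<close> survives with \<open>2 * K\<close>.\<close>
    have bound: "norm (B y w) \<le> 2 * K * norm w"
      if y: "y \<in> S" and small: "(\<Sum>b\<in>Basis. norm (A y b - A x b)) < 1 / (2 * K)" for y w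
    proof -
      define u where "u = B y w"
      have "A x u - A y u = (\<Sum>b\<in>Basis. (u \<bullet> b) *\<^sub>R (A x b - A y b))"
        using linear_eq_sum_Basis[OF linA[OF x], of u] linear_eq_sum_Basis[OF linA[OF y], of u]
        by (simp add: sum_subtractf scaleR_diff_right)
      then have "norm (A x u - A y u) \<le> (\<Sum>b\<in>Basis. norm ((u \<bullet> b) *\<^sub>R (A x b - A y b)))"
        using norm_sum by metis
      also have "\<dots> \<le> (\<Sum>b\<in>Basis. norm u * norm (A y b - A x b))"
        by (intro sum_mono) (simp add: Basis_le_norm mult_right_mono norm_minus_commute)
      also have "\<dots> \<le> norm u * (1 / (2 * K))"
        unfolding sum_distrib_left[symmetric] using small by (intro mult_left_mono) auto
      finally have le: "norm (A x u - A y u) \<le> norm u / (2 * K)" by simp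
      have "norm u = norm (B x (A x u))" by (simp add: BA x)
      also have "\<dots> \<le> K * norm (A x u)" by (rule K)
      also have "\<dots> \<le> K * (norm (A y u) + norm u / (2 * K))"
      proof (intro mult_left_mono)
        show "norm (A x u) \<le> norm (A y u) + norm u / (2 * K)"
          using norm_triangle_ineq[of "A y u" "A x u - A y u"] le by simp
      qed (use K in simp)
      also have "\<dots> = K * norm w + norm u / 2" using K by (simp add: u_def AB y field_simps)
      finally show ?thesis by (simp add: u_def)
    qed
    have "((\<lambda>y. B y v - B x v) \<longlongrightarrow> 0) (at x)"
    proof (rule tendsto_0_le[of "\<lambda>y. A x (B x v) - A y (B x v)" _ _ "2 * K"])
      show "((\<lambda>y. A x (B x v) - A y (B x v)) \<longlongrightarrow> 0) (at x)"
        using tendsto_diff[OF tendsto_const, of "\<lambda>y. A y (B x v)" "A x (B x v)" "at x" "A x (B x v)"]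
          contA[of "B x v"] by (simp add: isCont_def)
      show "\<forall>\<^sub>F y in at x. norm (B y v - B x v) \<le> norm (A x (B x v) - A y (B x v)) * (2 * K)"
        using ev evS
      proof eventually_elim
        case (elim y)
        have "B y v - B x v = B y (A x (B x v) - A y (B x v))"
          using elim by (simp add: linear_diff[OF linB] AB BA x)
        then show ?case
          using bound[OF elim(2,1), of "A x (B x v) - A y (B x v)"] by (simp only: mult.commute)
      qed
    qed
    then show ?thesis by (simp add: isCont_def LIM_zero_iff)
  qed
  then show ?case using \<open>open S\<close> by (simp add: continuous_on_eq_continuous_at)
next
  case (Suc k)
  define A' where "A' x u = frechet_derivative (\<lambda>x. A x u) (at x)" for x u
  have A': "((\<lambda>x. A x u) has_derivative A' x u) (at x)" if "x \<in> S" for x u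
    using Ck_on_Suc_has_derivative[OF Suc.prems that] by (simp add: A'_def)
  have IH: "Ck_on k (\<lambda>x. B x v) S" for v
    using Suc Ck_on_Suc_lower by blast
  define D where "D x w = - (\<Sum>b\<in>Basis. (\<Sum>c\<in>Basis. (B x v \<bullet> c) * (A' x c w \<bullet> b)) *\<^sub>R B x b)" for x w
  have "((\<lambda>y. B y v) has_derivative D x) (at x)" if x: "x \<in> S" for x
  proof -
    define u where "u = B x v"
    have A'lin: "A' x u w = (\<Sum>c\<in>Basis. (u \<bullet> c) *\<^sub>R A' x c w)" for w
    proof -
      have "((\<lambda>y. A y u) has_derivative (\<lambda>w. \<Sum>c\<in>Basis. (u \<bullet> c) *\<^sub>R A' x c w)) (at x)"
      proof (rule has_derivative_transform_within_open[OF _ \<open>open S\<close> x])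
        show "((\<lambda>y. \<Sum>c\<in>Basis. (u \<bullet> c) *\<^sub>R A y c) has_derivative (\<lambda>w. \<Sum>c\<in>Basis. (u \<bullet> c) *\<^sub>R A' x c w)) (at x)"
          by (intro has_derivative_sum has_derivative_scaleR_right A' x)
      qed (use linear_eq_sum_Basis linA in metis)
      then show ?thesis using has_derivative_unique[OF A'[OF x, of u]] by (simp add: fun_eq_iff)
    qed
    \<comment> \<open>The coordinates of \<open>(A y - A x) u\<close>, which vanish at \<open>y = x\<close>.\<close>
    define q where "q b y = (A y u - A x u) \<bullet> b" for b y
    have d': "((\<lambda>y. u - (\<Sum>b\<in>Basis. q b y *\<^sub>R B y b)) has_derivative
          (\<lambda>w. 0 - (\<Sum>b\<in>Basis. (A' x u w \<bullet> b) *\<^sub>R B x b))) (at x)"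
    proof (intro has_derivative_diff has_derivative_const has_derivative_sum has_derivative_scaleR_zero)
      fix b :: 'b
      have "((\<lambda>y. (A y u - A x u) \<bullet> b) has_derivative (\<lambda>w. (A' x u w - 0) \<bullet> b)) (at x)"
        by (intro has_derivative_inner_left has_derivative_diff A' x has_derivative_const)
      then show "(q b has_derivative (\<lambda>w. A' x u w \<bullet> b)) (at x)"
        by (simp add: q_def[abs_def])
      show "q b x = 0" by (simp add: q_def)
      show "isCont (\<lambda>y. B y b) x"
        using Ck_on_continuous_on[OF IH] \<open>open S\<close> x by (simp add: continuous_on_eq_continuous_at)
    qed
    have "D x = (\<lambda>w. 0 - (\<Sum>b\<in>Basis. (A' x u w \<bullet> b) *\<^sub>R B x b))"
      unfolding D_def A'lin by (simp add: fun_eq_iff u_def inner_sum_left)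
    with d' have d: "((\<lambda>y. u - (\<Sum>b\<in>Basis. q b y *\<^sub>R B y b)) has_derivative D x) (at x)"
      by metis
    have eq: "u - (\<Sum>b\<in>Basis. q b y *\<^sub>R B y b) = B y v" if y: "y \<in> S" for y
    proof -
      have "(\<Sum>b\<in>Basis. q b y *\<^sub>R B y b) = B y (A y u - A x u)"
        unfolding q_def using linear_eq_sum_Basis[OF linB[OF y]] by metis
      then show ?thesis using x y by (simp add: linear_diff[OF linB] BA AB u_def)
    qed
    show ?thesis by (rule has_derivative_transform_within_open[OF d \<open>open S\<close> x eq])
  qed
  then show ?case
  proof (rule Ck_on_SucI[OF \<open>open S\<close>])
    show "Ck_on k (\<lambda>x. D x w) S" for w
      unfolding D_def using Suc.prems
      by (intro Ck_on_linear_image[OF bounded_linear_minus[OF bounded_linear_ident]]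
          Ck_on_sum Ck_on_scaleR Ck_on_mult Ck_on_inner Ck_on_const IH \<open>open S\<close>)
        (simp add: A'_def)
  qed
qed

text \<open>The form in which the derivative enters the inverse function theorem and the rules for partial
  derivatives: directionwise continuity is continuity in the operator norm, as the dimension is finite.\<close>

lemma Ck_on_1_blinfun:
  fixes f :: "'a::euclidean_space \<Rightarrow> 'b::real_normed_vector"
  assumes "Ck_on (Suc 0) f S"
  obtains f' where "\<And>x. x \<in> S \<Longrightarrow> (f has_derivative blinfun_apply (f' x)) (at x)"
    and "continuous_on S f'"
proof
  define f' where "f' x = Blinfun (frechet_derivative f (at x))" for x
  have app: "blinfun_apply (f' x) = frechet_derivative f (at x)" if "x \<in> S" for x
    unfolding f'_def using assms that
    by (intro bounded_linear_Blinfun_apply) (metis Ck_on_Suc_has_derivative has_derivative_bounded_linear)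
  show "(f has_derivative blinfun_apply (f' x)) (at x)" if "x \<in> S" for x
    using Ck_on_Suc_has_derivative[OF assms that] app[OF that] by simp
  have "continuous_on S (\<lambda>x. frechet_derivative f (at x) i)" for i
    using assms by simp
  then show "continuous_on S f'"
    using app by (intro continuous_on_blinfun_componentwise) (simp cong: continuous_on_cong)
qed

lemma Ck_on_1_Lipschitz_on_cball:
  fixes f :: "'a::euclidean_space \<Rightarrow> 'b::real_normed_vector"
  assumes "Ck_on (Suc 0) f S" "cball x r \<subseteq> S"
  obtains L where "L \<ge> 0"
    "\<And>y z. y \<in> cball x r \<Longrightarrow> z \<in> cball x r \<Longrightarrow> norm (f y - f z) \<le> L * norm (y - z)"
proof -
  obtain f' where f': "\<And>x. x \<in> S \<Longrightarrow> (f has_derivative blinfun_apply (f' x)) (at x)"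
    and cont: "continuous_on S f'" by (rule Ck_on_1_blinfun[OF assms(1)], rule that)
  have "bounded (f' ` cball x r)"
    by (rule compact_imp_bounded[OF compact_continuous_image[OF continuous_on_subset[OF cont assms(2)] compact_cball]])
  then obtain L where "\<forall>y\<in>f' ` cball x r. norm y \<le> L"
    unfolding bounded_iff by (elim exE)
  then have L: "norm (f' y) \<le> L" if "y \<in> cball x r" for y
    by (rule bspec[OF _ imageI[OF that]])
  have "norm (f y - f z) \<le> max L 0 * norm (y - z)" if "y \<in> cball x r" "z \<in> cball x r" for y z
  proof (rule differentiable_bound[OF convex_cball _ _ that])
    fix u assume u: "u \<in> cball x r"
    show "(f has_derivative blinfun_apply (f' u)) (at u within cball x r)"
      by (rule has_derivative_at_withinI[OF f'[OF subsetD[OF assms(2) u]]])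
    show "onorm (blinfun_apply (f' u)) \<le> max L 0"
      using L[OF u] unfolding norm_blinfun.rep_eq by linarith
  qed
  then show ?thesis by (intro that[of "max L 0"]) simp_all
qed

section \<open>Flows of vector fields of class $C^2$\<close>

text \<open>Picard iteration for all initial values at once, in a Banach space. The integral equation is used in the
  form \<open>\<Phi> (t, e) = e + t * (integral over s in [0, 1] of F (\<Phi> (t s, e)))\<close>, whose domain of integration does not
  depend on \<open>t\<close>: positive and negative times are treated alike, and the iterates are jointly continuous
  by continuity of parameter integrals. The limit inherits joint continuity from uniform convergence.\<close>

lemma picard_parameter:
  fixes F :: "'e::banach \<Rightarrow> 'e"
  assumes "R > 0" "T > 0" "L \<ge> 0"
    and lip: "\<And>y z. y \<in> cball e0 R \<Longrightarrow> z \<in> cball e0 R \<Longrightarrow> norm (F y - F z) \<le> L * norm (y - z)"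
    and bd: "\<And>y. y \<in> cball e0 R \<Longrightarrow> norm (F y) \<le> B"
    and TB: "T * B \<le> R / 2" and TL: "T * L \<le> 1 / 2"
  obtains \<Phi> where "continuous_on ({-T..T} \<times> cball e0 (R/2)) \<Phi>"
    "\<And>e. e \<in> cball e0 (R/2) \<Longrightarrow> \<Phi> (0, e) = e"
    "\<And>t e. t \<in> {-T..T} \<Longrightarrow> e \<in> cball e0 (R/2) \<Longrightarrow> \<Phi> (t, e) \<in> cball e0 R"
    "\<And>t e. t \<in> {-T..T} \<Longrightarrow> e \<in> cball e0 (R/2) \<Longrightarrow>
        ((\<lambda>t. \<Phi> (t, e)) has_vector_derivative F (\<Phi> (t, e))) (at t within {-T..T})"
proof -
  define K where "K = {-T..T} \<times> cball e0 (R/2)"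
  have contF: "continuous_on (cball e0 R) F"
    by (rule lipschitz_on_continuous_on[of L]) (use lip \<open>L \<ge> 0\<close> in \<open>auto simp: lipschitz_on_def dist_norm\<close>)
  have scale: "(t * s, e) \<in> K" if "(t, e) \<in> K" "s \<in> {0..1}" for t s e
  proof -
    have "\<bar>t * s\<bar> \<le> \<bar>t\<bar> * 1" unfolding abs_mult using that by (intro mult_left_mono) auto
    then show ?thesis using that by (auto simp: K_def)
  qed
  define adm where "adm \<phi> \<longleftrightarrow> continuous_on K \<phi> \<and> \<phi> ` K \<subseteq> cball e0 R" for \<phi> :: "real \<times> 'e \<Rightarrow> 'e"
  define P where "P \<phi> = (\<lambda>(t, e). e + t *\<^sub>R integral {0..1} (\<lambda>s. F (\<phi> (t * s, e))))"
    for \<phi> :: "real \<times> 'e \<Rightarrow> 'e"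
  have contint: "continuous_on (K \<times> {0..1}) (\<lambda>(p, s). F (\<phi> (fst p * s, snd p)))" if "adm \<phi>" for \<phi>
  proof -
    have c: "continuous_on (K \<times> {0..1}) (\<lambda>(p, s). \<phi> (fst p * s, snd p))"
      unfolding split_beta
      by (rule continuous_on_compose2[of K \<phi>])
        (use that scale in \<open>auto simp: adm_def intro!: continuous_intros\<close>)
    show ?thesis
      unfolding split_beta
      by (rule continuous_on_compose2[OF contF c[unfolded split_beta]])
        (use that scale in \<open>auto simp: adm_def\<close>)
  qed
  have cont1: "continuous_on {0..1} (\<lambda>s. F (\<phi> (t * s, e)))" if "adm \<phi>" "(t, e) \<in> K" for \<phi> t e
    using continuous_on_compose2[OF contint[OF that(1)], of "{0..1}" "\<lambda>s. ((t, e), s)"] that(2)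
    by (simp add: continuous_on_Pair image_subset_iff)
  have integ: "(\<lambda>s. F (\<phi> (t * s, e))) integrable_on {0..1}" if "adm \<phi>" "(t, e) \<in> K" for \<phi> t e
    by (rule integrable_continuous_real[OF cont1[OF that]])
  have inball: "\<phi> (t * s, e) \<in> cball e0 R" if "adm \<phi>" "(t, e) \<in> K" "s \<in> {0..1}" for \<phi> t s e
    using that(1) scale[OF that(2,3)] unfolding adm_def image_subset_iff by blast
  have absT: "\<bar>t\<bar> \<le> T" if "(t, e) \<in> K" for t e using that by (auto simp: K_def)
  have admP: "adm (P \<phi>)" if a: "adm \<phi>" for \<phi>
    unfolding adm_def
  proof
    have "continuous_on K (\<lambda>p. integral (cbox 0 1) (\<lambda>s. F (\<phi> (fst p * s, snd p))))"
      by (rule integral_continuous_on_param) (use contint[OF a] in simp)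
    then show "continuous_on K (P \<phi>)"
      unfolding P_def split_beta by (auto intro!: continuous_intros)
    show "P \<phi> ` K \<subseteq> cball e0 R"
    proof clarify
      fix t e assume te: "(t, e) \<in> K"
      have "norm (integral {0..1} (\<lambda>s. F (\<phi> (t * s, e)))) \<le> B * (1 - 0)"
        by (rule integral_bound[OF _ cont1[OF a te]]) (simp_all add: bd inball[OF a te] del: mem_cball)
      moreover have "B \<ge> 0" using order_trans[OF norm_ge_zero bd[of e0]] \<open>R > 0\<close> by simp
      ultimately have "\<bar>t\<bar> * norm (integral {0..1} (\<lambda>s. F (\<phi> (t * s, e)))) \<le> T * B"
        using absT[OF te] by (intro mult_mono) auto
      then have "norm (P \<phi> (t, e) - e) \<le> R / 2" using TB by (simp add: P_def)
      moreover have "dist e0 e \<le> R / 2" using te by (simp add: K_def)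
      ultimately show "P \<phi> (t, e) \<in> cball e0 R"
        using dist_triangle[of e0 "P \<phi> (t, e)" e] by (simp add: dist_norm norm_minus_commute)
    qed
  qed
  have contr: "norm (P \<phi> p - P \<psi> p) \<le> d / 2"
    if a: "adm \<phi>" "adm \<psi>" and d: "\<And>p. p \<in> K \<Longrightarrow> norm (\<phi> p - \<psi> p) \<le> d" and p: "p \<in> K" for \<phi> \<psi> p d
  proof -
    obtain t e where te: "p = (t, e)" "(t, e) \<in> K" using p by (cases p) auto
    have i: "norm (integral {0..1} (\<lambda>s. F (\<phi> (t * s, e)) - F (\<psi> (t * s, e)))) \<le> (L * d) * (1 - 0)"
    proof (rule integral_bound)
      show "continuous_on {0..1} (\<lambda>s. F (\<phi> (t * s, e)) - F (\<psi> (t * s, e)))"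
        by (intro continuous_on_diff cont1 a te)
      fix s :: real assume s: "s \<in> {0..1}"
      have "norm (F (\<phi> (t * s, e)) - F (\<psi> (t * s, e))) \<le> L * norm (\<phi> (t * s, e) - \<psi> (t * s, e))"
        by (intro lip inball a te s)
      also have "\<dots> \<le> L * d" using d[OF scale[OF te(2) s]] \<open>L \<ge> 0\<close> by (rule mult_left_mono)
      finally show "norm (F (\<phi> (t * s, e)) - F (\<psi> (t * s, e))) \<le> L * d" .
    qed simp
    have d0: "d \<ge> 0" using d[OF p] norm_ge_zero order_trans by blast
    have "P \<phi> p - P \<psi> p = t *\<^sub>R integral {0..1} (\<lambda>s. F (\<phi> (t * s, e)) - F (\<psi> (t * s, e)))"
      using integral_diff[OF integ[OF a(1) te(2)] integ[OF a(2) te(2)]]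
      by (simp add: P_def te scaleR_diff_right)
    then have "norm (P \<phi> p - P \<psi> p) \<le> T * (L * d)"
      using i absT[OF te(2)] \<open>T > 0\<close> by (simp add: mult_mono)
    also have "\<dots> = (T * L) * d" by simp
    also have "\<dots> \<le> 1 / 2 * d" using TL d0 by (intro mult_right_mono) auto
    finally show ?thesis by simp
  qed
  define \<phi> where "\<phi> k = (P ^^ k) snd" for k
  have adm0: "adm snd"
    using \<open>R > 0\<close> by (auto simp: adm_def K_def intro!: continuous_intros)
  have adm: "adm (\<phi> k)" for k by (induction k) (simp_all add: \<phi>_def adm0 admP)
  have step: "\<phi> (Suc k) = P (\<phi> k)" for k by (simp add: \<phi>_def)
  have geo: "norm (\<phi> (Suc k) p - \<phi> k p) \<le> 2 * R * (1/2) ^ k" if "p \<in> K" for k p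
    using that
  proof (induction k arbitrary: p)
    case 0
    have "dist e0 (\<phi> 1 p) \<le> R" "dist e0 (\<phi> 0 p) \<le> R"
      using adm[of 0] adm[of 1] 0 by (auto simp: adm_def)
    then show ?case using dist_triangle2[of "\<phi> 1 p" "\<phi> 0 p" e0] by (simp add: dist_norm norm_minus_commute)
  next
    case (Suc k)
    then show ?case using contr[OF adm adm Suc.IH Suc.prems] by (simp add: step)
  qed
  define \<Phi> where "\<Phi> p = snd p + (\<Sum>i. \<phi> (Suc i) p - \<phi> i p)" for p
  have "uniform_limit K (\<lambda>n p. \<Sum>i<n. \<phi> (Suc i) p - \<phi> i p) (\<lambda>p. \<Sum>i. \<phi> (Suc i) p - \<phi> i p) sequentially"
    by (rule Weierstrass_m_test[where M = "\<lambda>k. 2 * R * (1/2) ^ k"])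
      (use geo in \<open>auto intro!: summable_mult summable_geometric\<close>)
  then have "uniform_limit K (\<lambda>n p. snd p + (\<Sum>i<n. \<phi> (Suc i) p - \<phi> i p)) \<Phi> sequentially"
    unfolding \<Phi>_def by (intro uniform_limit_intros)
  moreover have "snd p + (\<Sum>i<n. \<phi> (Suc i) p - \<phi> i p) = \<phi> n p" for n p
    using sum_lessThan_telescope[of "\<lambda>i. \<phi> i p" n] by (simp add: \<phi>_def)
  ultimately have lim: "uniform_limit K \<phi> \<Phi> sequentially" by simp
  have "continuous_on K \<Phi>"
    by (rule uniform_limit_theorem[OF _ lim]) (use adm in \<open>auto simp: adm_def\<close>)
  moreover have "\<Phi> p \<in> cball e0 R" if "p \<in> K" for p
    using Lim_in_closed_set[OF closed_cball _ _ tendsto_uniform_limitI[OF lim that], of e0 R] adm that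
    by (auto simp: adm_def image_subset_iff)
  ultimately have adm\<Phi>: "adm \<Phi>" by (auto simp: adm_def)
  have fixpt: "P \<Phi> p = \<Phi> p" if p: "p \<in> K" for p
  proof -
    have "norm (P \<Phi> p - \<Phi> p) \<le> 2 * d" if "d > 0" for d
    proof -
      obtain n where n: "\<And>m p. m \<ge> n \<Longrightarrow> p \<in> K \<Longrightarrow> dist (\<phi> m p) (\<Phi> p) < d"
        using lim \<open>d > 0\<close> unfolding uniform_limit_sequentially_iff by blast
      have "norm (P \<Phi> p - P (\<phi> n) p) \<le> d / 2"
      proof (rule contr[OF adm\<Phi> adm _ p])
        show "norm (\<Phi> p - \<phi> n p) \<le> d" if "p \<in> K" for p
          using n[OF order_refl that] by (simp add: dist_norm norm_minus_commute)
      qed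
      moreover have "norm (\<phi> (Suc n) p - \<Phi> p) \<le> d"
        using n[OF le_SucI[OF order_refl] p] by (simp add: dist_norm)
      ultimately show ?thesis
        using norm_triangle_ineq[of "P \<Phi> p - P (\<phi> n) p" "\<phi> (Suc n) p - \<Phi> p"] \<open>d > 0\<close> by (simp add: step)
    qed
    from this[of "norm (P \<Phi> p - \<Phi> p) / 4"] show ?thesis by (cases "P \<Phi> p = \<Phi> p") auto
  qed
  show ?thesis
  proof (rule that[of \<Phi>])
    show "continuous_on ({-T..T} \<times> cball e0 (R/2)) \<Phi>" using adm\<Phi> by (simp add: adm_def K_def)
    show "\<Phi> (0, e) = e" if "e \<in> cball e0 (R/2)" for e
      using fixpt[of "(0, e)"] that \<open>T > 0\<close> by (simp add: K_def P_def)
    show "\<Phi> (t, e) \<in> cball e0 R" if "t \<in> {-T..T}" "e \<in> cball e0 (R/2)" for t e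
      using adm\<Phi> that unfolding adm_def K_def image_subset_iff by blast
    fix t e assume t: "t \<in> {-T..T}" and e: "e \<in> cball e0 (R/2)"
    have in_K: "(s, e) \<in> K" if "s \<in> {-T..T}" for s using that e by (simp add: K_def)
    have "continuous_on {-T..T} (\<lambda>s. \<Phi> (s, e))"
      by (rule continuous_on_compose2[of K \<Phi>])
        (use adm\<Phi> in_K in \<open>auto simp: adm_def intro!: continuous_intros\<close>)
    then have "continuous_on {-T..T} (\<lambda>s. F (\<Phi> (s, e)))"
      by (rule continuous_on_compose2[OF contF]) (use adm\<Phi> in_K in \<open>auto simp: adm_def\<close>)
    then obtain G where G: "\<And>s. s \<in> {-T..T} \<Longrightarrow>
        (G has_vector_derivative F (\<Phi> (s, e))) (at s within {-T..T})"
      using antiderivative_continuous by blast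
    \<comment> \<open>Back to the differential equation: the substitution \<open>u \<mapsto> s * u\<close> turns the integral over \<open>[0, 1]\<close> into
      a difference of values of an antiderivative.\<close>
    have eq: "\<Phi> (s, e) = e + (G s - G 0)" if s: "s \<in> {-T..T}" for s
    proof -
      have sc: "s * u \<in> {-T..T}" if "u \<in> {0..1}" for u using scale[OF in_K[OF s] that] by (simp add: K_def)
      have "((\<lambda>u. G (s * u)) has_vector_derivative s *\<^sub>R F (\<Phi> (s * u, e))) (at u within {0..1})"
        if u: "u \<in> {0..1}" for u
      proof -
        have "((\<lambda>u. s * u) has_real_derivative s) (at u within {0..1})"
          by (auto intro!: derivative_eq_intros)
        moreover have "(G has_vector_derivative F (\<Phi> (s * u, e))) (at (s * u) within (*) s ` {0..1})"
          by (rule has_vector_derivative_within_subset[OF G]) (use sc u in auto)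
        ultimately show ?thesis
          using vector_diff_chain_within[of "(*) s" s u "{0..1}" G "F (\<Phi> (s * u, e))"]
          by (simp add: o_def has_real_derivative_iff_has_vector_derivative)
      qed
      then have hi: "((\<lambda>u. s *\<^sub>R F (\<Phi> (s * u, e))) has_integral (G (s * 1) - G (s * 0))) {0..1}"
        by (intro fundamental_theorem_of_calculus) auto
      have "s *\<^sub>R integral {0..1} (\<lambda>u. F (\<Phi> (s * u, e))) = G s - G 0"
        using integral_unique[OF hi] by simp
      then show ?thesis using fixpt[OF in_K[OF s]] by (simp add: P_def)
    qed
    have "((\<lambda>s. e + (G s - G 0)) has_vector_derivative F (\<Phi> (t, e))) (at t within {-T..T})"
      using G[OF t] by (auto intro!: derivative_eq_intros)
    then show "((\<lambda>t. \<Phi> (t, e)) has_vector_derivative F (\<Phi> (t, e))) (at t within {-T..T})"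
      by (rule has_vector_derivative_transform[OF t, rotated]) (use eq in auto)
  qed
qed

text \<open>On a time interval so short that \<open>T * L \<le> 1/2\<close>, Gronwall's inequality reduces to the mean value
  theorem: at the point \<open>m\<close> where the norm is maximal, half of the maximum can be absorbed.\<close>

lemma small_time_Gronwall:
  fixes f :: "real \<Rightarrow> 'e::real_normed_vector"
  assumes "T > 0" "L \<ge> 0" "T * L \<le> 1/2"
    and f: "\<And>t. t \<in> {-T..T} \<Longrightarrow> (f has_vector_derivative f' t) (at t within {-T..T})"
    and bd: "\<And>t. t \<in> {-T..T} \<Longrightarrow> norm (f' t) \<le> L * norm (f t) + d"
    and "d \<ge> 0" "t \<in> {-T..T}"
  shows "norm (f t) \<le> 2 * (norm (f 0) + T * d)"
proof -
  have "continuous_on {-T..T} (\<lambda>t. norm (f t))"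
    by (rule continuous_on_norm[OF continuous_on_vector_derivative[OF f]])
  then have "\<exists>m\<in>{-T..T}. \<forall>t\<in>{-T..T}. norm (f t) \<le> norm (f m)"
    using \<open>T > 0\<close> by (intro continuous_attains_sup compact_Icc) simp_all
  then obtain m where m: "m \<in> {-T..T}" "\<And>t. t \<in> {-T..T} \<Longrightarrow> norm (f t) \<le> norm (f m)"
    by (elim bexE) (rule that, assumption, erule bspec)
  define A where "A = L * norm (f m) + d"
  have A0: "A \<ge> 0" using assms by (simp add: A_def)
  have "norm (f m - f 0) \<le> A * norm (m - 0)"
  proof (rule differentiable_bound[where S="{-T..T}" and f'="\<lambda>t h. h *\<^sub>R f' t"])
    fix s assume s: "s \<in> {-T..T}"
    show "(f has_derivative (\<lambda>h. h *\<^sub>R f' s)) (at s within {-T..T})"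
      using f[OF s] by (simp add: has_vector_derivative_def)
    have "norm (f' s) \<le> A"
      using bd[OF s] mult_left_mono[OF m(2)[OF s] \<open>L \<ge> 0\<close>] by (simp add: A_def)
    then show "onorm (\<lambda>h. h *\<^sub>R f' s) \<le> A"
      by (intro onorm_le) (simp, metis abs_ge_zero mult.commute mult_left_mono)
  qed (use m \<open>T > 0\<close> in auto)
  also have "\<dots> \<le> A * T" using m(1) A0 by (intro mult_left_mono) auto
  also have "\<dots> = (T * L) * norm (f m) + T * d" by (simp add: A_def algebra_simps)
  also have "\<dots> \<le> 1/2 * norm (f m) + T * d"
    using assms(3) by (intro add_right_mono mult_right_mono) auto
  finally have "norm (f m) \<le> 2 * (norm (f 0) + T * d)"
    using norm_triangle_sub[of "f m" "f 0"] by simp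
  then show ?thesis using m(2)[OF assms(7)] by simp
qed

text \<open>The flow and its linearisation are obtained together, as the flow of the extended field
  \<open>(z, A) \<mapsto> (X z, X' z \<circ> A)\<close> started at \<open>(z, id)\<close>. This field is locally Lipschitz as \<open>X\<close> is \<open>C\<^sup>2\<close>, so \<open>Y\<close> is
  jointly continuous, and it remains to see that \<open>Y\<close> is the derivative of \<open>\<Phi>\<close> in the initial value. The
  difference \<open>\<Phi> (t, y) - \<Phi> (t, z) - Y (t, z) (y - z)\<close> satisfies a linear differential inequality whose
  inhomogeneous term is quadratic in \<open>y - z\<close>, and so it is itself quadratically small.\<close>

lemma flow_C1:
  fixes X :: "'c::euclidean_space \<Rightarrow> 'c"
  assumes "open W" "z0 \<in> W" and C2: "Ck_on (Suc (Suc 0)) X W"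
  obtains T r \<Phi> Y where "T > 0" "r > 0"
    "\<And>t z. t \<in> {-T..T} \<Longrightarrow> z \<in> cball z0 r \<Longrightarrow> \<Phi> (t, z) \<in> W"
    "\<And>z. z \<in> cball z0 r \<Longrightarrow> \<Phi> (0, z) = z"
    "\<And>t z. t \<in> {-T..T} \<Longrightarrow> z \<in> cball z0 r \<Longrightarrow>
        ((\<lambda>t. \<Phi> (t, z)) has_vector_derivative X (\<Phi> (t, z))) (at t within {-T..T})"
    "\<And>z w. z \<in> cball z0 r \<Longrightarrow> Y (0, z) w = w"
    "\<And>t z w. t \<in> {-T..T} \<Longrightarrow> z \<in> cball z0 r \<Longrightarrow>
        ((\<lambda>t. Y (t, z) w) has_vector_derivative
          frechet_derivative X (at (\<Phi> (t, z))) (Y (t, z) w)) (at t within {-T..T})"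
    "\<And>t z. t \<in> {-T<..<T} \<Longrightarrow> z \<in> ball z0 r \<Longrightarrow>
        (\<Phi> has_derivative (\<lambda>(s, w). s *\<^sub>R X (\<Phi> (t, z)) + Y (t, z) w)) (at (t, z))"
    "Ck_on (Suc 0) \<Phi> ({-T<..<T} \<times> ball z0 r)"
proof -
  obtain X' where X': "\<And>x. x \<in> W \<Longrightarrow> (X has_derivative blinfun_apply (X' x)) (at x)"
    and contX': "continuous_on W X'"
    by (rule Ck_on_1_blinfun[OF Ck_on_Suc_lower[OF C2]], rule that)
  have frX: "frechet_derivative X (at x) = blinfun_apply (X' x)" if "x \<in> W" for x
    using frechet_derivative_at[OF X'[OF that]] by simp
  obtain R0 where "R0 > 0" and R0W: "cball z0 R0 \<subseteq> W"
    using assms(1,2) open_contains_cball by blast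
  define R where "R = min R0 1"
  have R: "R > 0" "R \<le> 1" "R \<le> R0" using \<open>R0 > 0\<close> by (auto simp: R_def)
  have RW: "cball z0 R \<subseteq> W" using R0W R by (auto simp: subset_iff)
  have "\<exists>L\<ge>0. \<forall>y\<in>cball z0 R. \<forall>z\<in>cball z0 R. norm (X' y b - X' z b) \<le> L * norm (y - z)" for b
  proof -
    have "Ck_on (Suc 0) (\<lambda>x. frechet_derivative X (at x) b) W"
      using iffD1[OF Ck_on.simps(2) C2] by blast
    from Ck_on_cong[OF assms(1) _ this, of "\<lambda>x. X' x b"] frX
    have "Ck_on (Suc 0) (\<lambda>x. X' x b) W" by simp
    then show ?thesis by (rule Ck_on_1_Lipschitz_on_cball[OF _ RW]) blast
  qed
  then obtain Lb where Lb: "\<And>b. Lb b \<ge> 0"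
    "\<And>b y z. y \<in> cball z0 R \<Longrightarrow> z \<in> cball z0 R \<Longrightarrow> norm (X' y b - X' z b) \<le> Lb b * norm (y - z)"
    by metis
  define L2 where "L2 = sum Lb Basis"
  have L20: "L2 \<ge> 0" using Lb(1) by (simp add: L2_def sum_nonneg)
  have L2: "norm (X' y - X' z) \<le> L2 * norm (y - z)" if "y \<in> cball z0 R" "z \<in> cball z0 R" for y z
  proof -
    have "norm (X' y - X' z) \<le> (\<Sum>b\<in>Basis. norm ((X' y - X' z) b))"
      by (rule norm_blinfun_euclidean_le)
    also have "\<dots> \<le> (\<Sum>b\<in>Basis. Lb b * norm (y - z))"
      using Lb(2)[OF that] by (intro sum_mono) (simp add: blinfun.diff_left)
    finally show ?thesis by (simp add: L2_def sum_distrib_right)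
  qed
  define L1 where "L1 = norm (X' z0) + L2 * R"
  have L10: "L1 \<ge> 0" using L20 R by (simp add: L1_def)
  have z0R: "z0 \<in> cball z0 R" using R by simp
  have L1: "norm (X' y) \<le> L1" if y: "y \<in> cball z0 R" for y
  proof -
    have "norm (X' y - X' z0) \<le> L2 * norm (y - z0)" by (rule L2[OF y z0R])
    also have "\<dots> \<le> L2 * R"
      using y L20 by (intro mult_left_mono) (auto simp: dist_norm norm_minus_commute)
    finally show ?thesis using norm_triangle_sub[of "X' y" "X' z0"] by (simp add: L1_def)
  qed
  have Xlip: "norm (X y - X z) \<le> L1 * norm (y - z)" if "y \<in> cball z0 R" "z \<in> cball z0 R" for y z
  proof (rule differentiable_bound[OF convex_cball _ _ that])
    fix u assume u: "u \<in> cball z0 R"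
    show "(X has_derivative blinfun_apply (X' u)) (at u within cball z0 R)"
      by (rule has_derivative_at_withinI[OF X'[OF subsetD[OF RW u]]])
    show "onorm (blinfun_apply (X' u)) \<le> L1"
      using L1[OF u] unfolding norm_blinfun.rep_eq .
  qed
  define F where "F = (\<lambda>(z, A :: 'c \<Rightarrow>\<^sub>L 'c). (X z, X' z o\<^sub>L A))"
  define B where "B = norm (X z0) + 3 * L1"
  have B0: "B \<ge> 0" using L10 by (simp add: B_def)
  define L where "L = 2 * L1 + 2 * L2"
  have L0: "L \<ge> 0" "L1 \<le> L" using L10 L20 by (auto simp: L_def)
  \<comment> \<open>The first bound keeps the iterates in the ball, the second makes the iteration a contraction.\<close>
  define T where "T = min (R / (2 * (B + 1))) (1 / (2 * (L + 1)))"
  have T0: "T > 0" using R B0 L0 by (simp add: T_def)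
  have TB: "T * B \<le> R / 2"
  proof -
    have "T * B \<le> (R / (2 * (B + 1))) * B" using B0 by (intro mult_right_mono) (auto simp: T_def)
    also have "\<dots> \<le> R / 2" using B0 R by (simp add: field_simps)
    finally show ?thesis .
  qed
  have TL: "T * L \<le> 1 / 2"
  proof -
    have "T * L \<le> (1 / (2 * (L + 1))) * L" using L0 by (intro mult_right_mono) (auto simp: T_def)
    also have "\<dots> \<le> 1 / 2" using L0 by (simp add: field_simps)
    finally show ?thesis .
  qed
  have inR: "fst p \<in> cball z0 R" "norm (snd p) \<le> 2" if p: "p \<in> cball (z0, id_blinfun) R"
    for p :: "'c \<times> ('c \<Rightarrow>\<^sub>L 'c)"
  proof -
    have "dist z0 (fst p) \<le> R" using dist_fst_le[of "(z0, id_blinfun)" p] p by simp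
    then show "fst p \<in> cball z0 R" by simp
    have "dist id_blinfun (snd p) \<le> R" using dist_snd_le[of "(z0, id_blinfun)" p] p by simp
    then show "norm (snd p) \<le> 2"
      using norm_triangle_sub[of "snd p" "id_blinfun"] norm_blinfun_id_le[where 'a='c] R
      by (simp add: dist_norm norm_minus_commute)
  qed
  obtain \<Psi> where cont\<Psi>: "continuous_on ({-T..T} \<times> cball (z0, id_blinfun) (R/2)) \<Psi>"
    and \<Psi>0: "\<And>e. e \<in> cball (z0, id_blinfun) (R/2) \<Longrightarrow> \<Psi> (0, e) = e"
    and \<Psi>R: "\<And>t e. t \<in> {-T..T} \<Longrightarrow> e \<in> cball (z0, id_blinfun) (R/2) \<Longrightarrow>
        \<Psi> (t, e) \<in> cball (z0, id_blinfun) R"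
    and \<Psi>': "\<And>t e. t \<in> {-T..T} \<Longrightarrow> e \<in> cball (z0, id_blinfun) (R/2) \<Longrightarrow>
        ((\<lambda>t. \<Psi> (t, e)) has_vector_derivative F (\<Psi> (t, e))) (at t within {-T..T})"
  proof (rule picard_parameter[OF R(1) T0 L0(1) _ _ TB TL])
    fix p q :: "'c \<times> ('c \<Rightarrow>\<^sub>L 'c)"
    assume p: "p \<in> cball (z0, id_blinfun) R"
    obtain z A where pp: "p = (z, A)" by (cases p)
    have z: "z \<in> cball z0 R" and A: "norm A \<le> 2" using inR[OF p] by (auto simp: pp)
    have Xz: "norm (X z) \<le> norm (X z0) + L1"
    proof -
      have "norm (X z - X z0) \<le> L1 * norm (z - z0)" by (rule Xlip[OF z z0R])
      also have "\<dots> \<le> L1 * 1"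
        using z R L10 by (intro mult_left_mono) (auto simp: dist_norm norm_minus_commute)
      finally show ?thesis using norm_triangle_sub[of "X z" "X z0"] by simp
    qed
    have "norm (X' z o\<^sub>L A) \<le> norm (X' z) * norm A" by (rule norm_blinfun_compose)
    also have "\<dots> \<le> L1 * 2" using L1[OF z] A L10 by (intro mult_mono) auto
    finally show "norm (F p) \<le> B"
      using Xz norm_Pair_le[of "X z" "X' z o\<^sub>L A"] by (simp add: F_def pp B_def)
    assume q: "q \<in> cball (z0, id_blinfun) R"
    obtain z2 A2 where qq: "q = (z2, A2)" by (cases q)
    have z2: "z2 \<in> cball z0 R" using inR[OF q] by (auto simp: qq)
    have dz: "norm (z - z2) \<le> norm (p - q)" and dA: "norm (A - A2) \<le> norm (p - q)"
      using norm_fst_le[of "z - z2" "A - A2"] norm_snd_le[of "A - A2" "z - z2"] by (auto simp: pp qq)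
    have "norm ((X' z o\<^sub>L A) - (X' z2 o\<^sub>L A2)) = norm (((X' z - X' z2) o\<^sub>L A) + (X' z2 o\<^sub>L (A - A2)))"
      by (simp add: bounded_bilinear.diff_left[OF bounded_bilinear_blinfun_compose]
          bounded_bilinear.diff_right[OF bounded_bilinear_blinfun_compose])
    also have "\<dots> \<le> norm (X' z - X' z2) * norm A + norm (X' z2) * norm (A - A2)"
      by (intro norm_triangle_le add_mono norm_blinfun_compose)
    also have "\<dots> \<le> (L2 * norm (p - q)) * 2 + L1 * norm (p - q)"
    proof (intro add_mono mult_mono)
      show "norm (X' z - X' z2) \<le> L2 * norm (p - q)"
        using L2[OF z z2] mult_left_mono[OF dz L20] by linarith
    qed (use A L1[OF z2] dA L10 L20 in auto)
    finally have d2: "norm ((X' z o\<^sub>L A) - (X' z2 o\<^sub>L A2)) \<le> (2 * L2 + L1) * norm (p - q)"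
      by (simp add: algebra_simps)
    have d1: "norm (X z - X z2) \<le> L1 * norm (p - q)"
      using Xlip[OF z z2] mult_left_mono[OF dz L10] by linarith
    show "norm (F p - F q) \<le> L * norm (p - q)"
      using norm_Pair_le[of "X z - X z2" "(X' z o\<^sub>L A) - (X' z2 o\<^sub>L A2)"] d1 d2
      by (simp add: F_def pp qq L_def algebra_simps)
  qed (rule that)
  define \<Phi> where "\<Phi> = (\<lambda>(t, z). fst (\<Psi> (t, z, id_blinfun)))"
  define Y where "Y = (\<lambda>(t, z). snd (\<Psi> (t, z, id_blinfun)))"
  define r where "r = R / 2"
  have ini: "(z, id_blinfun) \<in> cball (z0, id_blinfun) (R/2)" if "z \<in> cball z0 r" for z
    using that by (simp add: r_def dist_Pair_Pair)
  have \<Phi>R: "\<Phi> (t, z) \<in> cball z0 R" if "t \<in> {-T..T}" "z \<in> cball z0 r" for t z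
    using inR(1)[OF \<Psi>R[OF that(1) ini[OF that(2)]]] by (simp add: \<Phi>_def)
  then have \<Phi>W: "\<Phi> (t, z) \<in> W" if "t \<in> {-T..T}" "z \<in> cball z0 r" for t z
    using RW that by blast
  have \<Phi>0: "\<Phi> (0, z) = z" and Y0: "Y (0, z) = id_blinfun" if "z \<in> cball z0 r" for z
    using \<Psi>0[OF ini[OF that]] by (simp_all add: \<Phi>_def Y_def)
  have \<Phi>': "((\<lambda>t. \<Phi> (t, z)) has_vector_derivative X (\<Phi> (t, z))) (at t within {-T..T})"
    and Y': "((\<lambda>t. Y (t, z)) has_vector_derivative (X' (\<Phi> (t, z)) o\<^sub>L Y (t, z))) (at t within {-T..T})"
    if "t \<in> {-T..T}" "z \<in> cball z0 r" for t z
    using bounded_linear.has_vector_derivative[OF bounded_linear_fst \<Psi>'[OF that(1) ini[OF that(2)]]]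
      bounded_linear.has_vector_derivative[OF bounded_linear_snd \<Psi>'[OF that(1) ini[OF that(2)]]]
    by (simp_all add: \<Phi>_def Y_def F_def split_beta)
  have Yw': "((\<lambda>t. Y (t, z) w) has_vector_derivative X' (\<Phi> (t, z)) (Y (t, z) w)) (at t within {-T..T})"
    if "t \<in> {-T..T}" "z \<in> cball z0 r" for t z w
    using bounded_linear.has_vector_derivative[OF blinfun.bounded_linear_left Y'[OF that]] by simp
  have cont: "continuous_on ({-T..T} \<times> cball z0 r) (\<lambda>p. \<Psi> (fst p, snd p, id_blinfun))"
    by (rule continuous_on_compose2[OF cont\<Psi>]) (use ini in \<open>auto intro!: continuous_intros\<close>)
  have contY: "continuous_on ({-T..T} \<times> cball z0 r) Y"
    and cont\<Phi>: "continuous_on ({-T..T} \<times> cball z0 r) \<Phi>"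
    using continuous_on_snd[OF cont] continuous_on_fst[OF cont]
    by (simp_all add: Y_def \<Phi>_def split_beta)
  have dz: "((\<lambda>z. \<Phi> (t, z)) has_derivative blinfun_apply (Y (t, z))) (at z)"
    if t: "t \<in> {-T..T}" and z: "z \<in> ball z0 r" for t z
  proof -
    have zc: "z \<in> cball z0 r" using z by simp
    have est: "norm (\<Phi> (t, y) - \<Phi> (t, z) - Y (t, z) (y - z)) \<le> 8 * T * L2 * (norm (y - z))\<^sup>2"
      if y: "y \<in> cball z0 r" for y
    proof -
      have TL1: "T * L1 \<le> 1/2" using TL mult_left_mono[OF L0(2), of T] T0 by linarith
      define f where "f s = \<Phi> (s, y) - \<Phi> (s, z)" for s
      \<comment> \<open>First the flow is Lipschitz in the initial value, with constant \<open>2\<close>.\<close>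
      have f: "norm (f s) \<le> 2 * (norm (f 0) + T * 0)" if "s \<in> {-T..T}" for s
      proof (rule small_time_Gronwall[OF T0 L10 TL1 _ _ _ that])
        fix s assume s: "s \<in> {-T..T}"
        show "(f has_vector_derivative (X (\<Phi> (s, y)) - X (\<Phi> (s, z)))) (at s within {-T..T})"
          unfolding f_def by (intro has_vector_derivative_diff \<Phi>' s y zc)
        show "norm (X (\<Phi> (s, y)) - X (\<Phi> (s, z))) \<le> L1 * norm (f s) + 0"
          unfolding f_def using Xlip[OF \<Phi>R[OF s y] \<Phi>R[OF s zc]] by simp
      qed simp
      then have f: "norm (f s) \<le> 2 * norm (y - z)" if "s \<in> {-T..T}" for s
        using that by (simp add: f_def \<Phi>0[OF y] \<Phi>0[OF zc])
      \<comment> \<open>Then the error of the linear approximation is estimated, using that \<open>X\<close> is linear up to a term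
        quadratic in the distance of the two solutions.\<close>
      define g where "g s = \<Phi> (s, y) - \<Phi> (s, z) - Y (s, z) (y - z)" for s
      define d where "d = L2 * (2 * norm (y - z))\<^sup>2"
      have "norm (g t) \<le> 2 * (norm (g 0) + T * d)"
      proof (rule small_time_Gronwall[OF T0 L10 TL1 _ _ _ t])
        show "d \<ge> 0" using L20 by (simp add: d_def)
        fix s assume s: "s \<in> {-T..T}"
        show "(g has_vector_derivative
            (X (\<Phi> (s, y)) - X (\<Phi> (s, z)) - X' (\<Phi> (s, z)) (Y (s, z) (y - z)))) (at s within {-T..T})"
          unfolding g_def by (intro has_vector_derivative_diff \<Phi>' Yw' s y zc)
        let ?a = "\<Phi> (s, z)" and ?b = "\<Phi> (s, y)"
        have a: "?a \<in> cball z0 R" and b: "?b \<in> cball z0 R" by (intro \<Phi>R s y zc)+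
        have seg: "closed_segment ?a ?b \<subseteq> cball z0 R"
          using a b convex_cball closed_segment_subset by blast
        have "norm (X ?b - X ?a - X' ?a (?b - ?a)) \<le> norm (?b - ?a) * (L2 * norm (f s))"
        proof (rule differentiable_bound_linearization[where S="closed_segment ?a ?b"
              and f'="\<lambda>x. blinfun_apply (X' x)"])
          show "?a + u *\<^sub>R (?b - ?a) \<in> closed_segment ?a ?b" if "u \<in> {0..1}" for u
            using that by (auto simp: closed_segment_def algebra_simps intro!: exI[of _ u])
          fix x assume x: "x \<in> closed_segment ?a ?b"
          then have xR: "x \<in> cball z0 R" using seg by blast
          show "(X has_derivative blinfun_apply (X' x)) (at x within closed_segment ?a ?b)"
            by (rule has_derivative_at_withinI[OF X'[OF subsetD[OF RW xR]]])
          have "norm (X' x - X' ?a) \<le> L2 * norm (x - ?a)" by (rule L2[OF xR a])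
          also have "\<dots> \<le> L2 * norm (f s)"
            using segment_bound(1)[OF x] L20 by (intro mult_left_mono) (simp_all add: f_def)
          finally show "onorm (blinfun_apply (X' x) - blinfun_apply (X' ?a)) \<le> L2 * norm (f s)"
            by (simp add: norm_blinfun.rep_eq minus_blinfun.rep_eq fun_diff_def)
        qed simp
        also have "\<dots> = L2 * (norm (f s))\<^sup>2" by (simp add: f_def power2_eq_square)
        also have "\<dots> \<le> d"
          unfolding d_def using f[OF s] L20 by (intro mult_left_mono power_mono) auto
        finally have 1: "norm (X ?b - X ?a - X' ?a (?b - ?a)) \<le> d" .
        have "norm (X' ?a (g s)) \<le> norm (X' ?a) * norm (g s)" by (rule norm_blinfun)
        also have "\<dots> \<le> L1 * norm (g s)" using L1[OF a] by (intro mult_right_mono) auto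
        finally have 2: "norm (X' ?a (g s)) \<le> L1 * norm (g s)" .
        have eq: "X ?b - X ?a - X' ?a (Y (s, z) (y - z)) = (X ?b - X ?a - X' ?a (?b - ?a)) + X' ?a (g s)"
          by (simp add: g_def blinfun.diff_right)
        show "norm (X ?b - X ?a - X' ?a (Y (s, z) (y - z))) \<le> L1 * norm (g s) + d"
          unfolding eq
          using norm_triangle_ineq[of "X ?b - X ?a - X' ?a (?b - ?a)" "X' ?a (g s)"] 1 2 by linarith
      qed
      moreover have "g 0 = 0" by (simp add: g_def \<Phi>0[OF y] \<Phi>0[OF zc] Y0[OF zc])
      ultimately show ?thesis by (simp add: g_def d_def power_mult_distrib)
    qed
    show ?thesis
      unfolding has_derivative_at2
    proof (intro conjI blinfun.bounded_linear_right)
      have "((\<lambda>y. 8 * T * L2 * norm (y - z)) \<longlongrightarrow> 8 * T * L2 * norm (z - z)) (at z)"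
        by (intro tendsto_intros)
      then have lim0: "((\<lambda>y. 8 * T * L2 * norm (y - z)) \<longlongrightarrow> 0) (at z)" by simp
      have "\<forall>\<^sub>F y in at z. y \<in> ball z0 r"
        by (rule eventually_at_in_open'[OF open_ball z])
      then have "\<forall>\<^sub>F y in at z. norm ((1 / norm (y - z)) *\<^sub>R
          (\<Phi> (t, y) - (\<Phi> (t, z) + Y (t, z) (y - z)))) \<le> 8 * T * L2 * norm (y - z)"
      proof (rule eventually_mono)
        fix y assume "y \<in> ball z0 r"
        then have "norm (\<Phi> (t, y) - \<Phi> (t, z) - Y (t, z) (y - z)) \<le> 8 * T * L2 * (norm (y - z))\<^sup>2"
          by (intro est) simp
        then show "norm ((1 / norm (y - z)) *\<^sub>R
          (\<Phi> (t, y) - (\<Phi> (t, z) + Y (t, z) (y - z)))) \<le> 8 * T * L2 * norm (y - z)"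
          by (cases "y = z") (simp_all add: diff_diff_eq divide_le_eq power2_eq_square mult.assoc)
      qed
      then show "((\<lambda>y. (1 / norm (y - z)) *\<^sub>R
          (\<Phi> (t, y) - (\<Phi> (t, z) + Y (t, z) (y - z)))) \<longlongrightarrow> 0) (at z)"
        by (rule Lim_null_comparison[OF _ lim0])
    qed
  qed
  let ?U = "{-T<..<T} \<times> ball z0 r"
  have openU: "open ?U" by (intro open_Times open_greaterThanLessThan open_ball)
  have subU: "?U \<subseteq> {-T..T} \<times> cball z0 r" by auto
  have der: "(\<Phi> has_derivative (\<lambda>(s, w). s *\<^sub>R X (\<Phi> (t, z)) + Y (t, z) w)) (at (t, z))"
    if t: "t \<in> {-T<..<T}" and z: "z \<in> ball z0 r" for t z
  proof -
    have "((\<lambda>(t, z). \<Phi> (t, z)) has_derivative (\<lambda>(s, w). s *\<^sub>R X (\<Phi> (t, z)) + Y (t, z) w))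
        (at (t, z) within ?U)"
    proof (rule has_derivative_partialsI[where fx="\<lambda>s. s *\<^sub>R X (\<Phi> (t, z))" and fy="\<lambda>t z. Y (t, z)"])
      have "((\<lambda>t. \<Phi> (t, z)) has_vector_derivative X (\<Phi> (t, z))) (at t within {-T<..<T})"
        by (rule has_vector_derivative_within_subset[OF \<Phi>']) (use t z in auto)
      then show "((\<lambda>x. \<Phi> (x, z)) has_derivative (\<lambda>s. s *\<^sub>R X (\<Phi> (t, z)))) (at t within {-T<..<T})"
        by (simp add: has_vector_derivative_def)
      show "((\<lambda>y. \<Phi> (x, y)) has_derivative blinfun_apply (Y (x, y))) (at y within ball z0 r)"
        if "x \<in> {-T<..<T}" "y \<in> ball z0 r" for x y
        by (rule has_derivative_at_withinI[OF dz]) (use that in auto)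
      show "continuous (at (t, z) within ?U) (\<lambda>(x, y). Y (x, y))"
        using continuous_on_subset[OF contY subU] t z
        by (simp add: continuous_on_eq_continuous_within)
    qed (use z in auto)
    then show ?thesis
      using at_within_open[OF _ openU, of "(t, z)"] t z by simp
  qed
  show ?thesis
  proof (rule that[of T r \<Phi> "\<lambda>p. blinfun_apply (Y p)"])
    show "Ck_on (Suc 0) \<Phi> ?U"
    proof (rule Ck_on_SucI[OF openU, where f'="\<lambda>p v. fst v *\<^sub>R X (\<Phi> p) + Y p (snd v)"])
      show "(\<Phi> has_derivative (\<lambda>v. fst v *\<^sub>R X (\<Phi> p) + Y p (snd v))) (at p)" if "p \<in> ?U" for p
        using der[of "fst p" "snd p"] that by (simp add: case_prod_unfold mem_Times_iff)
      have "continuous_on ?U (\<lambda>p. X (\<Phi> p))"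
        by (rule continuous_on_compose2[OF Ck_on_continuous_on[OF C2] continuous_on_subset[OF cont\<Phi> subU]])
          (use \<Phi>W in auto)
      then show "Ck_on 0 (\<lambda>p. fst v *\<^sub>R X (\<Phi> p) + Y p (snd v)) ?U" for v
        using continuous_on_subset[OF contY subU] by (auto intro!: continuous_intros)
    qed
    show "((\<lambda>t. Y (t, z) w) has_vector_derivative
          frechet_derivative X (at (\<Phi> (t, z))) (Y (t, z) w)) (at t within {-T..T})"
      if "t \<in> {-T..T}" "z \<in> cball z0 r" for t z w
      using Yw'[OF that] by (simp only: frX[OF \<Phi>W[OF that]])
  qed (use T0 R \<Phi>W \<Phi>0 \<Phi>' Y0 der in \<open>auto simp: r_def\<close>)
qed

section \<open>Inner products and the Hamiltonian of a metric\<close>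

definition inner_form :: "('a::euclidean_space \<Rightarrow> 'a \<Rightarrow> real) \<Rightarrow> bool" where
  "inner_form B \<longleftrightarrow> bilinear B \<and> (\<forall>v w. B v w = B w v) \<and> (\<forall>v. v \<noteq> 0 \<longrightarrow> B v v > 0)"

text \<open>Covectors are represented as vectors, by means of the inner product of the Euclidean space. The maps
  \<open>flat\<close> and \<open>sharp\<close> are the musical isomorphisms of the form \<open>B\<close> under this identification.\<close>

definition flat :: "('a::euclidean_space \<Rightarrow> 'a \<Rightarrow> real) \<Rightarrow> 'a \<Rightarrow> 'a" where
  "flat B v = (\<Sum>b\<in>Basis. B v b *\<^sub>R b)"

definition sharp :: "('a::euclidean_space \<Rightarrow> 'a \<Rightarrow> real) \<Rightarrow> 'a \<Rightarrow> 'a" where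
  "sharp B = inv (flat B)"

context
  fixes B :: "'a::euclidean_space \<Rightarrow> 'a \<Rightarrow> real"
  assumes B: "inner_form B"
begin

lemma inner_form_bilinear: "bilinear B" and inner_form_sym: "B v w = B w v"
  and inner_form_pos: "v \<noteq> 0 \<Longrightarrow> B v v > 0"
  using B by (auto simp: inner_form_def)

lemma inner_form_linear_right: "linear (B v)" and inner_form_linear_left: "linear (\<lambda>v. B v w)"
  using inner_form_bilinear by (auto simp: bilinear_def)

lemmas inner_form_add_left = linear_add[OF inner_form_linear_left]
  and inner_form_add_right = linear_add[OF inner_form_linear_right]
  and inner_form_scale_left = linear_scale[OF inner_form_linear_left, unfolded real_scaleR_def]
  and inner_form_scale_right = linear_scale[OF inner_form_linear_right, unfolded real_scaleR_def]
  and inner_form_diff_left = linear_diff[OF inner_form_linear_left]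
  and inner_form_diff_right = linear_diff[OF inner_form_linear_right]
  and inner_form_sum_left = linear_sum[OF inner_form_linear_left]
  and inner_form_sum_right = linear_sum[OF inner_form_linear_right]

lemma inner_form_zero [simp]: "B 0 w = 0" "B v 0 = 0"
  using linear_0[OF inner_form_linear_left] linear_0[OF inner_form_linear_right] by auto

lemma inner_form_eq_0_iff: "B v v = 0 \<longleftrightarrow> v = 0"
  using inner_form_pos[of v] by (cases "v = 0") simp_all

lemma inner_form_nonneg: "B v v \<ge> 0"
  using inner_form_pos[of v] by (cases "v = 0") simp_all

lemma flat_inner: "flat B v \<bullet> w = B v w"
  unfolding flat_def by (rule linear_functional_inner[OF inner_form_linear_right])

lemma linear_flat: "linear (flat B)"
  by (rule linearI) (simp_all add: flat_def linear_add[OF inner_form_linear_left]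
      linear_scale[OF inner_form_linear_left] scaleR_left_distrib sum.distrib scaleR_sum_right)

lemma bij_flat: "bij (flat B)"
proof -
  have "inj (flat B)"
    unfolding linear_injective_0[OF linear_flat]
    by (metis flat_inner inner_form_eq_0_iff inner_zero_left)
  then show ?thesis
    using linear_flat linear_injective_imp_surjective by (auto simp: bij_def)
qed

lemma flat_sharp [simp]: "flat B (sharp B v) = v" and sharp_flat [simp]: "sharp B (flat B v) = v"
  unfolding sharp_def using bij_flat by (auto simp: bij_def surj_f_inv_f)

lemma sharp_inner: "B (sharp B \<alpha>) w = \<alpha> \<bullet> w"
  by (metis flat_inner flat_sharp)

lemma sharp_unique: "(\<And>w. B v w = \<alpha> \<bullet> w) \<Longrightarrow> v = sharp B \<alpha>"
  by (metis flat_inner vector_eq_rdot sharp_flat)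

lemma linear_sharp: "linear (sharp B)"
  unfolding sharp_def using linear_flat bij_flat
  by (metis bij_def inj_linear_imp_inv_linear)

lemma sharp_selfadjoint: "\<alpha> \<bullet> sharp B \<beta> = sharp B \<alpha> \<bullet> \<beta>"
  by (metis inner_commute inner_form_sym sharp_inner)

lemma sharp_pos: "\<alpha> \<noteq> 0 \<Longrightarrow> \<alpha> \<bullet> sharp B \<alpha> > 0"
  using inner_form_pos[of "sharp B \<alpha>"] sharp_inner[of \<alpha> "sharp B \<alpha>"] flat_sharp[of \<alpha>]
    linear_0[OF linear_flat] by (cases "sharp B \<alpha> = 0") simp_all

end

text \<open>A Riemannian metric on an open subset of Euclidean space: the shape of a Riemannian metric in a chart.\<close>

locale metric_on =
  fixes S :: "'a::euclidean_space set" and G :: "'a \<Rightarrow> 'a \<Rightarrow> 'a \<Rightarrow> real"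
  assumes open_S: "open S"
    and form: "p \<in> S \<Longrightarrow> inner_form (G p)"
    and smooth: "smooth_on (\<lambda>p. G p v w) S"
begin

lemma Ck_on_metric: "Ck_on k (\<lambda>p. G p v w) S"
  using smooth by (simp add: smooth_on_def)

lemma Ck_on_flat: "Ck_on k (\<lambda>p. flat (G p) v) S"
  unfolding flat_def by (intro Ck_on_sum Ck_on_scaleR Ck_on_const Ck_on_metric open_S)

lemma Ck_on_sharp: "Ck_on k (\<lambda>p. sharp (G p) v) S"
  by (rule Ck_on_inverse_family[where A="\<lambda>p. flat (G p)"])
    (use form in \<open>auto simp: open_S linear_flat linear_sharp Ck_on_flat\<close>)

text \<open>Half the squared norm of the covector \<open>p\<close> at the point \<open>x\<close>, with \<open>z = (x, p)\<close>. Its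
  Hamiltonian field \<open>X\<close> below generates the geodesic flow.\<close>

definition H :: "'a \<times> 'a \<Rightarrow> real" where
  "H z = (snd z \<bullet> sharp (G (fst z)) (snd z)) / 2"

definition DH :: "'a \<times> 'a \<Rightarrow> 'a \<times> 'a \<Rightarrow> real" where
  "DH z = frechet_derivative H (at z)"

definition X :: "'a \<times> 'a \<Rightarrow> 'a \<times> 'a" where
  "X z = (sharp (G (fst z)) (snd z), - (\<Sum>b\<in>Basis. DH z (b, 0) *\<^sub>R b))"

lemma open_phase: "open (S \<times> (UNIV :: 'a set))"
  by (intro open_Times open_S open_UNIV)

text \<open>Linearity in the momentum reduces joint smoothness in \<open>(x, p)\<close> to smoothness in \<open>x\<close>.\<close>

lemma Ck_on_sharp_phase: "Ck_on k (\<lambda>z. sharp (G (fst z)) (snd z)) (S \<times> UNIV)"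
proof -
  have "Ck_on k (\<lambda>z::'a \<times> 'a. \<Sum>b\<in>Basis. (snd z \<bullet> b) *\<^sub>R sharp (G (fst z)) b) (S \<times> UNIV)"
  proof (intro Ck_on_sum Ck_on_scaleR Ck_on_inner Ck_on_const open_phase)
    show "Ck_on k snd (S \<times> (UNIV :: 'a set))"
      by (intro Ck_on_bounded_linear open_phase bounded_linear_snd)
    show "Ck_on k (\<lambda>z. sharp (G (fst z)) b) (S \<times> (UNIV :: 'a set))" for b
      by (rule Ck_on_compose[OF open_phase open_S _ _ Ck_on_sharp, of fst])
        (auto intro: Ck_on_bounded_linear open_phase bounded_linear_fst)
  qed
  then show ?thesis
  proof (rule Ck_on_cong[OF open_phase, rotated])
    fix z :: "'a \<times> 'a" assume "z \<in> S \<times> UNIV"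
    then have "linear (sharp (G (fst z)))" by (intro linear_sharp form) (simp add: mem_Times_iff)
    then show "(\<Sum>b\<in>Basis. (snd z \<bullet> b) *\<^sub>R sharp (G (fst z)) b) = sharp (G (fst z)) (snd z)"
      using linear_eq_sum_Basis[of "sharp (G (fst z))" "snd z"] by simp
  qed
qed

lemma Ck_on_H: "Ck_on k H (S \<times> UNIV)"
proof -
  have "Ck_on k (\<lambda>z::'a \<times> 'a. (snd z \<bullet> sharp (G (fst z)) (snd z)) *\<^sub>R (1/2 :: real)) (S \<times> UNIV)"
    by (intro Ck_on_scaleR Ck_on_inner open_phase Ck_on_sharp_phase Ck_on_const
        Ck_on_bounded_linear bounded_linear_snd)
  then show ?thesis by (simp add: H_def[abs_def])
qed

lemma H_has_derivative: "fst z \<in> S \<Longrightarrow> (H has_derivative DH z) (at z)"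
  using Ck_on_Suc_has_derivative[OF Ck_on_H, of z] by (simp add: DH_def mem_Times_iff)

lemma linear_DH: "fst z \<in> S \<Longrightarrow> linear (DH z)"
  using H_has_derivative has_derivative_linear by blast

lemma DH_momentum: assumes "x \<in> S" shows "DH (x, p) (0, \<pi>) = \<pi> \<bullet> sharp (G x) p"
proof -
  have B: "inner_form (G x)" using form assms .
  have bl: "bounded_linear (sharp (G x))" using linear_sharp[OF B] linear_linear by blast
  have "((\<lambda>t. H (x, p + t *\<^sub>R \<pi>)) has_derivative (\<lambda>t. DH (x, p) (0, t *\<^sub>R \<pi>))) (at 0)"
  proof (rule has_derivative_compose[of "\<lambda>t. (x, p + t *\<^sub>R \<pi>)" _ 0 UNIV H "DH (x, p)"])
    show "((\<lambda>t. (x, p + t *\<^sub>R \<pi>)) has_derivative (\<lambda>t. (0, t *\<^sub>R \<pi>))) (at 0)"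
      by (auto intro!: derivative_eq_intros)
    show "(H has_derivative DH (x, p)) (at (x, p + 0 *\<^sub>R \<pi>))"
      using H_has_derivative[of "(x, p)"] assms by simp
  qed
  moreover have "((\<lambda>t. ((p + t *\<^sub>R \<pi>) \<bullet> sharp (G x) (p + t *\<^sub>R \<pi>)) / 2) has_derivative
      (\<lambda>t. ((p + 0 *\<^sub>R \<pi>) \<bullet> sharp (G x) (t *\<^sub>R \<pi>) + (t *\<^sub>R \<pi>) \<bullet> sharp (G x) (p + 0 *\<^sub>R \<pi>)) / 2)) (at 0)"
    by (rule bounded_linear.has_derivative[OF bounded_linear_divide])
      (auto intro!: derivative_eq_intros bounded_linear.has_derivative[OF bl])
  then have "((\<lambda>t. H (x, p + t *\<^sub>R \<pi>)) has_derivative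
      (\<lambda>t. (p \<bullet> sharp (G x) (t *\<^sub>R \<pi>) + (t *\<^sub>R \<pi>) \<bullet> sharp (G x) p) / 2)) (at 0)"
    by (simp add: H_def)
  ultimately have "(\<lambda>t. DH (x, p) (0, t *\<^sub>R \<pi>)) =
      (\<lambda>t. (p \<bullet> sharp (G x) (t *\<^sub>R \<pi>) + (t *\<^sub>R \<pi>) \<bullet> sharp (G x) p) / 2)"
    by (rule has_derivative_unique)
  from fun_cong[OF this, of 1] show ?thesis
    using sharp_selfadjoint[OF B, of p \<pi>] by (simp add: inner_commute)
qed

text \<open>This identifies \<open>X\<close> as the Hamiltonian field \<open>(H\<^sub>p, - H\<^sub>x)\<close> of \<open>H\<close>.\<close>

lemma DH_split:
  assumes "fst z \<in> S"
  shows "DH z V = - (snd (X z) \<bullet> fst V) + snd V \<bullet> fst (X z)"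
proof -
  obtain x p where z: "z = (x, p)" by (cases z)
  have "DH z V = DH z ((fst V, 0) + (0, snd V))" by simp
  also have "\<dots> = DH z (fst V, 0) + DH z (0, snd V)"
    by (rule linear_add[OF linear_DH[OF assms]])
  also have "DH z (0, snd V) = snd V \<bullet> fst (X z)"
    using DH_momentum assms by (simp add: z X_def)
  also have "DH z (fst V, 0) = - (snd (X z) \<bullet> fst V)"
  proof -
    have "linear (\<lambda>v. DH z (v, 0))"
      by (rule linear_compose[OF _ linear_DH[OF assms], of "\<lambda>v. (v, 0)", unfolded o_def])
        (auto intro!: linearI)
    from linear_eq_sum_Basis[OF this, of "fst V"] show ?thesis
      by (simp add: X_def inner_sum_left inner_commute[of "fst V"] mult.commute)
  qed
  finally show ?thesis by simp
qed

lemma DH_X: "fst z \<in> S \<Longrightarrow> DH z (X z) = 0"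
  by (simp add: DH_split inner_commute)

lemma H_eq: "H z = (snd z \<bullet> fst (X z)) / 2"
  by (simp add: H_def X_def)

lemma Ck_on_X: "Ck_on k X (S \<times> UNIV)"
proof -
  have "Ck_on k (\<lambda>z. DH z (b, 0)) (S \<times> UNIV)" for b
    using iffD1[OF Ck_on.simps(2) Ck_on_H[of "Suc k"]] unfolding DH_def by blast
  then have "Ck_on k (\<lambda>z. - (\<Sum>b\<in>Basis. DH z (b, 0) *\<^sub>R b)) (S \<times> UNIV)"
    by (intro Ck_on_linear_image[OF bounded_linear_minus[OF bounded_linear_ident]]
        Ck_on_sum Ck_on_scaleR Ck_on_const open_phase)
  then show ?thesis
    unfolding X_def by (intro Ck_on_Pair open_phase Ck_on_sharp_phase)
qed

definition DX :: "'a \<times> 'a \<Rightarrow> 'a \<times> 'a \<Rightarrow> 'a \<times> 'a" where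
  "DX z = frechet_derivative X (at z)"

lemma X_has_derivative: "fst z \<in> S \<Longrightarrow> (X has_derivative DX z) (at z)"
  using Ck_on_Suc_has_derivative[OF Ck_on_X, of z] by (simp add: DX_def mem_Times_iff)

text \<open>The infinitesimal Gauss lemma. If \<open>V\<close> moves along the flow, \<open>V' = DX V\<close>, then the left side is the time
  derivative of the pairing of the momentum with the spatial part of \<open>V\<close>. It equals \<open>DH V\<close> since
  \<open>H\<close> is homogeneous of degree two in the momentum, that is, \<open>2 H z\<close> is the pairing of \<open>snd z\<close> with
  \<open>fst (X z)\<close>. Hence the pairing is conserved for variations within a level set of \<open>H\<close>.\<close>

lemma gauss_identity:
  assumes "fst z \<in> S"
  shows "snd (X z) \<bullet> fst V + snd z \<bullet> fst (DX z V) = DH z V"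
proof -
  have "((\<lambda>z. (snd z \<bullet> fst (X z)) / 2) has_derivative
      (\<lambda>V. (snd z \<bullet> fst (DX z V) + snd V \<bullet> fst (X z)) / 2)) (at z)"
    by (intro bounded_linear.has_derivative[OF bounded_linear_divide] has_derivative_inner
        has_derivative_fst has_derivative_snd has_derivative_ident X_has_derivative assms)
  then have "(H has_derivative (\<lambda>V. (snd z \<bullet> fst (DX z V) + snd V \<bullet> fst (X z)) / 2)) (at z)"
    by (simp only: H_eq[symmetric])
  then have "DH z = (\<lambda>V. (snd z \<bullet> fst (DX z V) + snd V \<bullet> fst (X z)) / 2)"
    by (rule has_derivative_unique[OF H_has_derivative[OF assms]])
  then have "2 * DH z V = snd z \<bullet> fst (DX z V) + snd V \<bullet> fst (X z)" by simp
  then show ?thesis using DH_split[OF assms, of V] by simp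
qed

end

section \<open>Eikonal functions with prescribed second derivative\<close>

context metric_on
begin

lemma H_scale: "x \<in> S \<Longrightarrow> H (x, c *\<^sub>R p) = c\<^sup>2 * H (x, p)"
  using linear_scale[OF linear_sharp[OF form], of x c p] by (simp add: H_def power2_eq_square)

lemma H_pos: "x \<in> S \<Longrightarrow> p \<noteq> 0 \<Longrightarrow> H (x, p) > 0"
  using sharp_pos[OF form] by (simp add: H_def)

text \<open>The method of characteristics. Let \<open>e\<close> be the unit vector of \<open>P0\<close>. The initial hypersurface is the
  paraboloid \<open>x0 s = y + s + (k/2) |s|\<^sup>2 e\<close> with \<open>s\<close> orthogonal to \<open>e\<close>. Its conormal \<open>n s = e - k s\<close>,
  scaled by \<open>\<rho> s\<close> to the energy \<open>H (y, P0)\<close>, is the initial momentum. A point \<open>s\<close> of the whole space encodes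
  the initial point given by its component orthogonal to \<open>e\<close> together with the time \<open>s \<bullet> e\<close>; the flow gives a
  map \<open>F\<close> into phase space whose spatial part \<open>f\<close> is a diffeomorphism near \<open>0\<close>, with inverse \<open>\<psi>\<close>.

  The solution is \<open>u x = 2 H (y, P0) (\<psi> x \<bullet> e)\<close>, and its differential \<open>P x\<close> is the momentum part of
  \<open>F (\<psi> x)\<close>: by the Gauss lemma the pairing of the momentum with the image of \<open>a\<close> under \<open>Df\<close> is constant along
  characteristics, and on the initial hypersurface it equals \<open>2 H (y, P0) (a \<bullet> e)\<close>, because the momentum
  is conormal there. So \<open>u\<close> is \<open>C\<^sup>2\<close> although \<open>F\<close> and \<open>\<psi>\<close> are only \<open>C\<^sup>1\<close>.

  The last three conclusions describe the second derivative \<open>D\<close> of \<open>u\<close> at \<open>y\<close>. In the direction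
  \<open>fst (X (y, P0))\<close>, the gradient of \<open>u\<close>, it does not depend on \<open>k\<close>; on the hyperplane orthogonal to \<open>P0\<close>
  it is controlled by the curvature \<open>k\<close> of the level set.\<close>

lemma eikonal_solution:
  assumes yS: "y \<in> S" and P0: "P0 \<noteq> 0"
  obtains V u P D where "open V" "y \<in> V" "V \<subseteq> S"
    "Ck_on (Suc (Suc 0)) u V"
    "\<And>x. x \<in> V \<Longrightarrow> (u has_derivative (\<lambda>v. P x \<bullet> v)) (at x)"
    "\<And>x. x \<in> V \<Longrightarrow> H (x, P x) = H (y, P0)"
    "P y = P0" "(P has_derivative D) (at y)"
    "D (fst (X (y, P0))) = snd (X (y, P0))"
    "\<And>v. D v \<bullet> fst (X (y, P0)) = snd (X (y, P0)) \<bullet> v"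
    "\<And>w. w \<bullet> P0 = 0 \<Longrightarrow> D w \<bullet> w = - (k * norm P0 * (w \<bullet> w))"
proof -
  define e where "e = P0 /\<^sub>R norm P0"
  have ee: "e \<bullet> e = 1" using P0 by (simp add: e_def dot_square_norm power2_eq_square)
  have P0e: "P0 = norm P0 *\<^sub>R e" using P0 by (simp add: e_def)
  have e0: "e \<noteq> 0" using ee by auto
  define c where "c = H (y, P0)"
  have c0: "c > 0" using H_pos[OF yS P0] by (simp add: c_def)
  define perp where "perp s = s - (s \<bullet> e) *\<^sub>R e" for s :: 'a
  have bl_perp: "bounded_linear perp"
    unfolding perp_def by (intro bounded_linear_sub bounded_linear_ident
        bounded_linear_scaleR_const bounded_linear_inner_left)
  have perp_e: "perp s \<bullet> e = 0" for s by (simp add: perp_def inner_diff_left ee)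
  have e_perp: "e \<bullet> perp s = 0" for s using perp_e by (simp add: inner_commute)
  have perp_shift: "perp (s + \<delta> *\<^sub>R e) = perp s" for s \<delta>
    by (simp add: perp_def inner_add_left ee algebra_simps)
  have perp_0: "perp 0 = 0" by (simp add: perp_def)
  define x0 where "x0 s = y + perp s + (k / 2 * (perp s \<bullet> perp s)) *\<^sub>R e" for s
  define n where "n s = e - k *\<^sub>R perp s" for s
  define \<rho> where "\<rho> s = sqrt (c / H (x0 s, n s))" for s
  define \<zeta> where "\<zeta> s = (x0 s, \<rho> s *\<^sub>R n s)" for s
  define S1 where "S1 = {s. x0 s \<in> S}"
  \<comment> \<open>The \<open>e\<close>-component of \<open>n s\<close> is \<open>1\<close>.\<close>
  have n0: "n s \<noteq> 0" for s
  proof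
    assume "n s = 0"
    then have "n s \<bullet> e = 0" by simp
    then show False by (simp add: n_def inner_diff_left perp_e ee)
  qed
  have C_perp: "Ck_on j perp UNIV" for j by (intro Ck_on_bounded_linear bl_perp open_UNIV)
  have C_n: "Ck_on j n UNIV" for j
  proof -
    have "Ck_on j (\<lambda>s. e + (- k) *\<^sub>R perp s) UNIV"
      by (intro Ck_on_add Ck_on_scaleR Ck_on_const C_perp open_UNIV)
    then show ?thesis by (simp add: n_def[abs_def])
  qed
  have C_x0: "Ck_on j x0 UNIV" for j
    unfolding x0_def by (intro Ck_on_add Ck_on_scaleR Ck_on_mult Ck_on_inner Ck_on_const C_perp open_UNIV)
  have open_S1: "open S1"
    using open_vimage[OF open_S Ck_on_continuous_on[OF C_x0[of 0]]] by (simp add: S1_def vimage_def)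
  have H_n: "H (x0 s, n s) > 0" if "s \<in> S1" for s using H_pos n0 that by (simp add: S1_def)
  have C_Hn: "Ck_on j (\<lambda>s. H (x0 s, n s)) S1" for j
    by (rule Ck_on_compose[OF open_S1 open_phase _ _ Ck_on_H])
      (auto simp: S1_def[symmetric] intro!: Ck_on_Pair[OF open_S1] Ck_on_subset[OF C_n] Ck_on_subset[OF C_x0],
       simp add: S1_def)
  have C_sqrt: "Ck_on (Suc 0) (\<lambda>t. sqrt (c / t)) {0<..}"
  proof (rule Ck_on_SucI[OF open_greaterThan])
    show "((\<lambda>t. sqrt (c / t)) has_derivative (\<lambda>h. h *\<^sub>R (- (c / t\<^sup>2) / (2 * sqrt (c / t))))) (at t)"
      if "t \<in> {0<..}" for t
      using that c0 unfolding has_vector_derivative_def[symmetric] has_real_derivative_iff_has_vector_derivative[symmetric]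
      by (auto intro!: derivative_eq_intros simp: power2_eq_square field_simps)
    show "Ck_on 0 (\<lambda>t. h *\<^sub>R (- (c / t\<^sup>2) / (2 * sqrt (c / t)))) {0<..}" for h
      using c0 by (auto intro!: continuous_intros)
  qed
  have C_\<rho>: "Ck_on (Suc 0) \<rho> S1"
    unfolding \<rho>_def by (rule Ck_on_compose[OF open_S1 open_greaterThan _ C_Hn C_sqrt]) (use H_n in auto)
  have C_\<zeta>: "Ck_on (Suc 0) \<zeta> S1"
    unfolding \<zeta>_def
    by (intro Ck_on_Pair Ck_on_scaleR open_S1 C_\<rho> Ck_on_subset[OF C_n] Ck_on_subset[OF C_x0]) auto
  define \<zeta>' where "\<zeta>' s = frechet_derivative \<zeta> (at s)" for s
  have \<zeta>': "(\<zeta> has_derivative \<zeta>' s) (at s)" if "s \<in> S1" for s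
    using Ck_on_Suc_has_derivative[OF C_\<zeta> that] by (simp add: \<zeta>'_def)
  have fst_\<zeta>': "fst (\<zeta>' s a) = perp a + (k * (perp s \<bullet> perp a)) *\<^sub>R e" if "s \<in> S1" for s a
  proof -
    have 1: "(x0 has_derivative (\<lambda>a. fst (\<zeta>' s a))) (at s)"
      using has_derivative_fst[OF \<zeta>'[OF that]] by (simp add: \<zeta>_def)
    have 2: "(x0 has_derivative (\<lambda>a. perp a + (k * (perp s \<bullet> perp a)) *\<^sub>R e)) (at s)"
      unfolding x0_def
      by (auto intro!: derivative_eq_intros bounded_linear.has_derivative[OF bl_perp] simp: inner_commute)
    show ?thesis using fun_cong[OF has_derivative_unique[OF 1 2]] .
  qed
  have \<zeta>_shift: "\<zeta> (s + \<delta> *\<^sub>R e) = \<zeta> s" for s \<delta>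
    by (simp add: \<zeta>_def x0_def n_def \<rho>_def perp_shift)
  have S1_shift: "s + \<delta> *\<^sub>R e \<in> S1 \<longleftrightarrow> s \<in> S1" for s \<delta> by (simp add: S1_def x0_def perp_shift)
  have \<zeta>'_shift: "\<zeta>' (s + \<delta> *\<^sub>R e) = \<zeta>' s" if "s \<in> S1" for s \<delta>
  proof -
    have sh: "((\<lambda>s. s + \<delta> *\<^sub>R e) has_derivative (\<lambda>a. a)) (at s)"
      using has_derivative_add[OF has_derivative_ident has_derivative_const] by simp
    have "s + \<delta> *\<^sub>R e \<in> S1" using that by (simp add: S1_shift)
    from has_derivative_compose[OF sh \<zeta>'[OF this]]
    have "((\<lambda>s. \<zeta> (s + \<delta> *\<^sub>R e)) has_derivative \<zeta>' (s + \<delta> *\<^sub>R e)) (at s)" .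
    then show ?thesis
      unfolding \<zeta>_shift by (rule has_derivative_unique[OF _ \<zeta>'[OF that]])
  qed
  have H_\<zeta>: "H (\<zeta> s) = c" if "s \<in> S1" for s
    using that H_n[OF that] c0 H_scale[of "x0 s"] by (simp add: \<zeta>_def \<rho>_def S1_def)
  have S1_0: "0 \<in> S1" using yS by (simp add: S1_def x0_def perp_0)
  have \<rho>0: "\<rho> 0 = norm P0"
  proof -
    have "c = (norm P0)\<^sup>2 * H (y, e)" using H_scale[OF yS, of "norm P0" e] P0e by (simp add: c_def)
    then show ?thesis
      using H_pos[OF yS e0] by (simp add: \<rho>_def x0_def n_def perp_0)
  qed
  have \<zeta>0: "\<zeta> 0 = (y, P0)"
    using P0e by (simp add: \<zeta>_def \<rho>0) (simp add: x0_def n_def perp_0)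
  have phase: "(y, P0) \<in> S \<times> UNIV" using yS by simp
  obtain T r \<Phi> Y where T: "T > 0" and r: "r > 0"
    and \<Phi>W: "\<And>t z. t \<in> {-T..T} \<Longrightarrow> z \<in> cball (y, P0) r \<Longrightarrow> \<Phi> (t, z) \<in> S \<times> UNIV"
    and \<Phi>0: "\<And>z. z \<in> cball (y, P0) r \<Longrightarrow> \<Phi> (0, z) = z"
    and \<Phi>': "\<And>t z. t \<in> {-T..T} \<Longrightarrow> z \<in> cball (y, P0) r \<Longrightarrow>
        ((\<lambda>t. \<Phi> (t, z)) has_vector_derivative X (\<Phi> (t, z))) (at t within {-T..T})"
    and Y0: "\<And>z w. z \<in> cball (y, P0) r \<Longrightarrow> Y (0, z) w = w"
    and Y': "\<And>t z w. t \<in> {-T..T} \<Longrightarrow> z \<in> cball (y, P0) r \<Longrightarrow>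
        ((\<lambda>t. Y (t, z) w) has_vector_derivative DX (\<Phi> (t, z)) (Y (t, z) w)) (at t within {-T..T})"
    and \<Phi>_der: "\<And>t z. t \<in> {-T<..<T} \<Longrightarrow> z \<in> ball (y, P0) r \<Longrightarrow>
        (\<Phi> has_derivative (\<lambda>(s, w). s *\<^sub>R X (\<Phi> (t, z)) + Y (t, z) w)) (at (t, z))"
    and C_\<Phi>: "Ck_on (Suc 0) \<Phi> ({-T<..<T} \<times> ball (y, P0) r)"
    by (rule flow_C1[OF open_phase phase Ck_on_X, folded DX_def], rule that)
  have \<Phi>S: "fst (\<Phi> (t, z)) \<in> S" if "t \<in> {-T<..<T}" "z \<in> ball (y, P0) r" for t z
    using \<Phi>W[of t z] that by (simp add: mem_Times_iff)
  have \<Phi>_open: "((\<lambda>t. \<Phi> (t, z)) has_vector_derivative X (\<Phi> (t, z))) (at t within {-T<..<T})"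
    and Y_open: "((\<lambda>t. Y (t, z) w) has_vector_derivative DX (\<Phi> (t, z)) (Y (t, z) w)) (at t within {-T<..<T})"
    if "t \<in> {-T<..<T}" "z \<in> ball (y, P0) r" for t z w
    using that by (auto intro!: has_vector_derivative_within_subset[OF \<Phi>'] has_vector_derivative_within_subset[OF Y'])
  \<comment> \<open>The parameters whose characteristic is defined up to the encoded time.\<close>
  define Dm where "Dm = {s. s \<bullet> e \<in> {-T<..<T} \<and> s \<in> S1 \<and> \<zeta> s \<in> ball (y, P0) r}"
  have open_Dm: "open Dm"
  proof -
    have "open (S1 \<inter> \<zeta> -` ball (y, P0) r)"
      by (intro continuous_open_preimage open_S1 open_ball Ck_on_continuous_on[OF C_\<zeta>])
    moreover have "open ((\<lambda>s. s \<bullet> e) -` {-T<..<T})"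
      by (intro open_vimage open_greaterThanLessThan continuous_intros)
    ultimately have "open ((S1 \<inter> \<zeta> -` ball (y, P0) r) \<inter> ((\<lambda>s. s \<bullet> e) -` {-T<..<T}))" by (rule open_Int)
    also have "\<dots> = Dm" by (auto simp: Dm_def)
    finally show ?thesis .
  qed
  have Dm_0: "0 \<in> Dm" using T r S1_0 by (simp add: Dm_def \<zeta>0)
  define F where "F s = \<Phi> (s \<bullet> e, \<zeta> s)" for s
  define F' where "F' s a = (a \<bullet> e) *\<^sub>R X (F s) + Y (s \<bullet> e, \<zeta> s) (\<zeta>' s a)" for s a
  have C_F: "Ck_on (Suc 0) F Dm"
    unfolding F_def
  proof (rule Ck_on_compose[OF open_Dm _ _ _ C_\<Phi>])
    show "Ck_on (Suc 0) (\<lambda>s. (s \<bullet> e, \<zeta> s)) Dm"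
      by (intro Ck_on_Pair open_Dm Ck_on_subset[OF C_\<zeta>] Ck_on_bounded_linear bounded_linear_inner_left)
        (auto simp: Dm_def)
  qed (auto simp: Dm_def intro!: open_Times)
  have F': "(F has_derivative F' s) (at s)" if s: "s \<in> Dm" for s
  proof -
    have j: "((\<lambda>s. (s \<bullet> e, \<zeta> s)) has_derivative (\<lambda>a. (a \<bullet> e, \<zeta>' s a))) (at s)"
      using s by (intro has_derivative_Pair has_derivative_inner_left has_derivative_ident \<zeta>') (simp add: Dm_def)
    have "(\<Phi> has_derivative (\<lambda>(\<tau>, w). \<tau> *\<^sub>R X (F s) + Y (s \<bullet> e, \<zeta> s) w)) (at (s \<bullet> e, \<zeta> s))"
      using \<Phi>_der[of "s \<bullet> e" "\<zeta> s"] s by (simp add: Dm_def F_def)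
    from has_derivative_compose[OF j this] show ?thesis
      by (simp add: F_def[abs_def] F'_def[abs_def])
  qed
  have F_S: "fst (F s) \<in> S" if "s \<in> Dm" for s
    using \<Phi>S that by (simp add: Dm_def F_def)
  \<comment> \<open>Conservation of energy.\<close>
  have H_F: "H (F s) = c" if s: "s \<in> Dm" for s
  proof -
    have z: "\<zeta> s \<in> ball (y, P0) r" "s \<bullet> e \<in> {-T<..<T}" using s by (auto simp: Dm_def)
    have "((\<lambda>\<tau>. H (\<Phi> (\<tau>, \<zeta> s))) has_derivative (\<lambda>_. 0)) (at \<tau> within {-T<..<T})"
      if \<tau>: "\<tau> \<in> {-T<..<T}" for \<tau>
    proof -
      have lin: "linear (DH (\<Phi> (\<tau>, \<zeta> s)))" by (rule linear_DH[OF \<Phi>S[OF \<tau> z(1)]])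
      have "((\<lambda>\<tau>. H (\<Phi> (\<tau>, \<zeta> s))) has_derivative (\<lambda>h. DH (\<Phi> (\<tau>, \<zeta> s)) (h *\<^sub>R X (\<Phi> (\<tau>, \<zeta> s)))))
          (at \<tau> within {-T<..<T})"
        by (rule has_derivative_compose[OF \<Phi>_open[OF \<tau> z(1), unfolded has_vector_derivative_def]
              H_has_derivative[OF \<Phi>S[OF \<tau> z(1)]]])
      then show ?thesis
        by (simp add: linear_scale[OF lin] DH_X[OF \<Phi>S[OF \<tau> z(1)]])
    qed
    then obtain h where "\<And>\<tau>. \<tau> \<in> {-T<..<T} \<Longrightarrow> H (\<Phi> (\<tau>, \<zeta> s)) = h"
      using has_derivative_zero_constant[of "{-T<..<T}" "\<lambda>\<tau>. H (\<Phi> (\<tau>, \<zeta> s))"] convex_real_interval(8) by blast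
    then have "H (\<Phi> (s \<bullet> e, \<zeta> s)) = H (\<Phi> (0, \<zeta> s))" using z(2) T by simp
    then show ?thesis using H_\<zeta>[of s] s z(1) by (simp add: F_def \<Phi>0 Dm_def)
  qed
  have DH_F: "DH (F s) (F' s a) = 0" if s: "s \<in> Dm" for s a
  proof -
    have 1: "((\<lambda>s. H (F s)) has_derivative (\<lambda>a. DH (F s) (F' s a))) (at s)"
      by (rule has_derivative_compose[OF F'[OF s] H_has_derivative[OF F_S[OF s]]])
    have 2: "((\<lambda>s. H (F s)) has_derivative (\<lambda>a. 0)) (at s)"
      by (rule has_derivative_transform_within_open[OF has_derivative_const[of c] open_Dm s]) (simp add: H_F)
    show ?thesis using fun_cong[OF has_derivative_unique[OF 1 2]] .
  qed
  have gauss: "snd (F s) \<bullet> fst (F' s a) = 2 * c * (a \<bullet> e)" if s: "s \<in> Dm" for s a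
  proof -
    define z where "z = \<zeta> s"
    have z: "z \<in> ball (y, P0) r" "s \<bullet> e \<in> {-T<..<T}" "s \<in> S1" using s by (auto simp: Dm_def z_def)
    \<comment> \<open>The variation of the characteristic through \<open>s\<close> in the direction \<open>a\<close>, at time \<open>\<tau>\<close>.\<close>
    define V where "V \<tau> = (a \<bullet> e) *\<^sub>R X (\<Phi> (\<tau>, z)) + Y (\<tau>, z) (\<zeta>' s a)" for \<tau>
    define \<theta> where "\<theta> \<tau> = snd (\<Phi> (\<tau>, z)) \<bullet> fst (V \<tau>)" for \<tau>
    have "(\<theta> has_vector_derivative 0) (at \<tau> within {-T<..<T})" if \<tau>: "\<tau> \<in> {-T<..<T}" for \<tau>
    proof -
      have S: "fst (\<Phi> (\<tau>, z)) \<in> S" by (rule \<Phi>S[OF \<tau> z(1)])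
      have linDX: "linear (DX (\<Phi> (\<tau>, z)))"
        using X_has_derivative[OF S] has_derivative_linear by blast
      have d\<Phi>: "((\<lambda>\<tau>. \<Phi> (\<tau>, z)) has_vector_derivative X (\<Phi> (\<tau>, z))) (at \<tau> within {-T<..<T})"
        by (rule \<Phi>_open[OF \<tau> z(1)])
      have "((\<lambda>\<tau>. X (\<Phi> (\<tau>, z))) has_vector_derivative DX (\<Phi> (\<tau>, z)) (X (\<Phi> (\<tau>, z)))) (at \<tau> within {-T<..<T})"
        using has_derivative_compose[OF d\<Phi>[unfolded has_vector_derivative_def] X_has_derivative[OF S]]
        by (simp add: has_vector_derivative_def linear_scale[OF linDX])
      then have "(V has_vector_derivative ((a \<bullet> e) *\<^sub>R DX (\<Phi> (\<tau>, z)) (X (\<Phi> (\<tau>, z)))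
            + DX (\<Phi> (\<tau>, z)) (Y (\<tau>, z) (\<zeta>' s a)))) (at \<tau> within {-T<..<T})"
        unfolding V_def
        by (intro has_vector_derivative_add Y_open \<tau> z(1)
            bounded_linear.has_vector_derivative[OF bounded_linear_scaleR_right])
      then have dV: "(V has_vector_derivative DX (\<Phi> (\<tau>, z)) (V \<tau>)) (at \<tau> within {-T<..<T})"
        by (simp add: V_def linear_add[OF linDX] linear_scale[OF linDX])
      have "(\<theta> has_vector_derivative (snd (\<Phi> (\<tau>, z)) \<bullet> fst (DX (\<Phi> (\<tau>, z)) (V \<tau>))
          + snd (X (\<Phi> (\<tau>, z))) \<bullet> fst (V \<tau>))) (at \<tau> within {-T<..<T})"
        unfolding \<theta>_def
        by (intro bounded_bilinear.has_vector_derivative[OF bounded_bilinear_inner]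
            bounded_linear.has_vector_derivative[OF bounded_linear_snd d\<Phi>]
            bounded_linear.has_vector_derivative[OF bounded_linear_fst dV])
      moreover have "DH (\<Phi> (\<tau>, z)) (V \<tau>) = 0"
      proof -
        \<comment> \<open>The vector \<open>V \<tau>\<close> is an image under \<open>DF\<close>, taken at the parameter with the same initial point and
          time \<open>\<tau>\<close>; therefore it is tangent to the level set of \<open>H\<close>.\<close>
        define s' where "s' = s + (\<tau> - s \<bullet> e) *\<^sub>R e"
        have s'e: "s' \<bullet> e = \<tau>" by (simp add: s'_def inner_add_left ee)
        have \<zeta>s': "\<zeta> s' = z" unfolding s'_def \<zeta>_shift z_def ..
        have \<zeta>'s': "\<zeta>' s' = \<zeta>' s" unfolding s'_def using \<zeta>'_shift[OF z(3)] .
        have "s' \<in> S1" using z(3) by (simp add: s'_def S1_shift)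
        then have "s' \<in> Dm" using \<tau> z(1) by (simp add: Dm_def s'e \<zeta>s')
        from DH_F[OF this, of a] show ?thesis by (simp add: F_def F'_def V_def s'e \<zeta>s' \<zeta>'s')
      qed
      ultimately show ?thesis using gauss_identity[OF S, of "V \<tau>"] by (simp add: add.commute)
    qed
    then obtain h where "\<And>\<tau>. \<tau> \<in> {-T<..<T} \<Longrightarrow> \<theta> \<tau> = h"
      using has_vector_derivative_zero_constant[of "{-T<..<T}" \<theta>] convex_real_interval(8) by blast
    then have "\<theta> (s \<bullet> e) = \<theta> 0" using z(2) T by simp
    moreover have "\<theta> (s \<bullet> e) = snd (F s) \<bullet> fst (F' s a)" by (simp add: \<theta>_def V_def F_def F'_def z_def)
    moreover have "\<theta> 0 = (a \<bullet> e) * (snd z \<bullet> fst (X z)) + snd z \<bullet> fst (\<zeta>' s a)"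
      using z(1) by (simp add: \<theta>_def V_def \<Phi>0 Y0 inner_add_right)
    moreover have "snd z \<bullet> fst (X z) = 2 * c" using H_eq[of z] H_\<zeta>[OF z(3)] by (simp add: z_def)
    moreover have "snd z \<bullet> fst (\<zeta>' s a) = 0"
      by (simp add: fst_\<zeta>'[OF z(3)] z_def)
        (simp add: \<zeta>_def n_def inner_add_right inner_diff_left perp_e e_perp ee)
    ultimately show ?thesis by simp
  qed
  define f where "f s = fst (F s)" for s
  have C_f: "Ck_on (Suc 0) f Dm"
    unfolding f_def by (rule Ck_on_linear_image[OF bounded_linear_fst open_Dm C_F])
  obtain f' where f': "\<And>s. s \<in> Dm \<Longrightarrow> (f has_derivative blinfun_apply (f' s)) (at s)"
    and cont_f': "continuous_on Dm f'"
    by (rule Ck_on_1_blinfun[OF C_f], rule that)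
  have f'_F': "blinfun_apply (f' s) a = fst (F' s a)" if "s \<in> Dm" for s a
    using fun_cong[OF has_derivative_unique[OF f'[OF that] has_derivative_fst[OF F'[OF that], folded f_def]]] .
  have F0: "F 0 = (y, P0)" using r by (simp add: F_def \<zeta>0 \<Phi>0)
  have F'0: "F' 0 a = (a \<bullet> e) *\<^sub>R X (y, P0) + \<zeta>' 0 a" for a
    using r by (simp add: F'_def F0 \<zeta>0 Y0)
  have f'0: "blinfun_apply (f' 0) a = perp a + (a \<bullet> e) *\<^sub>R fst (X (y, P0))" for a
    by (simp add: f'_F'[OF Dm_0] F'0 fst_\<zeta>'[OF S1_0] perp_0)
  have eX: "fst (X (y, P0)) \<bullet> e > 0"
  proof -
    have "fst (X (y, P0)) = norm P0 *\<^sub>R sharp (G y) e"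
      using linear_scale[OF linear_sharp[OF form[OF yS]], of "norm P0" e] P0e by (simp add: X_def)
    then show ?thesis using sharp_pos[OF form[OF yS] e0] P0 by (simp add: inner_commute)
  qed
  have inj0: "inj (blinfun_apply (f' 0))"
    unfolding linear_injective_0[OF bounded_linear.linear[OF blinfun.bounded_linear_right]]
  proof (intro allI impI)
    fix a assume a: "blinfun_apply (f' 0) a = 0"
    then have "(perp a + (a \<bullet> e) *\<^sub>R fst (X (y, P0))) \<bullet> e = 0" by (simp add: f'0)
    then have "a \<bullet> e = 0" using eX by (simp add: inner_add_left perp_e)
    then show "a = 0" using a by (simp add: f'0 perp_def)
  qed
  obtain g0 where g0: "linear g0" "g0 \<circ> blinfun_apply (f' 0) = id"
    using linear_injective_left_inverse[OF bounded_linear.linear[OF blinfun.bounded_linear_right] inj0] by blast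
  have invf: "Blinfun g0 o\<^sub>L f' 0 = id_blinfun"
    using g0 by (intro blinfun_eqI)
      (simp add: bounded_linear_Blinfun_apply linear_linear fun_eq_iff)
  obtain U' V \<psi> \<psi>' where U': "open U'" "U' \<subseteq> Dm" "0 \<in> U'" and V: "open V" "f 0 \<in> V"
    and hom: "homeomorphism U' V f \<psi>"
    and \<psi>': "\<And>x. x \<in> V \<Longrightarrow> (\<psi> has_derivative \<psi>' x) (at x)"
    and \<psi>'_inv: "\<And>x. x \<in> V \<Longrightarrow> \<psi>' x = inv (blinfun_apply (f' (\<psi> x)))"
    and bij: "\<And>x. x \<in> V \<Longrightarrow> bij (blinfun_apply (f' (\<psi> x)))"
    by (rule inverse_function_theorem[OF open_Dm _ cont_f' Dm_0 invf], erule f', rule that)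
  have yV: "y \<in> V" using V(2) by (simp add: f_def F0)
  have \<psi>Dm: "\<psi> x \<in> Dm" and f\<psi>: "f (\<psi> x) = x" if "x \<in> V" for x
    using hom U'(2) that by (auto simp: homeomorphism_def)
  have \<psi>y: "\<psi> y = 0"
    using hom U'(3) F0 by (auto simp: homeomorphism_def f_def)
  have inv1: "blinfun_apply (f' (\<psi> x)) (\<psi>' x v) = v" and inv2: "\<psi>' x (blinfun_apply (f' (\<psi> x)) v) = v"
    if "x \<in> V" for x v
    using bij[OF that] by (simp_all add: \<psi>'_inv[OF that] bij_is_inj bij_is_surj surj_f_inv_f)
  have cont_\<psi>: "continuous_on V \<psi>" using hom by (simp add: homeomorphism_def)
  have C_\<psi>': "Ck_on 0 (\<lambda>x. \<psi>' x v) V" for v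
  proof (rule Ck_on_inverse_family[where A="\<lambda>x. blinfun_apply (f' (\<psi> x))", OF V(1)])
    show "linear (\<psi>' x)" if "x \<in> V" for x using \<psi>'[OF that] has_derivative_linear by blast
    have "continuous_on V (\<lambda>x. f' (\<psi> x))"
      by (rule continuous_on_compose2[OF cont_f' cont_\<psi>]) (use \<psi>Dm in auto)
    then show "Ck_on 0 (\<lambda>x. blinfun_apply (f' (\<psi> x)) v) V" for v
      by (auto intro!: continuous_intros)
  qed (use inv1 inv2 in \<open>auto simp: bounded_linear.linear[OF blinfun.bounded_linear_right]\<close>)
  have C_\<psi>: "Ck_on (Suc 0) \<psi> V"
    by (rule Ck_on_SucI[OF V(1) \<psi>' C_\<psi>'])
  define P where "P x = snd (F (\<psi> x))" for x
  define u where "u x = 2 * c * (\<psi> x \<bullet> e)" for x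
  have C_P: "Ck_on (Suc 0) P V"
    unfolding P_def
    by (intro Ck_on_linear_image[OF bounded_linear_snd] Ck_on_compose[OF V(1) open_Dm _ C_\<psi> C_F] V(1))
      (use \<psi>Dm in auto)
  have du: "(u has_derivative (\<lambda>v. P x \<bullet> v)) (at x)" if x: "x \<in> V" for x
  proof -
    have "(u has_derivative (\<lambda>v. 2 * c * (\<psi>' x v \<bullet> e))) (at x)"
      unfolding u_def by (intro has_derivative_mult_right has_derivative_inner_left \<psi>' x)
    moreover have "2 * c * (\<psi>' x v \<bullet> e) = P x \<bullet> v" for v
      using gauss[OF \<psi>Dm[OF x], of "\<psi>' x v"] f'_F'[OF \<psi>Dm[OF x], of "\<psi>' x v"] inv1[OF x, of v]
      by (simp add: P_def)
    ultimately show ?thesis by simp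
  qed
  define D where "D v = snd (F' 0 (\<psi>' y v))" for v
  have dP: "(P has_derivative D) (at y)"
    unfolding P_def D_def
    by (rule has_derivative_snd[OF has_derivative_compose[OF \<psi>'[OF yV] F'[OF Dm_0, folded \<psi>y], unfolded \<psi>y]])
  have FxP: "F (\<psi> x) = (x, P x)" if "x \<in> V" for x
    using f\<psi>[OF that] by (simp add: P_def f_def prod_eq_iff)
  have HP: "H (x, P x) = c" if "x \<in> V" for x
    using H_F[OF \<psi>Dm[OF that]] FxP[OF that] by simp
  have VS: "V \<subseteq> S" using F_S \<psi>Dm FxP by fastforce
  have Py: "P y = P0" by (simp add: P_def \<psi>y F0)
  show ?thesis
  proof (rule that[OF V(1) yV VS _ du _ Py dP])
    show "Ck_on (Suc (Suc 0)) u V"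
    proof (rule Ck_on_SucI[OF V(1) du])
      show "Ck_on (Suc 0) (\<lambda>x. P x \<bullet> v) V" for v by (intro Ck_on_inner V(1) C_P Ck_on_const)
    qed
    show "H (x, P x) = H (y, P0)" if "x \<in> V" for x using HP[OF that] by (simp add: c_def)
    have inv2': "\<psi>' y (perp a + (a \<bullet> e) *\<^sub>R fst (X (y, P0))) = a" for a
      using inv2[OF yV, of a] by (simp add: \<psi>y f'0)
    have lin\<zeta>': "linear (\<zeta>' 0)" using \<zeta>'[OF S1_0] has_derivative_linear by blast
    show "D (fst (X (y, P0))) = snd (X (y, P0))"
    proof -
      have pe: "perp e = 0" by (simp add: perp_def ee)
      \<comment> \<open>The initial data do not depend on the component along \<open>e\<close>.\<close>
      then have "\<zeta>' 0 e = 0"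
      proof -
        have "((\<lambda>t. \<zeta> (t *\<^sub>R e)) has_derivative (\<lambda>t. \<zeta>' 0 (t *\<^sub>R e))) (at 0)"
          by (rule has_derivative_compose[of "\<lambda>t. t *\<^sub>R e"])
            (use \<zeta>'[OF S1_0] in \<open>auto intro!: derivative_eq_intros\<close>)
        moreover have "(\<lambda>t. \<zeta> (t *\<^sub>R e)) = (\<lambda>t. \<zeta> 0)" using \<zeta>_shift[of 0] by auto
        ultimately have "((\<lambda>t::real. \<zeta> 0) has_derivative (\<lambda>t. \<zeta>' 0 (t *\<^sub>R e))) (at 0)" by simp
        from fun_cong[OF has_derivative_unique[OF this has_derivative_const], of 1]
        show ?thesis by simp
      qed
      then show ?thesis using inv2'[of e] by (simp add: D_def F'0 pe ee)
    qed
    show "D v \<bullet> fst (X (y, P0)) = snd (X (y, P0)) \<bullet> v" for v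
    proof -
      \<comment> \<open>The eikonal equation \<open>H (x, P x) = c\<close> is differentiated at \<open>y\<close>.\<close>
      have 1: "((\<lambda>x. H (x, P x)) has_derivative (\<lambda>v. DH (y, P0) (v, D v))) (at y)"
        by (rule has_derivative_compose[OF has_derivative_Pair[OF has_derivative_ident dP]])
          (use H_has_derivative[of "(y, P0)"] yS Py in simp)
      have 2: "((\<lambda>x. H (x, P x)) has_derivative (\<lambda>v. 0)) (at y)"
        by (rule has_derivative_transform_within_open[OF has_derivative_const[of c] V(1) yV]) (simp add: HP)
      have "DH (y, P0) (v, D v) = 0" using fun_cong[OF has_derivative_unique[OF 1 2]] .
      then show ?thesis using DH_split[of "(y, P0)" "(v, D v)"] yS by simp
    qed
    fix w :: 'a assume "w \<bullet> P0 = 0"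
    then have we: "w \<bullet> e = 0" "e \<bullet> w = 0" by (simp_all add: e_def inner_commute[of P0])
    then have pw: "perp w = w" by (simp add: perp_def)
    have Dw: "D w = snd (\<zeta>' 0 w)" using inv2'[of w] by (simp add: D_def F'0 we pw)
    define \<rho>' where "\<rho>' = frechet_derivative \<rho> (at 0)"
    have d\<rho>: "(\<rho> has_derivative \<rho>') (at 0)"
      using Ck_on_Suc_has_derivative[OF C_\<rho> S1_0] by (simp add: \<rho>'_def)
    have dn: "(n has_derivative (\<lambda>a. - (k *\<^sub>R perp a))) (at 0)"
      unfolding n_def
      by (auto intro!: derivative_eq_intros bounded_linear.has_derivative[OF bl_perp])
    have 1: "((\<lambda>s. \<rho> s *\<^sub>R n s) has_derivative (\<lambda>a. snd (\<zeta>' 0 a))) (at 0)"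
      using has_derivative_snd[OF \<zeta>'[OF S1_0]] by (simp add: \<zeta>_def)
    have 2: "((\<lambda>s. \<rho> s *\<^sub>R n s) has_derivative (\<lambda>a. \<rho> 0 *\<^sub>R (- (k *\<^sub>R perp a)) + \<rho>' a *\<^sub>R n 0)) (at 0)"
      by (rule has_derivative_scaleR[OF d\<rho> dn])
    have "D w = \<rho> 0 *\<^sub>R (- (k *\<^sub>R perp w)) + \<rho>' w *\<^sub>R n 0"
      unfolding Dw using fun_cong[OF has_derivative_unique[OF 1 2]] .
    then show "D w \<bullet> w = - (k * norm P0 * (w \<bullet> w))"
      using we by (simp add: pw \<rho>0 n_def perp_0 inner_diff_left inner_add_left)
  qed
qed

end

section \<open>Adjoints, conformality and orthonormal bases\<close>

definition metric_adjoint ::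
  "('a::euclidean_space \<Rightarrow> 'a \<Rightarrow> real) \<Rightarrow> ('b::euclidean_space \<Rightarrow> 'b \<Rightarrow> real) \<Rightarrow> ('a \<Rightarrow> 'b) \<Rightarrow> 'b \<Rightarrow> 'a" where
  "metric_adjoint B C T \<beta> = sharp B (\<Sum>b\<in>Basis. C \<beta> (T b) *\<^sub>R b)"

context
  fixes B :: "'a::euclidean_space \<Rightarrow> 'a \<Rightarrow> real" and C :: "'b::euclidean_space \<Rightarrow> 'b \<Rightarrow> real"
    and T :: "'a \<Rightarrow> 'b"
  assumes B: "inner_form B" and C: "inner_form C" and T: "linear T"
begin

lemma metric_adjoint: "B (metric_adjoint B C T \<beta>) v = C \<beta> (T v)"
proof -
  have "linear (\<lambda>v. C \<beta> (T v))"
    using linear_compose[OF T inner_form_linear_right[OF C]] by (simp add: o_def)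
  from linear_functional_inner[OF this] show ?thesis
    by (simp add: metric_adjoint_def sharp_inner[OF B])
qed

lemma metric_adjoint_unique: "(\<And>v. B w v = C \<beta> (T v)) \<Longrightarrow> w = metric_adjoint B C T \<beta>"
  using metric_adjoint[of \<beta>] unfolding metric_adjoint_def sharp_inner[OF B]
  by (intro sharp_unique[OF B]) simp

lemma linear_metric_adjoint: "linear (metric_adjoint B C T)"
  by (rule linearI; rule sym; rule metric_adjoint_unique)
    (simp_all add: inner_form_add_left[OF B] inner_form_scale_left[OF B]
      inner_form_add_left[OF C] inner_form_scale_left[OF C] metric_adjoint)

lemma metric_adjoint_zero_map: "(\<And>v. T v = 0) \<Longrightarrow> metric_adjoint B C T \<beta> = 0"
  by (rule metric_adjoint_unique[symmetric]) (simp add: inner_form_zero[OF B] inner_form_zero[OF C])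

text \<open>If \<open>T T\<^sup>* = l id\<close>, then \<open>w - T\<^sup>* T w / l\<close> is always vertical. For a horizontal \<open>w\<close> it is horizontal
  as well, hence zero, and \<open>T\<^sup>* T w = l w\<close>.\<close>

lemma conformal_of_adjoint:
  assumes l: "\<And>\<beta>. T (metric_adjoint B C T \<beta>) = l *\<^sub>R \<beta>"
    and nz: "T \<noteq> (\<lambda>_. 0)"
  shows "l > 0" "surj T"
    "(\<forall>k. T k = 0 \<longrightarrow> B v k = 0) \<Longrightarrow> (\<forall>k. T k = 0 \<longrightarrow> B w k = 0) \<Longrightarrow> C (T v) (T w) = l * B v w"
proof -
  have norm: "B (metric_adjoint B C T \<beta>) (metric_adjoint B C T \<beta>) = l * C \<beta> \<beta>" for \<beta>
    by (simp add: metric_adjoint l inner_form_scale_right[OF C])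
  obtain v0 where v0: "T v0 \<noteq> 0" using nz by auto
  have "metric_adjoint B C T (T v0) \<noteq> 0"
    using metric_adjoint[of "T v0" v0] inner_form_pos[OF C v0] inner_form_zero[OF B] by force
  then have "l * C (T v0) (T v0) > 0" using norm[of "T v0"] inner_form_pos[OF B] by metis
  then show l0: "l > 0" using inner_form_pos[OF C v0] by (simp add: zero_less_mult_iff)
  have "T (metric_adjoint B C T ((1 / l) *\<^sub>R \<beta>)) = \<beta>" for \<beta> using l0 by (simp add: l)
  then show "surj T" by (rule surjI)
  assume v: "\<forall>k. T k = 0 \<longrightarrow> B v k = 0" and w: "\<forall>k. T k = 0 \<longrightarrow> B w k = 0"
  define w' where "w' = w - (1 / l) *\<^sub>R metric_adjoint B C T (T w)"
  have Tw': "T w' = 0" using l0 by (simp add: w'_def linear_diff[OF T] linear_scale[OF T] l)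
  have "B w' w' = B w w' - (1 / l) * C (T w) (T w')"
    unfolding w'_def by (simp add: inner_form_diff_left[OF B]
        inner_form_scale_left[OF B] metric_adjoint)
  also have "\<dots> = 0" using w Tw' by (simp add: inner_form_zero[OF C])
  finally have "w' = 0" using inner_form_eq_0_iff[OF B] by simp
  then have "w = (1 / l) *\<^sub>R metric_adjoint B C T (T w)" by (simp add: w'_def)
  then have "B w v = (1 / l) * C (T w) (T v)"
    by (metis inner_form_scale_left[OF B] metric_adjoint real_scaleR_def)
  then show "C (T v) (T w) = l * B v w"
    using l0 inner_form_sym[OF B, of v w] inner_form_sym[OF C, of "T v" "T w"] by simp
qed

text \<open>The image of \<open>T\<^sup>*\<close> is horizontal, so conformality may be applied to \<open>T\<^sup>* \<gamma>\<close> and \<open>T\<^sup>* \<beta>\<close>. It says that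
  \<open>T T\<^sup>* \<beta> - l \<beta>\<close> is orthogonal to the image of \<open>T T\<^sup>*\<close>, which is everything when \<open>T\<close> is onto.\<close>

lemma adjoint_of_conformal:
  assumes "surj T"
    and conf: "\<And>v w. (\<forall>k. T k = 0 \<longrightarrow> B v k = 0) \<Longrightarrow> (\<forall>k. T k = 0 \<longrightarrow> B w k = 0) \<Longrightarrow>
      C (T v) (T w) = l * B v w"
  shows "T (metric_adjoint B C T \<beta>) = l *\<^sub>R \<beta>"
proof -
  let ?A = "metric_adjoint B C T"
  have hor: "\<forall>k. T k = 0 \<longrightarrow> B (?A \<beta>) k = 0" for \<beta>
    by (simp add: metric_adjoint inner_form_zero[OF C])
  have linTA: "linear (\<lambda>\<beta>. T (?A \<beta>))"
    using linear_compose[OF linear_metric_adjoint T] by (simp add: o_def)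
  have "inj (\<lambda>\<beta>. T (?A \<beta>))"
    unfolding linear_injective_0[OF linTA]
  proof (intro allI impI)
    fix \<beta> assume "T (?A \<beta>) = 0"
    then have "B (?A \<beta>) (?A \<beta>) = 0" using hor by simp
    then have A0: "?A \<beta> = 0" using inner_form_eq_0_iff[OF B] by simp
    obtain v where v: "\<beta> = T v" using \<open>surj T\<close> by (metis surjD)
    have "C \<beta> (T v) = 0"
      using metric_adjoint[of \<beta> v] unfolding A0 by (simp add: inner_form_zero[OF B])
    then have "C \<beta> \<beta> = 0" unfolding v[symmetric] .
    then show "\<beta> = 0" using inner_form_eq_0_iff[OF C] by simp
  qed
  then have surj: "surj (\<lambda>\<beta>. T (?A \<beta>))"
    using linear_injective_imp_surjective[OF linTA] by blast
  define \<delta> where "\<delta> = T (?A \<beta>) - l *\<^sub>R \<beta>"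
  obtain \<gamma> where \<gamma>: "T (?A \<gamma>) = \<delta>" using surj by (metis surjD)
  have "C (T (?A \<gamma>)) \<delta> = C (T (?A \<gamma>)) (T (?A \<beta>)) - l * C (T (?A \<gamma>)) \<beta>"
    unfolding \<delta>_def by (simp add: inner_form_diff_right[OF C]
        inner_form_scale_right[OF C])
  also have "C (T (?A \<gamma>)) (T (?A \<beta>)) = l * B (?A \<gamma>) (?A \<beta>)" by (rule conf[OF hor hor])
  also have "B (?A \<gamma>) (?A \<beta>) = C (T (?A \<gamma>)) \<beta>"
    using metric_adjoint[of \<beta> "?A \<gamma>"] inner_form_sym[OF B] inner_form_sym[OF C] by metis
  finally have "C \<delta> \<delta> = 0" by (simp add: \<gamma>)
  then show ?thesis using inner_form_eq_0_iff[OF C] by (simp add: \<delta>_def)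
qed

end

lemma linear_scalar_of_eigenvectors:
  fixes A :: "'b::real_vector \<Rightarrow> 'b"
  assumes A: "linear A" and ev: "\<And>v. \<exists>s. A v = s *\<^sub>R v"
  obtains l where "\<And>v. A v = l *\<^sub>R v"
proof (cases "\<exists>v0 :: 'b. v0 \<noteq> 0")
  case True
  then obtain v0 :: 'b where v0: "v0 \<noteq> 0" by blast
  obtain s0 where s0: "A v0 = s0 *\<^sub>R v0" using ev by blast
  have "A v = s0 *\<^sub>R v" for v
  proof -
    obtain s where s: "A v = s *\<^sub>R v" using ev by blast
    obtain t where t: "A (v + v0) = t *\<^sub>R (v + v0)" using ev by blast
    have eq: "(s - t) *\<^sub>R v = (t - s0) *\<^sub>R v0"
      using t by (simp add: linear_add[OF A] s s0 algebra_simps)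
    show ?thesis
    proof (cases "s = t")
      case True
      then have "t = s0" using eq v0 by simp
      then show ?thesis using s True by simp
    next
      case False
      then have "v = ((t - s0) / (s - t)) *\<^sub>R v0"
        using arg_cong[OF eq, of "\<lambda>x. (1 / (s - t)) *\<^sub>R x"] by simp
      then show ?thesis by (metis linear_scale[OF A] s0 scaleR_left_commute)
    qed
  qed
  then show ?thesis by (rule that)
next
  case False
  then show ?thesis using that[of 0] by (metis scale_zero_right)
qed

text \<open>Spanning is stated separately: a basis is found as a set of maximal cardinality.\<close>

definition orthonormal_set :: "('a::euclidean_space \<Rightarrow> 'a \<Rightarrow> real) \<Rightarrow> 'a set \<Rightarrow> bool" where
  "orthonormal_set B E \<longleftrightarrow> (\<forall>e\<in>E. \<forall>f\<in>E. B e f = (if e = f then 1 else 0))"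

context
  fixes B :: "'a::euclidean_space \<Rightarrow> 'a \<Rightarrow> real"
  assumes B: "inner_form B"
begin

lemma orthonormal_set_independent:
  assumes E: "orthonormal_set B E"
  shows "independent E"
  unfolding dependent_def
proof clarify
  fix a assume a: "a \<in> E" "a \<in> span (E - {a})"
  have "B a x = 0" if "x \<in> span (E - {a})" for x
    using that
  proof (induction rule: span_induct)
    case base
    show ?case by (rule subspaceI)
        (simp_all add: inner_form_zero[OF B] inner_form_add_right[OF B]
          inner_form_scale_right[OF B])
  next
    case (step x)
    then show ?case using E a(1) by (auto simp: orthonormal_set_def)
  qed
  from this[OF a(2)] show False using E a(1) by (auto simp: orthonormal_set_def)
qed

lemma orthonormal_set_finite: "orthonormal_set B E \<Longrightarrow> finite E \<and> card E \<le> DIM('a)"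
  using orthonormal_set_independent independent_bound by blast

lemma orthonormal_set_inner_sum:
  assumes E: "orthonormal_set B E" and f: "f \<in> E"
  shows "B (\<Sum>e\<in>E. c e *\<^sub>R e) f = c f"
proof -
  have fin: "finite E" using orthonormal_set_finite[OF E] by simp
  have "B (\<Sum>e\<in>E. c e *\<^sub>R e) f = (\<Sum>e\<in>E. c e * B e f)"
    by (simp add: inner_form_sum_left[OF B] inner_form_scale_left[OF B])
  also have "\<dots> = (\<Sum>e\<in>E. if e = f then c e else 0)"
    using E f by (intro sum.cong) (auto simp: orthonormal_set_def)
  finally show ?thesis using fin f by simp
qed

text \<open>An orthonormal set of maximal cardinality spans, since otherwise a Gram-Schmidt step would enlarge it.\<close>

lemma orthonormal_basis_exists: "\<exists>E. orthonormal_set B E \<and> span E = UNIV"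
proof -
  have "orthonormal_set B {}" by (simp add: orthonormal_set_def)
  then obtain E where E: "orthonormal_set B E" and max: "\<And>E'. orthonormal_set B E' \<Longrightarrow> card E' \<le> card E"
    using ex_has_greatest_nat[of "orthonormal_set B" "{}" card "DIM('a) + 1"] orthonormal_set_finite
    by (metis le_imp_less_Suc less_imp_le Suc_eq_plus1)
  have fin: "finite E" using orthonormal_set_finite[OF E] by simp
  have "v \<in> span E" for v
  proof (rule ccontr)
    assume v: "v \<notin> span E"
    define w where "w = v - (\<Sum>e\<in>E. B v e *\<^sub>R e)"
    have "(\<Sum>e\<in>E. B v e *\<^sub>R e) \<in> span E" by (intro span_sum span_scale span_base)
    then have w0: "w \<noteq> 0" using v by (auto simp: w_def)
    have wE: "B w f = 0" if "f \<in> E" for f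
      by (simp add: w_def inner_form_diff_left[OF B] orthonormal_set_inner_sum[OF E that])
    define e where "e = (1 / sqrt (B w w)) *\<^sub>R w"
    have ee: "B e e = 1"
      using inner_form_pos[OF B w0]
      by (simp add: e_def inner_form_scale_left[OF B] inner_form_scale_right[OF B])
    have eE: "B e f = 0" "B f e = 0" if "f \<in> E" for f
      using wE[OF that] inner_form_sym[OF B, of f e]
      by (simp_all add: e_def inner_form_scale_left[OF B])
    have "e \<notin> E" using ee eE by force
    moreover have "orthonormal_set B (insert e E)"
      using E ee eE \<open>e \<notin> E\<close> by (auto simp: orthonormal_set_def)
    ultimately show False using max[of "insert e E"] fin by simp
  qed
  then show ?thesis using E by auto
qed

lemma orthonormal_basis_card:
  assumes "orthonormal_set B E" "span E = UNIV"
  shows "card E = DIM('a)"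
  using assms orthonormal_set_independent by (metis dim_UNIV dim_eq_card_independent dim_span)

lemma orthonormal_basis_Parseval:
  assumes E: "orthonormal_set B E" "span E = UNIV"
  shows "B v v = (\<Sum>e\<in>E. (B v e)\<^sup>2)"
proof -
  have fin: "finite E" using orthonormal_set_finite[OF E(1)] by simp
  obtain c where v: "v = (\<Sum>e\<in>E. c e *\<^sub>R e)"
    using E(2) span_finite[OF fin] by (metis (no_types, lifting) UNIV_I imageE)
  have c: "B v e = c e" if "e \<in> E" for e
    unfolding v by (rule orthonormal_set_inner_sum[OF E(1) that])
  have "B v v = (\<Sum>e\<in>E. c e * B v e)"
    by (subst (2) v) (simp add: inner_form_sum_right[OF B] inner_form_scale_right[OF B])
  then show ?thesis using c by (simp add: power2_eq_square)
qed

end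

text \<open>The trace of \<open>T\<^sup>* T\<close> is that of \<open>T T\<^sup>*\<close>: both are the sum of the squares of the entries of \<open>T\<close> in a pair
  of orthonormal bases.\<close>

lemma conformal_trace:
  fixes B :: "'a::euclidean_space \<Rightarrow> 'a \<Rightarrow> real" and C :: "'b::euclidean_space \<Rightarrow> 'b \<Rightarrow> real"
  assumes B: "inner_form B" and C: "inner_form C" and T: "linear T"
    and l: "\<And>\<beta>. T (metric_adjoint B C T \<beta>) = l *\<^sub>R \<beta>"
    and E: "orthonormal_set B E" "span E = UNIV"
  shows "(\<Sum>e\<in>E. C (T e) (T e)) = real DIM('b) * l"
proof -
  obtain F where F: "orthonormal_set C F" "span F = UNIV" using orthonormal_basis_exists[OF C] by blast
  let ?A = "metric_adjoint B C T"
  have "(\<Sum>e\<in>E. C (T e) (T e)) = (\<Sum>e\<in>E. \<Sum>f\<in>F. (C (T e) f)\<^sup>2)"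
    using orthonormal_basis_Parseval[OF C F] by simp
  also have "\<dots> = (\<Sum>e\<in>E. \<Sum>f\<in>F. (B (?A f) e)\<^sup>2)"
    using metric_adjoint[OF B C T] inner_form_sym[OF C] by simp
  also have "\<dots> = (\<Sum>f\<in>F. \<Sum>e\<in>E. (B (?A f) e)\<^sup>2)" by (rule sum.swap)
  also have "\<dots> = (\<Sum>f\<in>F. B (?A f) (?A f))"
    using orthonormal_basis_Parseval[OF B E] by simp
  also have "\<dots> = (\<Sum>f\<in>F. l * C f f)"
    by (simp add: metric_adjoint[OF B C T] l inner_form_scale_right[OF C])
  also have "\<dots> = (\<Sum>f\<in>F. l)" using F(1) by (intro sum.cong) (auto simp: orthonormal_set_def)
  also have "\<dots> = real DIM('b) * l" using orthonormal_basis_card[OF C F] by simp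
  finally show ?thesis .
qed

section \<open>Gradients on a Riemannian manifold\<close>

text \<open>Differentiability together with the value of \<open>differential\<close>, which alone says nothing at a point
  where \<open>f\<close> is not differentiable.\<close>

definition has_differential ::
  "('m, 'a::euclidean_space) riemannian \<Rightarrow> ('m \<Rightarrow> real) \<Rightarrow> 'm \<Rightarrow> ('a \<Rightarrow> real) \<Rightarrow> bool" where
  "has_differential M f x A \<longleftrightarrow>
     (f \<circ> chart_inv (chart_at M x) has_derivative A) (at (snd (chart_at M x) x))"

text \<open>The metric in the coordinates of the chart \<open>c\<close>, as opposed to the coordinates of \<open>chart_at M x\<close>, which
  jump with \<open>x\<close>.\<close>

definition local_metric ::
  "('m, 'a::euclidean_space) riemannian \<Rightarrow> ('m, 'a) chart \<Rightarrow> 'a \<Rightarrow> 'a \<Rightarrow> 'a \<Rightarrow> real" where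
  "local_metric M c p v w = metric M (chart_inv c p)
     (coord_vector M c (chart_inv c p) v) (coord_vector M c (chart_inv c p) w)"

definition grad_sq :: "('m, 'a::euclidean_space) riemannian \<Rightarrow> ('m \<Rightarrow> real) \<Rightarrow> 'm \<Rightarrow> real" where
  "grad_sq M u x = metric M x (gradient M u x) (gradient M u x)"

lemma differential_eq: "has_differential M f x A \<Longrightarrow> differential M f x = A"
  unfolding has_differential_def differential_def by (rule frechet_derivative_at[symmetric])

lemma has_differential_linear: "has_differential M f x A \<Longrightarrow> linear A"
  unfolding has_differential_def by (rule has_derivative_linear)

lemma differentiable_fun_at_iff: "differentiable_fun_at M f x \<longleftrightarrow> (\<exists>A. has_differential M f x A)"
  by (simp add: differentiable_fun_at_def has_differential_def differentiable_def)

lemma has_differential_const: "has_differential M (\<lambda>_. k) x (\<lambda>_. 0)"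
  by (simp add: has_differential_def o_def)

context
  fixes M :: "('m::{t2_space, second_countable_topology}, 'a::euclidean_space) riemannian"
  assumes M: "riemannian_manifold M"
begin

lemma metric_inner_form: "inner_form (metric M x)"
  using M by (auto simp: riemannian_manifold_def inner_form_def)

lemma chart_at_in: "chart_at M x \<in> charts M" "x \<in> fst (chart_at M x)"
proof -
  have "x \<in> (\<Union>c\<in>charts M. fst c)" using M by (simp add: riemannian_manifold_def smooth_atlas_def)
  then have "\<exists>c. c \<in> charts M \<and> x \<in> fst c" by blast
  from someI_ex[OF this] show "chart_at M x \<in> charts M" "x \<in> fst (chart_at M x)"
    by (simp_all add: chart_at_def)
qed

context
  fixes c assumes c: "c \<in> charts M"
begin

lemma open_chart_domain: "open (fst c)" and open_chart_image: "open (snd c ` fst c)"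
  and chart_homeomorphism: "homeomorphism (fst c) (snd c ` fst c) (snd c) (chart_inv c)"
  using M c by (simp_all add: riemannian_manifold_def smooth_atlas_def)

lemma chart_inv_left: "x \<in> fst c \<Longrightarrow> chart_inv c (snd c x) = x"
  using chart_homeomorphism by (simp add: homeomorphism_def)

lemma chart_inv_right: "p \<in> snd c ` fst c \<Longrightarrow> snd c (chart_inv c p) = p"
  using chart_homeomorphism unfolding homeomorphism_def by blast

lemma chart_inv_in: "p \<in> snd c ` fst c \<Longrightarrow> chart_inv c p \<in> fst c"
  using chart_inv_left by auto

lemma open_chart_image_of: assumes "open U" shows "open (snd c ` (fst c \<inter> U))"
proof -
  have "open (snd c ` fst c \<inter> chart_inv c -` U)"
    using chart_homeomorphism
    by (intro continuous_open_preimage open_chart_image assms) (simp add: homeomorphism_def)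
  also have "snd c ` fst c \<inter> chart_inv c -` U = snd c ` (fst c \<inter> U)"
    by (auto simp: chart_inv_left)
  finally show ?thesis .
qed

end

lemma Ck_on_transition:
  assumes "c \<in> charts M" "d \<in> charts M"
  shows "Ck_on k (snd d \<circ> chart_inv c) (snd c ` (fst c \<inter> fst d))"
  using M assms by (simp add: riemannian_manifold_def smooth_atlas_def smooth_on_def)

lemma transition_has_derivative:
  assumes "c \<in> charts M" "d \<in> charts M" "x \<in> fst c" "x \<in> fst d"
  shows "(snd d \<circ> chart_inv c has_derivative
    frechet_derivative (snd d \<circ> chart_inv c) (at (snd c x))) (at (snd c x))"
  by (rule Ck_on_Suc_has_derivative[OF Ck_on_transition[OF assms(1,2)]]) (use assms in auto)

lemma chart_change:
  assumes "c \<in> charts M" "d \<in> charts M" "x \<in> fst c" "x \<in> fst d"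
    and A: "(f \<circ> chart_inv d has_derivative A) (at (snd d x))"
  shows "(f \<circ> chart_inv c has_derivative
    A \<circ> frechet_derivative (snd d \<circ> chart_inv c) (at (snd c x))) (at (snd c x))"
proof -
  have eq: "(snd d \<circ> chart_inv c) (snd c x) = snd d x" using assms chart_inv_left by simp
  have "((f \<circ> chart_inv d) \<circ> (snd d \<circ> chart_inv c) has_derivative
    A \<circ> frechet_derivative (snd d \<circ> chart_inv c) (at (snd c x))) (at (snd c x))"
    by (rule diff_chain_at[OF transition_has_derivative[OF assms(1-4)]]) (simp only: eq A)
  then show ?thesis
  proof (rule has_derivative_transform_within_open)
    show "open (snd c ` (fst c \<inter> fst d))"
      by (intro open_chart_image_of open_chart_domain assms)
    show "snd c x \<in> snd c ` (fst c \<inter> fst d)" using assms by blast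
    show "((f \<circ> chart_inv d) \<circ> (snd d \<circ> chart_inv c)) p = (f \<circ> chart_inv c) p"
      if "p \<in> snd c ` (fst c \<inter> fst d)" for p
      using that by (auto simp: chart_inv_left[OF assms(1)] chart_inv_left[OF assms(2)])
  qed
qed

lemma chart_self_derivative:
  assumes "c \<in> charts M" "x \<in> fst c"
  shows "(snd c \<circ> chart_inv c has_derivative (\<lambda>v. v)) (at (snd c x))"
  by (rule has_derivative_transform_within_open[OF has_derivative_ident open_chart_image[OF assms(1)]])
    (use assms(2) in \<open>auto simp: chart_inv_left[OF assms(1)]\<close>)

lemma coord_vector_chart_at: "coord_vector M (chart_at M x) x = (\<lambda>v. v)"
  unfolding coord_vector_def
  by (rule frechet_derivative_at[symmetric, OF chart_self_derivative[OF chart_at_in]])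

context
  fixes c x assumes c: "c \<in> charts M" and x: "x \<in> fst c"
begin

lemma linear_coord_vector: "linear (coord_vector M c x)"
  unfolding coord_vector_def
  using transition_has_derivative[OF c chart_at_in(1) x chart_at_in(2)] has_derivative_linear by blast

text \<open>The derivatives of the two transition maps between \<open>c\<close> and \<open>chart_at M x\<close> are inverse to each other.\<close>

lemma bij_coord_vector: "bij (coord_vector M c x)"
proof -
  have "(snd c \<circ> chart_inv c has_derivative
      frechet_derivative (snd c \<circ> chart_inv (chart_at M x)) (at (snd (chart_at M x) x))
        \<circ> coord_vector M c x) (at (snd c x))"
    unfolding coord_vector_def
    by (rule chart_change[OF c chart_at_in(1) x chart_at_in(2)])
      (rule transition_has_derivative[OF chart_at_in(1) c chart_at_in(2) x])
  from has_derivative_unique[OF this chart_self_derivative[OF c x]]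
  have "inj (coord_vector M c x)" by (metis inj_on_id2 inj_on_imageI2)
  then show ?thesis
    using linear_injective_imp_surjective[OF linear_coord_vector] by (simp add: bij_def)
qed

lemma has_differential_chart:
  assumes "has_differential M f x A"
  shows "(f \<circ> chart_inv c has_derivative A \<circ> coord_vector M c x) (at (snd c x))"
  using chart_change[OF c chart_at_in(1) x chart_at_in(2)] assms
  unfolding has_differential_def coord_vector_def by blast

lemma has_differential_of_chart:
  assumes "(f \<circ> chart_inv c has_derivative A') (at (snd c x))"
  obtains A where "has_differential M f x A" "A' = A \<circ> coord_vector M c x"
proof -
  have "has_differential M f x
      (A' \<circ> frechet_derivative (snd c \<circ> chart_inv (chart_at M x)) (at (snd (chart_at M x) x)))"
    unfolding has_differential_def
    by (rule chart_change[OF chart_at_in(1) c chart_at_in(2) x assms])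
  from that[OF this has_derivative_unique[OF assms has_differential_chart[OF this]]]
  show ?thesis .
qed

end

lemma has_differential_cong:
  assumes "open U" "x \<in> U" "\<And>y. y \<in> U \<Longrightarrow> f y = g y" "has_differential M f x A"
  shows "has_differential M g x A"
  unfolding has_differential_def
proof (rule has_derivative_transform_within_open)
  let ?c = "chart_at M x"
  show "(f \<circ> chart_inv ?c has_derivative A) (at (snd ?c x))"
    using assms(4) by (simp add: has_differential_def)
  show "open (snd ?c ` (fst ?c \<inter> U))" by (rule open_chart_image_of[OF chart_at_in(1) assms(1)])
  show "snd ?c x \<in> snd ?c ` (fst ?c \<inter> U)" using chart_at_in(2) assms(2) by blast
  show "(f \<circ> chart_inv ?c) p = (g \<circ> chart_inv ?c) p" if "p \<in> snd ?c ` (fst ?c \<inter> U)" for p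
    using that assms(3) by (auto simp: chart_inv_left[OF chart_at_in(1)])
qed

lemma has_differential_outer:
  assumes f: "has_differential M f x A" and g: "(g has_real_derivative g') (at (f x))"
  shows "has_differential M (\<lambda>y. g (f y)) x (\<lambda>v. g' * A v)"
proof -
  have "(g has_derivative (*) g') (at ((f \<circ> chart_inv (chart_at M x)) (snd (chart_at M x) x)))"
    using g chart_inv_left[OF chart_at_in] by (simp add: has_field_derivative_def)
  from diff_chain_at[OF f[unfolded has_differential_def] this] show ?thesis
    by (simp add: has_differential_def o_def)
qed

lemma has_differential_mult:
  assumes "has_differential M f x A" "has_differential M g x A'"
  shows "has_differential M (\<lambda>y. f y * g y) x (\<lambda>v. f x * A' v + A v * g x)"
  using has_derivative_mult[OF assms[unfolded has_differential_def]] chart_inv_left[OF chart_at_in]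
  by (simp add: has_differential_def o_def)

lemma gradient_inner:
  assumes A: "has_differential M f x A"
  shows "metric M x (gradient M f x) w = A w"
proof -
  let ?\<alpha> = "\<Sum>b\<in>Basis. A b *\<^sub>R b"
  have \<alpha>: "?\<alpha> \<bullet> w = A w" for w
    by (rule linear_functional_inner[OF has_differential_linear[OF A]])
  have "gradient M f x = sharp (metric M x) ?\<alpha>"
    unfolding gradient_def differential_eq[OF A]
  proof (rule the_equality)
    show "\<forall>w. metric M x (sharp (metric M x) ?\<alpha>) w = A w"
      by (simp add: sharp_inner[OF metric_inner_form] \<alpha>)
    show "v = sharp (metric M x) ?\<alpha>" if "\<forall>w. metric M x v w = A w" for v
      by (rule sharp_unique[OF metric_inner_form]) (simp add: that \<alpha>)
  qed
  then show ?thesis by (simp add: sharp_inner[OF metric_inner_form] \<alpha>)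
qed

lemma gradient_unique:
  assumes "has_differential M f x A" "\<And>w. metric M x v w = A w"
  shows "gradient M f x = v"
proof -
  have "flat (metric M x) (gradient M f x) = flat (metric M x) v"
    by (simp add: flat_def gradient_inner[OF assms(1)] assms(2))
  then show ?thesis by (metis metric_inner_form sharp_flat)
qed

lemma metric_on_local_metric:
  assumes c: "c \<in> charts M"
  shows "metric_on (snd c ` fst c) (local_metric M c)"
proof
  show "open (snd c ` fst c)" by (rule open_chart_image[OF c])
  show "smooth_on (\<lambda>p. local_metric M c p v w) (snd c ` fst c)" for v w
    using M c by (simp add: riemannian_manifold_def local_metric_def)
  fix p assume p: "p \<in> snd c ` fst c"
  let ?x = "chart_inv c p"
  have x: "?x \<in> fst c" by (rule chart_inv_in[OF c p])
  note lin = linear_coord_vector[OF c x] and B = metric_inner_form[of ?x]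
  have nz: "coord_vector M c ?x v \<noteq> 0" if "v \<noteq> 0" for v
    using bij_coord_vector[OF c x] that linear_injective_0[OF lin] by (auto simp: bij_def)
  have "bilinear (local_metric M c p)"
    unfolding bilinear_def local_metric_def
    using linear_compose[OF lin inner_form_linear_right[OF B]]
      linear_compose[OF lin inner_form_linear_left[OF B]] by (simp add: o_def)
  moreover have "local_metric M c p v w = local_metric M c p w v" for v w
    unfolding local_metric_def by (rule inner_form_sym[OF B])
  ultimately show "inner_form (local_metric M c p)"
    using nz inner_form_pos[OF B] by (simp add: inner_form_def local_metric_def)
qed

context
  fixes c x f \<alpha> assumes c: "c \<in> charts M" and x: "x \<in> fst c"
    and f: "(f \<circ> chart_inv c has_derivative (\<lambda>v. \<alpha> \<bullet> v)) (at (snd c x))"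
begin

text \<open>The gradient is computed in any chart around \<open>x\<close> from the coordinates \<open>\<alpha>\<close> of the differential.
  Since one chart serves all nearby points, this is what makes derivatives of the gradient accessible.\<close>

lemma gradient_coord: "gradient M f x = coord_vector M c x (sharp (local_metric M c (snd c x)) \<alpha>)"
proof -
  obtain A where A: "has_differential M f x A" and \<alpha>: "(\<lambda>v. \<alpha> \<bullet> v) = A \<circ> coord_vector M c x"
    by (rule has_differential_of_chart[OF c x f], rule that)
  have B: "inner_form (local_metric M c (snd c x))"
    using metric_on.form[OF metric_on_local_metric[OF c]] x by blast
  show ?thesis
  proof (rule gradient_unique[OF A])
    fix w
    obtain v where w: "w = coord_vector M c x v"
      using bij_coord_vector[OF c x] by (metis bij_pointE)
    have "metric M x (coord_vector M c x (sharp (local_metric M c (snd c x)) \<alpha>)) w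
        = local_metric M c (snd c x) (sharp (local_metric M c (snd c x)) \<alpha>) v"
      by (simp add: local_metric_def chart_inv_left[OF c x] w)
    also have "\<dots> = \<alpha> \<bullet> v" by (rule sharp_inner[OF B])
    also have "\<dots> = A w" using fun_cong[OF \<alpha>, of v] by (simp add: w)
    finally show "metric M x (coord_vector M c x (sharp (local_metric M c (snd c x)) \<alpha>)) w = A w" .
  qed
qed

lemma grad_sq_coord: "grad_sq M f x = 2 * metric_on.H (local_metric M c) (snd c x, \<alpha>)"
proof -
  have B: "inner_form (local_metric M c (snd c x))"
    using metric_on.form[OF metric_on_local_metric[OF c]] x by blast
  have "grad_sq M f x = local_metric M c (snd c x)
      (sharp (local_metric M c (snd c x)) \<alpha>) (sharp (local_metric M c (snd c x)) \<alpha>)"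
    unfolding grad_sq_def gradient_coord by (simp add: local_metric_def chart_inv_left[OF c x])
  then show ?thesis
    by (simp add: sharp_inner[OF B] metric_on.H_def[OF metric_on_local_metric[OF c]])
qed

end

lemma Ck_fun_on_Suc_chart:
  assumes "Ck_fun_on (Suc k) M U u" "c \<in> charts M" "x \<in> fst c" "x \<in> U"
  shows "(u \<circ> chart_inv c has_derivative frechet_derivative (u \<circ> chart_inv c) (at (snd c x))) (at (snd c x))"
  by (rule Ck_on_Suc_has_derivative[of k _ "snd c ` (fst c \<inter> U)"])
    (use assms in \<open>auto simp: Ck_fun_on_def\<close>)

lemma Ck_fun_on_Suc_has_differential:
  assumes "Ck_fun_on (Suc k) M U u" "x \<in> U"
  shows "has_differential M u x (differential M u x)"
  using Ck_fun_on_Suc_chart[OF assms(1) chart_at_in assms(2)]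
  by (simp add: has_differential_def differential_def)

text \<open>In a chart the squared norm of the gradient is \<open>2 H (p, \<alpha> p)\<close>, where \<open>H\<close> is smooth and \<open>\<alpha>\<close>, the vector
  of partial derivatives, is of one order less than \<open>u\<close>.\<close>

lemma Ck_fun_on_grad_sq:
  assumes "open U" and u: "Ck_fun_on (Suc k) M U u"
  shows "Ck_fun_on k M U (grad_sq M u)"
  unfolding Ck_fun_on_def
proof
  fix c assume c: "c \<in> charts M"
  interpret metric_on "snd c ` fst c" "local_metric M c" by (rule metric_on_local_metric[OF c])
  let ?O = "snd c ` (fst c \<inter> U)"
  have O: "open ?O" by (rule open_chart_image_of[OF c \<open>open U\<close>])
  define \<alpha> where "\<alpha> p = (\<Sum>b\<in>Basis. frechet_derivative (u \<circ> chart_inv c) (at p) b *\<^sub>R b)" for p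
  have "Ck_on k (\<lambda>p. frechet_derivative (u \<circ> chart_inv c) (at p) b) ?O" for b
    using u c iffD1[OF Ck_on.simps(2)] unfolding Ck_fun_on_def by blast
  then have C_\<alpha>: "Ck_on k \<alpha> ?O" unfolding \<alpha>_def by (intro Ck_on_sum Ck_on_scaleR Ck_on_const O)
  have "Ck_on k (\<lambda>p. H (p, \<alpha> p)) ?O"
  proof (rule Ck_on_compose[OF O open_phase _ _ Ck_on_H])
    show "Ck_on k (\<lambda>p. (p, \<alpha> p)) ?O"
      by (intro Ck_on_Pair O C_\<alpha> Ck_on_bounded_linear bounded_linear_ident)
  qed auto
  then have C: "Ck_on k (\<lambda>p. H (p, \<alpha> p) *\<^sub>R 2) ?O" by (intro Ck_on_scaleR O Ck_on_const)
  show "Ck_on k (grad_sq M u \<circ> chart_inv c) ?O"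
  proof (rule Ck_on_cong[OF O _ C])
    fix p assume "p \<in> ?O"
    then obtain x where x: "x \<in> fst c" "x \<in> U" "p = snd c x" by auto
    have d: "(u \<circ> chart_inv c has_derivative frechet_derivative (u \<circ> chart_inv c) (at p)) (at p)"
      unfolding x(3) by (rule Ck_fun_on_Suc_chart[OF u c x(1,2)])
    have "frechet_derivative (u \<circ> chart_inv c) (at p) = (\<lambda>v. \<alpha> p \<bullet> v)"
      using linear_functional_inner[OF has_derivative_linear[OF d]] by (simp add: fun_eq_iff \<alpha>_def)
    with d have "(u \<circ> chart_inv c has_derivative (\<lambda>v. \<alpha> p \<bullet> v)) (at (snd c x))"
      unfolding x(3) by (simp only:)
    from grad_sq_coord[OF c x(1) this] show "H (p, \<alpha> p) *\<^sub>R 2 = (grad_sq M u \<circ> chart_inv c) p"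
      by (simp add: chart_inv_left[OF c x(1)] x(3))
  qed
qed

lemma grad_sq_has_differential:
  assumes "open U" "Ck_fun_on 2 M U u" "x \<in> U"
  shows "has_differential M (grad_sq M u) x (differential M (grad_sq M u) x)"
  using Ck_fun_on_Suc_has_differential[OF Ck_fun_on_grad_sq[OF assms(1)] assms(3)] assms(2)
  by (simp add: numeral_2_eq_2)

text \<open>The inner product with the gradient of a differentiable function is its differential. This form spares
  the second gradient.\<close>

lemma infinity_harmonic_fun_on_iff:
  "infinity_harmonic_fun_on M U u \<longleftrightarrow> open U \<and> Ck_fun_on 2 M U u \<and>
     (\<forall>x\<in>U. differential M (grad_sq M u) x (gradient M u x) = 0)"
proof -
  have "metric M x (gradient M u x) (gradient M (grad_sq M u) x)
      = differential M (grad_sq M u) x (gradient M u x)"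
    if U: "open U" "Ck_fun_on 2 M U u" "x \<in> U" for x
    using gradient_inner[OF grad_sq_has_differential[OF U]] inner_form_sym[OF metric_inner_form] by metis
  moreover have "(\<lambda>y. metric M y (gradient M u y) (gradient M u y)) = grad_sq M u"
    by (simp add: grad_sq_def fun_eq_iff)
  ultimately show ?thesis
    unfolding infinity_harmonic_fun_on_def by auto
qed

end

section \<open>Morphisms, conformality and homothety\<close>

lemma local_metric_chart_at:
  assumes "riemannian_manifold M"
  shows "local_metric M (chart_at M x) (snd (chart_at M x) x) = metric M x"
  by (intro ext)
    (simp add: local_metric_def chart_inv_left[OF assms chart_at_in[OF assms]] coord_vector_chart_at[OF assms])

context
  fixes N :: "('n::{t2_space, second_countable_topology}, 'b::euclidean_space) riemannian"
    and d :: "('n, 'b) chart" and V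
  assumes N: "riemannian_manifold N" and d: "d \<in> charts N"
    and V: "open V" "V \<subseteq> snd d ` fst d"
begin

lemma open_chart_vimage: "open (fst d \<inter> snd d -` V)"
  using chart_homeomorphism[OF N d]
  by (intro continuous_open_preimage open_chart_domain[OF N d] V) (simp add: homeomorphism_def)

lemma chart_function_has_derivative:
  assumes P: "\<And>q. q \<in> V \<Longrightarrow> (u has_derivative (\<lambda>v. P q \<bullet> v)) (at q)"
    and z: "z \<in> fst d \<inter> snd d -` V"
  shows "((u \<circ> snd d) \<circ> chart_inv d has_derivative (\<lambda>v. P (snd d z) \<bullet> v)) (at (snd d z))"
  by (rule has_derivative_transform_within_open[OF P V(1)])
    (use z V(2) in \<open>auto simp: chart_inv_right[OF N d] subset_iff\<close>)

lemma Ck_fun_on_chart_function: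
  assumes u: "Ck_on (Suc (Suc 0)) u V"
  shows "Ck_fun_on (Suc (Suc 0)) N (fst d \<inter> snd d -` V) (u \<circ> snd d)"
  unfolding Ck_fun_on_def
proof
  fix c assume c: "c \<in> charts N"
  let ?O = "snd c ` (fst c \<inter> (fst d \<inter> snd d -` V))"
  have "Ck_on (Suc (Suc 0)) (\<lambda>p. u ((snd d \<circ> chart_inv c) p)) ?O"
  proof (rule Ck_on_compose[OF _ V(1) _ _ u])
    show "open ?O" by (rule open_chart_image_of[OF N c open_chart_vimage])
    show "Ck_on (Suc (Suc 0)) (snd d \<circ> chart_inv c) ?O"
      by (rule Ck_on_subset[OF Ck_on_transition[OF N c d]]) auto
  qed (auto simp: chart_inv_left[OF N c])
  then show "Ck_on (Suc (Suc 0)) (u \<circ> snd d \<circ> chart_inv c) ?O" by (simp add: o_def)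
qed

lemma grad_sq_chart_function:
  assumes "\<And>q. q \<in> V \<Longrightarrow> (u has_derivative (\<lambda>v. P q \<bullet> v)) (at q)" "z \<in> fst d \<inter> snd d -` V"
  shows "grad_sq N (u \<circ> snd d) z = 2 * metric_on.H (local_metric N d) (snd d z, P (snd d z))"
  using grad_sq_coord[OF N d _ chart_function_has_derivative[OF assms]] assms(2) by simp

text \<open>Functions with a gradient of constant norm are infinity-harmonic, as the norm is what gets differentiated.\<close>

lemma infinity_harmonic_chart_function:
  assumes u: "Ck_on (Suc (Suc 0)) u V"
    and P: "\<And>q. q \<in> V \<Longrightarrow> (u has_derivative (\<lambda>v. P q \<bullet> v)) (at q)"
    and k: "\<And>q. q \<in> V \<Longrightarrow> metric_on.H (local_metric N d) (q, P q) = k"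
  shows "infinity_harmonic_fun_on N (fst d \<inter> snd d -` V) (u \<circ> snd d)"
  unfolding infinity_harmonic_fun_on_iff[OF N]
proof (intro conjI ballI open_chart_vimage)
  show "Ck_fun_on 2 N (fst d \<inter> snd d -` V) (u \<circ> snd d)"
    using Ck_fun_on_chart_function[OF u] by (simp add: numeral_2_eq_2)
  fix z assume z: "z \<in> fst d \<inter> snd d -` V"
  have "has_differential N (grad_sq N (u \<circ> snd d)) z (\<lambda>_. 0)"
    by (rule has_differential_cong[OF N open_chart_vimage z _ has_differential_const[of _ "2 * k"]])
      (use grad_sq_chart_function[OF P] k in auto)
  then show "differential N (grad_sq N (u \<circ> snd d)) z (gradient N (u \<circ> snd d) z) = 0"
    by (simp add: differential_eq)
qed

end

context
  fixes M :: "('m::{t2_space, second_countable_topology}, 'a::euclidean_space) riemannian"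
    and N :: "('n::{t2_space, second_countable_topology}, 'b::euclidean_space) riemannian"
    and \<phi> :: "'m \<Rightarrow> 'n"
  assumes M: "riemannian_manifold M" and N: "riemannian_manifold N" and \<phi>: "Ck_map 2 M N \<phi>"
begin

lemmas form_M = metric_inner_form[OF M] and form_N = metric_inner_form[OF N]

abbreviation T where "T \<equiv> tangent_map M N \<phi>"

abbreviation T_adj where "T_adj x \<equiv> metric_adjoint (metric M x) (metric N (\<phi> x)) (T x)"

lemma open_preimage: "open V \<Longrightarrow> open (\<phi> -` V)"
  using \<phi> by (intro open_vimage) (simp_all add: Ck_map_def)

lemma Ck_on_map:
  assumes "c \<in> charts M" "d \<in> charts N"
  shows "Ck_on (Suc (Suc 0)) (snd d \<circ> \<phi> \<circ> chart_inv c) (snd c ` (fst c \<inter> \<phi> -` fst d))"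
  using \<phi> assms by (simp add: Ck_map_def numeral_2_eq_2)

lemma tangent_map_has_derivative:
  "(snd (chart_at N (\<phi> x)) \<circ> \<phi> \<circ> chart_inv (chart_at M x) has_derivative T x)
    (at (snd (chart_at M x) x))"
  unfolding tangent_map_def
  by (rule Ck_on_Suc_has_derivative[OF Ck_on_map[OF chart_at_in(1)[OF M] chart_at_in(1)[OF N]]])
    (use chart_at_in(2)[OF M, of x] chart_at_in(2)[OF N, of "\<phi> x"] in auto)

lemma linear_tangent_map: "linear (T x)"
  using tangent_map_has_derivative has_derivative_linear by blast

lemmas adjoint = metric_adjoint[OF form_M form_N linear_tangent_map]

lemma linear_T_adj: "linear (T_adj x)"
  by (rule linear_metric_adjoint[OF form_M form_N linear_tangent_map])

abbreviation target_chart where "target_chart x \<equiv> chart_at N (\<phi> x)"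

abbreviation target_point where "target_point x \<equiv> snd (chart_at N (\<phi> x)) (\<phi> x)"

lemma has_differential_pullback:
  assumes A: "has_differential N u (\<phi> x) A"
  shows "has_differential M (u \<circ> \<phi>) x (A \<circ> T x)"
  unfolding has_differential_def
proof (rule has_derivative_transform_within_open)
  let ?c = "chart_at M x" and ?d = "chart_at N (\<phi> x)"
  note c = chart_at_in[OF M, of x] and d = chart_at_in[OF N, of "\<phi> x"]
  show "((u \<circ> chart_inv ?d) \<circ> (snd ?d \<circ> \<phi> \<circ> chart_inv ?c) has_derivative A \<circ> T x) (at (snd ?c x))"
    by (rule diff_chain_at[OF tangent_map_has_derivative])
      (use A in \<open>simp add: has_differential_def chart_inv_left[OF M c]\<close>)
  show "open (snd ?c ` (fst ?c \<inter> \<phi> -` fst ?d))"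
    by (intro open_chart_image_of[OF M c(1)] open_preimage open_chart_domain[OF N d(1)])
  show "snd ?c x \<in> snd ?c ` (fst ?c \<inter> \<phi> -` fst ?d)" using c d by blast
  show "((u \<circ> chart_inv ?d) \<circ> (snd ?d \<circ> \<phi> \<circ> chart_inv ?c)) p = (u \<circ> \<phi> \<circ> chart_inv ?c) p"
    if "p \<in> snd ?c ` (fst ?c \<inter> \<phi> -` fst ?d)" for p
    using that by (auto simp: chart_inv_left[OF M c(1)] chart_inv_left[OF N d(1)])
qed

lemma gradient_pullback:
  assumes A: "has_differential N u (\<phi> x) A"
  shows "gradient M (u \<circ> \<phi>) x = T_adj x (gradient N u (\<phi> x))"
  by (rule gradient_unique[OF M has_differential_pullback[OF A]])
    (simp add: adjoint gradient_inner[OF N A])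

text \<open>Near a point \<open>x\<close> the function is the composition of the coordinate expressions of \<open>u\<close> and \<open>\<phi>\<close> in a chart
  around \<open>\<phi> x\<close>. That chart varies with \<open>x\<close>, so the argument is local.\<close>

lemma Ck_fun_on_pullback:
  assumes V: "open V" and u: "Ck_fun_on 2 N V u"
  shows "Ck_fun_on 2 M (\<phi> -` V) (u \<circ> \<phi>)"
  unfolding Ck_fun_on_def
proof
  fix c assume c: "c \<in> charts M"
  show "Ck_on 2 (u \<circ> \<phi> \<circ> chart_inv c) (snd c ` (fst c \<inter> \<phi> -` V))"
  proof (rule Ck_on_local)
    fix p assume "p \<in> snd c ` (fst c \<inter> \<phi> -` V)"
    then obtain x where x: "p = snd c x" "x \<in> fst c" "\<phi> x \<in> V" by auto
    let ?d = "chart_at N (\<phi> x)"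
    note d = chart_at_in[OF N, of "\<phi> x"]
    let ?O = "snd c ` (fst c \<inter> \<phi> -` (fst ?d \<inter> V))"
    have O: "open ?O"
      by (intro open_chart_image_of[OF M c] open_preimage open_Int V open_chart_domain[OF N d(1)])
    have "Ck_on (Suc (Suc 0)) (\<lambda>p. (u \<circ> chart_inv ?d) ((snd ?d \<circ> \<phi> \<circ> chart_inv c) p)) ?O"
    proof (rule Ck_on_compose[OF O open_chart_image_of[OF N d(1) V]])
      show "Ck_on (Suc (Suc 0)) (snd ?d \<circ> \<phi> \<circ> chart_inv c) ?O"
        by (rule Ck_on_subset[OF Ck_on_map[OF c d(1)]]) auto
      show "Ck_on (Suc (Suc 0)) (u \<circ> chart_inv ?d) (snd ?d ` (fst ?d \<inter> V))"
        using u d(1) by (simp add: Ck_fun_on_def numeral_2_eq_2)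
    qed (auto simp: chart_inv_left[OF M c])
    then have "Ck_on (Suc (Suc 0)) (u \<circ> \<phi> \<circ> chart_inv c) ?O"
      by (rule Ck_on_cong[OF O, rotated])
        (auto simp: chart_inv_left[OF M c] chart_inv_left[OF N d(1)])
    then have "Ck_on 2 (u \<circ> \<phi> \<circ> chart_inv c) (?O \<inter> snd c ` (fst c \<inter> \<phi> -` V))"
      unfolding numeral_2_eq_2 by (rule Ck_on_subset) auto
    moreover have "p \<in> ?O" using x d by auto
    ultimately show "\<exists>U. open U \<and> p \<in> U \<and> Ck_on 2 (u \<circ> \<phi> \<circ> chart_inv c) (U \<inter> snd c ` (fst c \<inter> \<phi> -` V))"
      using O by blast
  qed
qed

text \<open>Horizontal weak conformality as an equation without case distinction: at a critical point \<open>T\<close> and \<open>T_adj\<close>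
  vanish, and the equation forces \<open>dil x = 0\<close> because the target has positive dimension.\<close>

lemma has_dilation_iff:
  "has_dilation M N \<phi> dil \<longleftrightarrow> (\<forall>x. dil x \<ge> 0 \<and> (\<forall>\<beta>. T x (T_adj x \<beta>) = (dil x)\<^sup>2 *\<^sub>R \<beta>))"
proof -
  have "(if critical_point M N \<phi> x then dil x = 0
        else surj (T x) \<and>
             (\<forall>v\<in>horizontal_space M N \<phi> x. \<forall>w\<in>horizontal_space M N \<phi> x.
                metric N (\<phi> x) (T x v) (T x w) = (dil x)\<^sup>2 * metric M x v w))
      \<longleftrightarrow> (\<forall>\<beta>. T x (T_adj x \<beta>) = (dil x)\<^sup>2 *\<^sub>R \<beta>)" (is "?L \<longleftrightarrow> ?R") if "dil x \<ge> 0" for x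
  proof (cases "critical_point M N \<phi> x")
    case True
    then have T0: "T x v = 0" for v by (simp add: critical_point_def)
    obtain b :: 'b where "b \<in> Basis" using nonempty_Basis by blast
    then have "b \<noteq> 0" by auto
    then show ?thesis using True by (auto simp: T0)
  next
    case False
    note forms = form_M[of x] form_N[of "\<phi> x"] linear_tangent_map[of x]
    have nz: "T x \<noteq> (\<lambda>_. 0)" using False by (simp add: critical_point_def)
    have hor: "v \<in> horizontal_space M N \<phi> x \<longleftrightarrow> (\<forall>k. T x k = 0 \<longrightarrow> metric M x v k = 0)" for v
      by (auto simp: horizontal_space_def vertical_space_def)
    show ?thesis
    proof
      assume ?L
      then have surj: "surj (T x)" and conf: "\<And>v w. v \<in> horizontal_space M N \<phi> x \<Longrightarrow>
          w \<in> horizontal_space M N \<phi> x \<Longrightarrow> metric N (\<phi> x) (T x v) (T x w) = (dil x)\<^sup>2 * metric M x v w"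
        using False by auto
      show ?R by (intro allI adjoint_of_conformal[OF forms surj] conf; simp only: hor)
    next
      assume ?R
      then have R: "\<And>\<beta>. T x (T_adj x \<beta>) = (dil x)\<^sup>2 *\<^sub>R \<beta>" by blast
      have "metric N (\<phi> x) (T x v) (T x w) = (dil x)\<^sup>2 * metric M x v w"
        if "v \<in> horizontal_space M N \<phi> x" "w \<in> horizontal_space M N \<phi> x" for v w
        using that unfolding hor by (rule conformal_of_adjoint(3)[OF forms R nz])
      then show ?L
        using False conformal_of_adjoint(2)[OF forms R nz] by simp
    qed
  qed
  then show ?thesis unfolding has_dilation_def by meson
qed

lemma grad_sq_pullback:
  assumes A: "has_differential N u (\<phi> x) A"
    and l: "\<And>\<beta>. T x (T_adj x \<beta>) = l *\<^sub>R \<beta>"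
  shows "grad_sq M (u \<circ> \<phi>) x = l * grad_sq N u (\<phi> x)"
  by (simp add: grad_sq_def gradient_pullback[OF A] adjoint l
      inner_form_scale_right[OF form_N])

text \<open>The kernel of \<open>T x\<close> is the orthogonal complement of the image of \<open>T_adj x\<close>.\<close>

lemma gradient_vertical_iff:
  assumes A: "has_differential M f x A"
  shows "T x (gradient M f x) = 0 \<longleftrightarrow> (\<forall>\<beta>. A (T_adj x \<beta>) = 0)"
proof -
  have "A (T_adj x \<beta>) = metric N (\<phi> x) \<beta> (T x (gradient M f x))" for \<beta>
    using gradient_inner[OF M A] inner_form_sym[OF form_M] adjoint by metis
  then show ?thesis
    using inner_form_zero[OF form_N] inner_form_eq_0_iff[OF form_N]
    by metis
qed

lemma dilation_nonzero:
  assumes "\<And>\<beta>. T x (T_adj x \<beta>) = l *\<^sub>R \<beta>" "\<not> critical_point M N \<phi> x"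
  shows "l > 0"
  using conformal_of_adjoint(1)[OF form_M form_N linear_tangent_map]
    assms by (auto simp: critical_point_def)

text \<open>The function \<open>|grad (u \<circ> \<phi>)|\<^sup>2 = dil\<^sup>2 (|grad u|\<^sup>2 \<circ> \<phi>)\<close> is differentiated in the direction
  \<open>W = grad (u \<circ> \<phi>) = T\<^sup>* (grad u)\<close>. The derivative of \<open>dil\<close> vanishes since \<open>W\<close> is horizontal, that of the other
  factor since \<open>T W\<close> is a multiple of \<open>grad u\<close> and \<open>u\<close> is infinity-harmonic. At a critical point,
  where \<open>dil\<close> may fail to be differentiable, \<open>W = 0\<close>.\<close>

lemma homothetic_imp_morphism:
  assumes "horizontally_homothetic M N \<phi>"
  shows "infinity_harmonic_morphism M N \<phi>"
  unfolding infinity_harmonic_morphism_def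
proof (intro allI impI)
  fix V u assume harm: "infinity_harmonic_fun_on N V u"
  obtain dil where dil: "has_dilation M N \<phi> dil"
    and grad: "\<And>x. \<not> critical_point M N \<phi> x \<Longrightarrow>
      differentiable_fun_at M dil x \<and> gradient M dil x \<in> vertical_space M N \<phi> x"
    using assms unfolding horizontally_homothetic_def by blast
  have l: "T x (T_adj x \<beta>) = (dil x)\<^sup>2 *\<^sub>R \<beta>" for x \<beta> using dil has_dilation_iff by blast
  have V: "open V" and u: "Ck_fun_on 2 N V u"
    and eq: "\<And>y. y \<in> V \<Longrightarrow> differential N (grad_sq N u) y (gradient N u y) = 0"
    using harm infinity_harmonic_fun_on_iff[OF N] by auto
  have du: "has_differential N u y (differential N u y)" if "y \<in> V" for y
    using Ck_fun_on_Suc_has_differential[OF N _ that] u by (simp add: numeral_2_eq_2)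
  note dg = grad_sq_has_differential[OF N V u]
  show "infinity_harmonic_fun_on M (\<phi> -` V) (u \<circ> \<phi>)"
    unfolding infinity_harmonic_fun_on_iff[OF M]
  proof (intro conjI ballI open_preimage V Ck_fun_on_pullback u)
    fix x assume "x \<in> \<phi> -` V"
    then have x: "\<phi> x \<in> V" by simp
    define W where "W = gradient M (u \<circ> \<phi>) x"
    have W: "W = T_adj x (gradient N u (\<phi> x))" unfolding W_def by (rule gradient_pullback[OF du[OF x]])
    note dgM = grad_sq_has_differential[OF M open_preimage[OF V] Ck_fun_on_pullback[OF V u] \<open>x \<in> \<phi> -` V\<close>]
    have "differential M (grad_sq M (u \<circ> \<phi>)) x W = 0"
    proof (cases "critical_point M N \<phi> x")
      case True
      then have "W = 0"
        unfolding W critical_point_def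
        by (intro metric_adjoint_zero_map metric_inner_form M N linear_tangent_map) simp
      then show ?thesis using linear_0[OF has_differential_linear[OF dgM]] by simp
    next
      case False
      obtain A where A: "has_differential M dil x A" and vert: "T x (gradient M dil x) = 0"
        using grad[OF False] unfolding differentiable_fun_at_iff vertical_space_def by blast
      have AW: "A W = 0" using gradient_vertical_iff[OF A] vert W by simp
      have eqn: "dil z * dil z * (grad_sq N u \<circ> \<phi>) z = grad_sq M (u \<circ> \<phi>) z" if "z \<in> \<phi> -` V" for z
        using grad_sq_pullback[OF du[of "\<phi> z"] l] that by (simp add: power2_eq_square)
      have "has_differential M (\<lambda>z. dil z * dil z * (grad_sq N u \<circ> \<phi>) z) x
         (\<lambda>v. dil x * dil x * (differential N (grad_sq N u) (\<phi> x) \<circ> T x) v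
           + (dil x * A v + A v * dil x) * (grad_sq N u \<circ> \<phi>) x)"
        by (intro has_differential_mult[OF M] A has_differential_pullback dg x)
      then have "has_differential M (grad_sq M (u \<circ> \<phi>)) x
         (\<lambda>v. dil x * dil x * (differential N (grad_sq N u) (\<phi> x) \<circ> T x) v
           + (dil x * A v + A v * dil x) * (grad_sq N u \<circ> \<phi>) x)"
        by (rule has_differential_cong[OF M open_preimage[OF V], rotated 2]) (use eqn x in auto)
      then have eqW: "differential M (grad_sq M (u \<circ> \<phi>)) x W
        = dil x * dil x * differential N (grad_sq N u) (\<phi> x) (T x W)"
        by (simp add: differential_eq AW)
      have "T x W = (dil x)\<^sup>2 *\<^sub>R gradient N u (\<phi> x)" unfolding W by (rule l)
      then have "differential N (grad_sq N u) (\<phi> x) (T x W) = 0"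
        by (simp add: linear_scale[OF has_differential_linear[OF dg[OF x]]] eq[OF x])
      then show ?thesis unfolding eqW by simp
    qed
    then show "differential M (grad_sq M (u \<circ> \<phi>)) x (gradient M (u \<circ> \<phi>) x) = 0" by (simp add: W_def)
  qed
qed

text \<open>Orthonormal bases exist, so the arbitrary choice in \<open>norm_sq_tangent_map\<close> is a proper one.\<close>

lemma norm_sq_tangent_map_conformal:
  assumes "\<And>\<beta>. T x (T_adj x \<beta>) = l *\<^sub>R \<beta>"
  shows "norm_sq_tangent_map M N \<phi> x = real DIM('b) * l"
proof -
  define E where "E = (SOME E. orthonormal_basis M x E)"
  have "\<exists>E. orthonormal_basis M x E"
    using orthonormal_basis_exists[OF form_M[of x]]
    by (simp add: orthonormal_basis_def orthonormal_set_def)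
  then have "orthonormal_basis M x E" unfolding E_def by (rule someI_ex)
  then have "orthonormal_set (metric M x) E" "span E = UNIV"
    by (auto simp: orthonormal_basis_def orthonormal_set_def)
  from conformal_trace[OF form_M form_N linear_tangent_map assms this]
  show ?thesis by (simp add: norm_sq_tangent_map_def E_def)
qed

lemma infinity_laplacian_conformal:
  assumes l: "\<And>z \<beta>. T z (T_adj z \<beta>) = (dil z)\<^sup>2 *\<^sub>R \<beta>" and A: "has_differential M dil x A"
  shows "infinity_laplacian M N \<phi> x = (real DIM('b) * dil x) *\<^sub>R T x (gradient M dil x)"
proof -
  have "norm_sq_tangent_map M N \<phi> = (\<lambda>z. real DIM('b) * (dil z)\<^sup>2)"
    using norm_sq_tangent_map_conformal[OF l] by auto
  moreover have "has_differential M (\<lambda>z. real DIM('b) * (dil z)\<^sup>2) x (\<lambda>v. (2 * real DIM('b) * dil x) * A v)"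
    by (rule has_differential_outer[OF M A, of "\<lambda>t. real DIM('b) * t\<^sup>2"])
      (auto intro!: derivative_eq_intros)
  ultimately have "gradient M (norm_sq_tangent_map M N \<phi>) x = (2 * real DIM('b) * dil x) *\<^sub>R gradient M dil x"
    by (intro gradient_unique[OF M])
      (auto simp: inner_form_scale_left[OF form_M] gradient_inner[OF M A])
  then show ?thesis
    by (simp add: infinity_laplacian_def linear_scale[OF linear_tangent_map])
qed

lemma homothetic_imp_infinity_harmonic:
  assumes "horizontally_homothetic M N \<phi>"
  shows "horizontally_weakly_conformal M N \<phi> \<and> infinity_harmonic_map M N \<phi>"
proof
  obtain dil where dil: "has_dilation M N \<phi> dil"
    and grad: "\<And>x. \<not> critical_point M N \<phi> x \<Longrightarrow>
      differentiable_fun_at M dil x \<and> gradient M dil x \<in> vertical_space M N \<phi> x"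
    using assms unfolding horizontally_homothetic_def by blast
  then show "horizontally_weakly_conformal M N \<phi>" by (auto simp: horizontally_weakly_conformal_def)
  have l: "T x (T_adj x \<beta>) = (dil x)\<^sup>2 *\<^sub>R \<beta>" for x \<beta> using dil has_dilation_iff by blast
  have "infinity_laplacian M N \<phi> x = 0" for x
  proof (cases "critical_point M N \<phi> x")
    case True
    then show ?thesis by (simp add: infinity_laplacian_def critical_point_def)
  next
    case False
    obtain A where A: "has_differential M dil x A" and "T x (gradient M dil x) = 0"
      using grad[OF False] unfolding differentiable_fun_at_iff vertical_space_def by blast
    then show ?thesis using infinity_laplacian_conformal[OF l A] by simp
  qed
  then show "infinity_harmonic_map M N \<phi>" using \<phi> by (simp add: infinity_harmonic_map_def)
qed

text \<open>Near \<open>x\<close> the dilation is the square root of \<open>|grad (u \<circ> \<phi>)|\<^sup>2 / (|grad u|\<^sup>2 \<circ> \<phi>)\<close>, a positive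
  quotient of differentiable functions.\<close>

lemma dilation_differentiable:
  assumes dil: "has_dilation M N \<phi> dil"
    and V: "open V" "\<phi> x \<in> V" and u: "Ck_fun_on 2 N V u" and pos: "\<And>y. y \<in> V \<Longrightarrow> grad_sq N u y > 0"
    and nc: "\<not> critical_point M N \<phi> x"
  obtains A where "has_differential M dil x A"
proof -
  have l: "T x (T_adj x \<beta>) = (dil x)\<^sup>2 *\<^sub>R \<beta>" and dil0: "dil x \<ge> 0" for x \<beta>
    using dil has_dilation_iff by blast+
  have du: "has_differential N u y (differential N u y)" if "y \<in> V" for y
    using Ck_fun_on_Suc_has_differential[OF N _ that] u by (simp add: numeral_2_eq_2)
  have xV: "x \<in> \<phi> -` V" using V(2) by simp
  note dg = has_differential_pullback[OF grad_sq_has_differential[OF N V(1) u V(2)]]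
    and dgM = grad_sq_has_differential[OF M open_preimage[OF V(1)] Ck_fun_on_pullback[OF V(1) u] xV]
  have eqn: "grad_sq M (u \<circ> \<phi>) z = (dil z)\<^sup>2 * grad_sq N u (\<phi> z)" if "\<phi> z \<in> V" for z
    by (rule grad_sq_pullback[OF du[OF that] l])
  have "((\<lambda>t. inverse t) has_real_derivative - (inverse (grad_sq N u (\<phi> x)) ^ Suc (Suc 0)))
      (at ((grad_sq N u \<circ> \<phi>) x))"
    using DERIV_inverse[of "grad_sq N u (\<phi> x)"] pos[OF V(2)] by simp
  from has_differential_mult[OF M dgM has_differential_outer[OF M dg this]]
  obtain A1 where A1: "has_differential M
      (\<lambda>z. grad_sq M (u \<circ> \<phi>) z * inverse ((grad_sq N u \<circ> \<phi>) z)) x A1" by blast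
  have "0 < (dil x)\<^sup>2" by (rule dilation_nonzero[OF l nc])
  then have val: "0 < grad_sq M (u \<circ> \<phi>) x * inverse ((grad_sq N u \<circ> \<phi>) x)"
    using pos[OF V(2)] eqn[OF V(2)] by simp
  have d: "has_differential M (\<lambda>z. sqrt (grad_sq M (u \<circ> \<phi>) z * inverse ((grad_sq N u \<circ> \<phi>) z))) x
      (\<lambda>v. (inverse (sqrt (grad_sq M (u \<circ> \<phi>) x * inverse ((grad_sq N u \<circ> \<phi>) x))) / 2) * A1 v)"
    by (rule has_differential_outer[OF M A1 DERIV_real_sqrt[OF val]])
  have "has_differential M dil x
      (\<lambda>v. (inverse (sqrt (grad_sq M (u \<circ> \<phi>) x * inverse ((grad_sq N u \<circ> \<phi>) x))) / 2) * A1 v)"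
  proof (rule has_differential_cong[OF M open_preimage[OF V(1)] xV _ d])
    fix z assume "z \<in> \<phi> -` V"
    then have "grad_sq M (u \<circ> \<phi>) z * inverse ((grad_sq N u \<circ> \<phi>) z) = (dil z)\<^sup>2"
      using pos[of "\<phi> z"] eqn[of z] by simp
    then show "sqrt (grad_sq M (u \<circ> \<phi>) z * inverse ((grad_sq N u \<circ> \<phi>) z)) = dil z"
      by (simp add: dil0)
  qed
  then show ?thesis by (rule that)
qed

text \<open>A coordinate of the chart around \<open>\<phi> x\<close> serves as a function with nonvanishing gradient.\<close>

lemma dilation_has_differential:
  assumes dil: "has_dilation M N \<phi> dil" and nc: "\<not> critical_point M N \<phi> x"
  obtains A where "has_differential M dil x A"
proof -
  let ?d = "chart_at N (\<phi> x)"
  note d = chart_at_in[OF N, of "\<phi> x"]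
  interpret metric_on "snd ?d ` fst ?d" "local_metric N ?d" by (rule metric_on_local_metric[OF N d(1)])
  obtain b :: 'b where b: "b \<in> Basis" using nonempty_Basis by blast
  then have b0: "b \<noteq> 0" by auto
  have y: "\<phi> x \<in> fst ?d \<inter> snd ?d -` (snd ?d ` fst ?d)" using d by blast
  have "Ck_on (Suc (Suc 0)) (\<lambda>q. b \<bullet> q) (snd ?d ` fst ?d)"
    by (intro Ck_on_bounded_linear open_S bounded_linear_inner_right)
  then have u: "Ck_fun_on 2 N (fst ?d \<inter> snd ?d -` (snd ?d ` fst ?d)) ((\<lambda>q. b \<bullet> q) \<circ> snd ?d)"
    unfolding numeral_2_eq_2 by (rule Ck_fun_on_chart_function[OF N d(1) open_S subset_refl])
  have "grad_sq N ((\<lambda>q. b \<bullet> q) \<circ> snd ?d) z > 0" if z: "z \<in> fst ?d \<inter> snd ?d -` (snd ?d ` fst ?d)" for z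
  proof -
    have "grad_sq N ((\<lambda>q. b \<bullet> q) \<circ> snd ?d) z = 2 * H (snd ?d z, b)"
      by (rule grad_sq_chart_function[OF N d(1) open_S subset_refl _ z])
        (intro has_derivative_inner_right has_derivative_ident)
    then show ?thesis using H_pos[of "snd ?d z" b] b0 z by simp
  qed
  from dilation_differentiable[OF dil open_chart_vimage[OF N d(1) open_S subset_refl] y u this nc] that
  show ?thesis by blast
qed

lemma infinity_harmonic_imp_homothetic:
  assumes "horizontally_weakly_conformal M N \<phi>" "infinity_harmonic_map M N \<phi>"
  shows "horizontally_homothetic M N \<phi>"
proof -
  obtain dil where dil: "has_dilation M N \<phi> dil"
    using assms(1) unfolding horizontally_weakly_conformal_def by blast
  have l: "T x (T_adj x \<beta>) = (dil x)\<^sup>2 *\<^sub>R \<beta>" for x \<beta> using dil has_dilation_iff by blast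
  have "differentiable_fun_at M dil x \<and> gradient M dil x \<in> vertical_space M N \<phi> x"
    if nc: "\<not> critical_point M N \<phi> x" for x
  proof -
    obtain A where A: "has_differential M dil x A" by (rule dilation_has_differential[OF dil nc])
    have "(real DIM('b) * dil x) *\<^sub>R T x (gradient M dil x) = 0"
      using assms(2) infinity_laplacian_conformal[OF l A] by (simp add: infinity_harmonic_map_def)
    moreover have "dil x \<noteq> 0" using dilation_nonzero[OF l nc] by auto
    ultimately show ?thesis using A unfolding differentiable_fun_at_iff vertical_space_def by auto
  qed
  then show ?thesis using dil unfolding horizontally_homothetic_def by blast
qed

text \<open>The infinity Laplacian of \<open>u \<circ> \<phi>\<close> at \<open>x\<close>, up to the factor 2, for a function \<open>u\<close> with gradient \<open>\<beta>\<close> at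
  \<open>\<phi> x\<close>. The second derivative \<open>D\<close> of \<open>u\<close> enters only through its value on \<open>T T\<^sup>* \<beta>\<close>. The other
  terms, which stem from the derivatives of the metric and of \<open>d\<phi>\<close>, see \<open>u\<close> only through its gradient and
  are collected in \<open>K\<close>; that \<open>K\<close> is the same for all such \<open>u\<close> is the point of the lemma.\<close>

lemma grad_sq_pullback_second_order:
  obtains K where "\<And>u P D V. open V \<Longrightarrow> snd (chart_at N (\<phi> x)) (\<phi> x) \<in> V \<Longrightarrow>
      \<forall>q\<in>V. (u has_derivative (\<lambda>v. P q \<bullet> v)) (at q) \<Longrightarrow>
      P (snd (chart_at N (\<phi> x)) (\<phi> x)) = flat (metric N (\<phi> x)) \<beta> \<Longrightarrow>
      (P has_derivative D) (at (snd (chart_at N (\<phi> x)) (\<phi> x))) \<Longrightarrow>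
      differential M (grad_sq M (u \<circ> snd (chart_at N (\<phi> x)) \<circ> \<phi>)) x (T_adj x \<beta>)
        = K + 2 * (D (T x (T_adj x \<beta>)) \<bullet> T x (T_adj x \<beta>))"
proof -
  define c where "c = chart_at M x"
  define d where "d = chart_at N (\<phi> x)"
  have c: "c \<in> charts M" "x \<in> fst c" using chart_at_in[OF M] by (auto simp: c_def)
  have d: "d \<in> charts N" "\<phi> x \<in> fst d" using chart_at_in[OF N] by (auto simp: d_def)
  define p0 where "p0 = snd c x"
  define f where "f = snd d \<circ> \<phi> \<circ> chart_inv c"
  define O1 where "O1 = snd c ` (fst c \<inter> \<phi> -` fst d)"
  have O1: "open O1" unfolding O1_def
    by (intro open_chart_image_of[OF M c(1)] open_preimage open_chart_domain[OF N d(1)])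
  have p0: "p0 \<in> O1" using c d by (auto simp: p0_def O1_def)
  have fp0: "f p0 = snd d (\<phi> x)" by (simp add: f_def p0_def chart_inv_left[OF M c])
  have C_f: "Ck_on (Suc (Suc 0)) f O1" unfolding f_def O1_def by (rule Ck_on_map[OF c(1) d(1)])
  interpret metric_on "snd c ` fst c" "local_metric M c" by (rule metric_on_local_metric[OF M c(1)])
  define Df where "Df p = frechet_derivative f (at p)" for p
  have Df: "(f has_derivative Df p) (at p)" if "p \<in> O1" for p
    using Ck_on_Suc_has_derivative[OF C_f that] by (simp add: Df_def)
  have Dfp0: "Df p0 = T x" by (simp add: Df_def f_def p0_def c_def d_def tangent_map_def)
  define L where "L b = frechet_derivative (\<lambda>p. Df p b) (at p0)" for b
  have L: "((\<lambda>p. Df p b) has_derivative L b) (at p0)" for b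
  proof -
    have "Ck_on (Suc 0) (\<lambda>p. Df p b) O1" using iffD1[OF Ck_on.simps(2) C_f] unfolding Df_def by blast
    from Ck_on_Suc_has_derivative[OF this p0] show ?thesis by (simp add: L_def)
  qed
  define P0 where "P0 = flat (metric N (\<phi> x)) \<beta>"
  define \<alpha>0 where "\<alpha>0 = (\<Sum>b\<in>Basis. (P0 \<bullet> T x b) *\<^sub>R b)"
  define W where "W = T_adj x \<beta>"
  have metric_p0: "local_metric M c p0 = metric M x"
    unfolding c_def p0_def by (rule local_metric_chart_at[OF M])
  have sharp_\<alpha>0: "sharp (local_metric M c p0) \<alpha>0 = W"
    by (simp add: metric_p0 \<alpha>0_def W_def P0_def flat_inner[OF form_N] metric_adjoint_def)
  have p0S: "p0 \<in> snd c ` fst c" using c by (auto simp: p0_def)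
  have linDH: "linear (DH (p0, \<alpha>0))" using linear_DH[of "(p0, \<alpha>0)"] p0S by simp
  \<comment> \<open>The terms from the derivative of the metric and from the second derivative of \<open>\<phi>\<close>.\<close>
  define K where "K = 2 * (DH (p0, \<alpha>0) (W, 0) + P0 \<bullet> (\<Sum>b\<in>Basis. (W \<bullet> b) *\<^sub>R L b W))"
  show ?thesis
  proof (rule that[of K], fold d_def W_def, fold P0_def)
    fix u P D and V :: "'b set"
    assume V: "open V" "snd d (\<phi> x) \<in> V"
      and u: "\<forall>q\<in>V. (u has_derivative (\<lambda>v. P q \<bullet> v)) (at q)"
      and P0: "P (snd d (\<phi> x)) = P0" and D: "(P has_derivative D) (at (snd d (\<phi> x)))"
    \<comment> \<open>The coordinates of the differential of \<open>u \<circ> \<phi>\<close> and their derivative at \<open>x\<close>.\<close>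
    define \<alpha> where "\<alpha> p = (\<Sum>b\<in>Basis. (P (f p) \<bullet> Df p b) *\<^sub>R b)" for p
    define \<alpha>' where "\<alpha>' w = (\<Sum>b\<in>Basis. (P0 \<bullet> L b w + D (T x w) \<bullet> T x b) *\<^sub>R b)" for w
    have \<alpha>p0: "\<alpha> p0 = \<alpha>0" by (simp add: \<alpha>_def \<alpha>0_def fp0 P0 Dfp0)
    have Pf: "((\<lambda>p. P (f p)) has_derivative (\<lambda>w. D (T x w))) (at p0)"
      by (rule has_derivative_compose[OF Df[OF p0, unfolded Dfp0]]) (simp add: fp0 D)
    have \<alpha>': "(\<alpha> has_derivative \<alpha>') (at p0)"
    proof -
      have "((\<lambda>p. P (f p) \<bullet> Df p b) has_derivative (\<lambda>w. P0 \<bullet> L b w + D (T x w) \<bullet> T x b)) (at p0)" for b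
        using has_derivative_inner[OF Pf L[of b]] by (simp add: fp0 P0 Dfp0)
      then show ?thesis unfolding \<alpha>_def \<alpha>'_def by (intro has_derivative_sum has_derivative_scaleR_left)
    qed
    define O2 where "O2 = O1 \<inter> f -` V"
    have O2: "open O2" unfolding O2_def
      by (intro continuous_open_preimage Ck_on_continuous_on[OF C_f] O1 V)
    have p0O2: "p0 \<in> O2" using p0 V by (simp add: O2_def fp0)
    let ?g = "grad_sq M (u \<circ> snd d \<circ> \<phi>)"
    have g: "2 * H (p, \<alpha> p) = (?g \<circ> chart_inv c) p" if p: "p \<in> O2" for p
    proof -
      obtain z where z: "p = snd c z" "z \<in> fst c" using p by (auto simp: O2_def O1_def)
      have dp: "((\<lambda>p. u (f p)) has_derivative (\<lambda>v. P (f p) \<bullet> Df p v)) (at p)"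
        by (rule has_derivative_compose[OF Df bspec[OF u]]) (use p in \<open>simp_all add: O2_def\<close>)
      note lin = has_derivative_linear[OF dp]
      from dp have "((u \<circ> snd d \<circ> \<phi>) \<circ> chart_inv c has_derivative (\<lambda>v. \<alpha> p \<bullet> v)) (at (snd c z))"
        unfolding \<alpha>_def linear_functional_inner[OF lin] by (simp add: f_def o_def z)
      from grad_sq_coord[OF M c(1) z(2) this] show ?thesis
        by (simp add: z chart_inv_left[OF M c(1) z(2)])
    qed
    have "((\<lambda>p. 2 * H (p, \<alpha> p)) has_derivative (\<lambda>w. 2 * DH (p0, \<alpha>0) (w, \<alpha>' w))) (at p0)"
      by (intro has_derivative_mult_right
          has_derivative_compose[OF has_derivative_Pair[OF has_derivative_ident \<alpha>'], of H])
        (use H_has_derivative[of "(p0, \<alpha>0)"] p0S in \<open>simp add: \<alpha>p0\<close>)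
    then have "has_differential M ?g x (\<lambda>w. 2 * DH (p0, \<alpha>0) (w, \<alpha>' w))"
      unfolding has_differential_def c_def[symmetric] p0_def[symmetric]
      by (rule has_derivative_transform_within_open[OF _ O2 p0O2 g])
    then have "differential M ?g x W = 2 * DH (p0, \<alpha>0) ((W, 0) + (0, \<alpha>' W))"
      by (simp add: differential_eq)
    then have g': "differential M ?g x W = 2 * (DH (p0, \<alpha>0) (W, 0) + \<alpha>' W \<bullet> W)"
      unfolding linear_add[OF linDH] DH_momentum[OF p0S] sharp_\<alpha>0 .
    have "\<alpha>' W \<bullet> W = (\<Sum>b\<in>Basis. (W \<bullet> b) * (P0 \<bullet> L b W + D (T x W) \<bullet> T x b))"
      by (subst inner_commute) (simp add: \<alpha>'_def inner_sum_right mult.commute)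
    also have "\<dots> = P0 \<bullet> (\<Sum>b\<in>Basis. (W \<bullet> b) *\<^sub>R L b W) + D (T x W) \<bullet> (\<Sum>b\<in>Basis. (W \<bullet> b) *\<^sub>R T x b)"
      by (simp add: inner_sum_right distrib_left sum.distrib)
    also have "(\<Sum>b\<in>Basis. (W \<bullet> b) *\<^sub>R T x b) = T x W"
      by (rule linear_eq_sum_Basis[OF linear_tangent_map, symmetric])
    finally show "differential M ?g x W = K + 2 * (D (T x W) \<bullet> T x W)"
      unfolding g' K_def by simp
  qed
qed

text \<open>The functions that test a morphism: solutions of the eikonal equation with gradient \<open>\<beta>\<close> at \<open>\<phi> x\<close>, in the
  chart around \<open>\<phi> x\<close>, together with what the morphism property says about their pullback. The
  second derivative \<open>D\<close> depends on \<open>\<kappa>\<close> only through the last equation.\<close>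

lemma eikonal_test_function:
  assumes mor: "infinity_harmonic_morphism M N \<phi>" and \<beta>: "\<beta> \<noteq> 0"
  obtains V u P D c where "open V" "target_point x \<in> V"
    "V \<subseteq> snd (target_chart x) ` fst (target_chart x)"
    "Ck_on (Suc (Suc 0)) u V" "\<forall>q\<in>V. (u has_derivative (\<lambda>v. P q \<bullet> v)) (at q)"
    "P (target_point x) = flat (metric N (\<phi> x)) \<beta>" "(P has_derivative D) (at (target_point x))"
    "c > 0" "\<And>z. z \<in> fst (target_chart x) \<inter> snd (target_chart x) -` V \<Longrightarrow>
      grad_sq N (u \<circ> snd (target_chart x)) z = c"
    "differential M (grad_sq M (u \<circ> snd (target_chart x) \<circ> \<phi>)) x (T_adj x \<beta>) = 0"
    "D \<beta> = snd (metric_on.X (local_metric N (target_chart x)) (target_point x, flat (metric N (\<phi> x)) \<beta>))"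
    "\<And>w. D w \<bullet> \<beta> =
      snd (metric_on.X (local_metric N (target_chart x)) (target_point x, flat (metric N (\<phi> x)) \<beta>)) \<bullet> w"
    "\<And>w. w \<bullet> flat (metric N (\<phi> x)) \<beta> = 0 \<Longrightarrow>
      D w \<bullet> w = - (\<kappa> * norm (flat (metric N (\<phi> x)) \<beta>) * (w \<bullet> w))"
proof -
  define d where "d = target_chart x"
  have d: "d \<in> charts N" "\<phi> x \<in> fst d" using chart_at_in[OF N] by (auto simp: d_def)
  interpret metric_on "snd d ` fst d" "local_metric N d" by (rule metric_on_local_metric[OF N d(1)])
  define q0 where "q0 = snd d (\<phi> x)"
  have q0: "q0 \<in> snd d ` fst d" using d by (auto simp: q0_def)
  note B = form_N[of "\<phi> x"]
  define P0 where "P0 = flat (metric N (\<phi> x)) \<beta>"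
  have P0: "P0 \<noteq> 0"
    using linear_injective_0[OF linear_flat[OF B]] bij_flat[OF B] \<beta> by (auto simp: P0_def bij_def)
  have metric_q0: "local_metric N d q0 = metric N (\<phi> x)"
    unfolding d_def q0_def by (rule local_metric_chart_at[OF N])
  have fstX: "fst (X (q0, P0)) = \<beta>" by (simp add: X_def metric_q0 P0_def sharp_flat[OF B])
  obtain V u P D where V: "open V" "q0 \<in> V" "V \<subseteq> snd d ` fst d"
    and u: "Ck_on (Suc (Suc 0)) u V"
    and P: "\<And>q. q \<in> V \<Longrightarrow> (u has_derivative (\<lambda>v. P q \<bullet> v)) (at q)"
    and HP: "\<And>q. q \<in> V \<Longrightarrow> H (q, P q) = H (q0, P0)"
    and Pq0: "P q0 = P0" and D: "(P has_derivative D) (at q0)"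
    and D1: "D (fst (X (q0, P0))) = snd (X (q0, P0))"
    and D2: "\<And>w. D w \<bullet> fst (X (q0, P0)) = snd (X (q0, P0)) \<bullet> w"
    and D3: "\<And>w. w \<bullet> P0 = 0 \<Longrightarrow> D w \<bullet> w = - (\<kappa> * norm P0 * (w \<bullet> w))"
    by (rule eikonal_solution[OF q0 P0, where k=\<kappa>], rule that)
  let ?U = "fst d \<inter> snd d -` V"
  have yU: "\<phi> x \<in> ?U" using d V(2) by (simp add: q0_def)
  have "infinity_harmonic_fun_on N ?U (u \<circ> snd d)"
    by (rule infinity_harmonic_chart_function[OF N d(1) V(1,3) u P HP])
  then have "infinity_harmonic_fun_on M (\<phi> -` ?U) (u \<circ> snd d \<circ> \<phi>)"
    using mor unfolding infinity_harmonic_morphism_def by blast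
  then have 0: "differential M (grad_sq M (u \<circ> snd d \<circ> \<phi>)) x (gradient M (u \<circ> snd d \<circ> \<phi>) x) = 0"
    using yU unfolding infinity_harmonic_fun_on_iff[OF M] by blast
  have "gradient N (u \<circ> snd d) (\<phi> x)
      = coord_vector N d (\<phi> x) (sharp (local_metric N d (snd d (\<phi> x))) (P (snd d (\<phi> x))))"
    by (rule gradient_coord[OF N d chart_function_has_derivative[OF N d(1) V(1,3) P yU]])
  also have "\<dots> = \<beta>"
    using Pq0 by (simp add: q0_def[symmetric] metric_q0 P0_def sharp_flat[OF B])
      (simp add: d_def coord_vector_chart_at[OF N])
  finally have W: "gradient M (u \<circ> snd d \<circ> \<phi>) x = T_adj x \<beta>"
    using gradient_pullback[OF Ck_fun_on_Suc_has_differential[OF N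
          Ck_fun_on_chart_function[OF N d(1) V(1,3) u] yU]]
    by simp
  have g: "grad_sq N (u \<circ> snd d) z = 2 * H (q0, P0)" if z: "z \<in> ?U" for z
    using grad_sq_chart_function[OF N d(1) V(1,3) P z] HP z by simp
  have pos: "2 * H (q0, P0) > 0" using H_pos[OF q0 P0] by simp
  show ?thesis
    using that[folded d_def, folded q0_def P0_def, of V u P D "2 * H (q0, P0)"]
      V u P Pq0 D pos g 0[unfolded W] D1 D2 D3 unfolding fstX by blast
qed

text \<open>Two test functions with the same gradient \<open>\<beta>\<close> but level sets of different curvature are compared. For
  \<open>v = T T\<^sup>* \<beta>\<close> the difference of their second derivatives vanishes on \<open>v\<close>. This difference annihilates \<open>\<beta>\<close> on
  either side and is definite on the complement of \<open>\<beta>\<close>, so \<open>v\<close> is a multiple of \<open>\<beta>\<close>.\<close>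

lemma morphism_eigenvector:
  assumes mor: "infinity_harmonic_morphism M N \<phi>"
  shows "\<exists>s. T x (T_adj x \<beta>) = s *\<^sub>R \<beta>"
proof (cases "\<beta> = 0")
  case True
  then show ?thesis using linear_0[OF linear_T_adj] linear_0[OF linear_tangent_map] by simp
next
  case False
  define P0 where "P0 = flat (metric N (\<phi> x)) \<beta>"
  define \<nu> where "\<nu> = snd (metric_on.X (local_metric N (target_chart x)) (target_point x, P0))"
  define v where "v = T x (T_adj x \<beta>)"
  obtain K where K: "\<And>u P D V. open V \<Longrightarrow> target_point x \<in> V \<Longrightarrow>
      \<forall>q\<in>V. (u has_derivative (\<lambda>v. P q \<bullet> v)) (at q) \<Longrightarrow>
      P (target_point x) = P0 \<Longrightarrow> (P has_derivative D) (at (target_point x)) \<Longrightarrow>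
      differential M (grad_sq M (u \<circ> snd (target_chart x) \<circ> \<phi>)) x (T_adj x \<beta>) = K + 2 * (D v \<bullet> v)"
    by (rule grad_sq_pullback_second_order[of x \<beta>, folded v_def P0_def], rule that)
  have "\<exists>D. linear D \<and> K + 2 * (D v \<bullet> v) = 0 \<and> D \<beta> = \<nu> \<and> (\<forall>w. D w \<bullet> \<beta> = \<nu> \<bullet> w) \<and>
      (\<forall>w. w \<bullet> P0 = 0 \<longrightarrow> D w \<bullet> w = - (\<kappa> * norm P0 * (w \<bullet> w)))" for \<kappa>
  proof (rule eikonal_test_function[OF mor False, of x \<kappa>], fold P0_def, fold \<nu>_def)
    fix V u P D
    assume V: "open V" "target_point x \<in> V" and P: "\<forall>q\<in>V. (u has_derivative (\<lambda>v. P q \<bullet> v)) (at q)"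
      and Pq0: "P (target_point x) = P0" and D: "(P has_derivative D) (at (target_point x))"
      and 0: "differential M (grad_sq M (u \<circ> snd (target_chart x) \<circ> \<phi>)) x (T_adj x \<beta>) = 0"
      and D': "D \<beta> = \<nu>" "\<And>w. D w \<bullet> \<beta> = \<nu> \<bullet> w"
        "\<And>w. w \<bullet> P0 = 0 \<Longrightarrow> D w \<bullet> w = - (\<kappa> * norm P0 * (w \<bullet> w))"
    have "K + 2 * (D v \<bullet> v) = 0" using K[OF V P Pq0 D] 0 by simp
    then show ?thesis using has_derivative_linear[OF D] D' by blast
  qed
  \<comment> \<open>A flat and a curved initial hypersurface.\<close>
  from this[of 0] this[of 1] obtain D E where
    D: "linear D" "K + 2 * (D v \<bullet> v) = 0" "D \<beta> = \<nu>"
      "\<And>w. D w \<bullet> \<beta> = \<nu> \<bullet> w" "\<And>w. w \<bullet> P0 = 0 \<Longrightarrow> D w \<bullet> w = 0" and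
    E: "linear E" "K + 2 * (E v \<bullet> v) = 0" "E \<beta> = \<nu>"
      "\<And>w. E w \<bullet> \<beta> = \<nu> \<bullet> w" "\<And>w. w \<bullet> P0 = 0 \<Longrightarrow> E w \<bullet> w = - (norm P0 * (w \<bullet> w))"
    by auto
  have P0\<beta>: "P0 \<bullet> \<beta> > 0"
    using inner_form_pos[OF form_N False]
    by (simp add: P0_def flat_inner[OF form_N])
  define s where "s = (v \<bullet> P0) / (P0 \<bullet> \<beta>)"
  define w where "w = v - s *\<^sub>R \<beta>"
  have wP0: "w \<bullet> P0 = 0"
    using P0\<beta> by (simp add: w_def s_def inner_diff_left inner_commute[of \<beta>])
  have v: "v = w + s *\<^sub>R \<beta>" by (simp add: w_def)
  have "D v - E v = D w - E w"
    by (simp add: v linear_add[OF D(1)] linear_add[OF E(1)] linear_scale[OF D(1)] linear_scale[OF E(1)] D(3) E(3))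
  then have "(D v - E v) \<bullet> v = (D w - E w) \<bullet> w"
    using D(4)[of w] E(4)[of w] by (simp add: v inner_add_right inner_diff_left)
  then have "norm P0 * (w \<bullet> w) = 0"
    using D(2) E(2) D(5)[OF wP0] E(5)[OF wP0] unfolding inner_diff_left by linarith
  then have "w = 0" using P0\<beta> by auto
  then have "T x (T_adj x \<beta>) = s *\<^sub>R \<beta>" using v by (simp add: v_def)
  then show ?thesis ..
qed

text \<open>By linear algebra an operator all of whose vectors are eigenvectors is a multiple of the identity, and
  \<open>T T\<^sup>*\<close> is positive semidefinite, which gives the dilation. For a test function
  \<open>|grad (u \<circ> \<phi>)|\<^sup>2\<close> is a positive constant times \<open>dil\<^sup>2\<close>, and its derivative along \<open>T\<^sup>* \<beta>\<close> vanishes.\<close>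

lemma morphism_imp_homothetic:
  assumes mor: "infinity_harmonic_morphism M N \<phi>"
  shows "horizontally_homothetic M N \<phi>"
proof -
  have "\<exists>l. \<forall>\<beta>. T x (T_adj x \<beta>) = l *\<^sub>R \<beta>" for x
  proof -
    have "linear (\<lambda>\<beta>. T x (T_adj x \<beta>))"
      using linear_compose[OF linear_T_adj linear_tangent_map] by (simp add: o_def)
    from linear_scalar_of_eigenvectors[OF this morphism_eigenvector[OF mor]] show ?thesis by blast
  qed
  then obtain l where l: "\<And>x \<beta>. T x (T_adj x \<beta>) = l x *\<^sub>R \<beta>" by metis
  have l0: "l x \<ge> 0" for x
  proof -
    obtain b :: 'b where "b \<in> Basis" using nonempty_Basis by blast
    then have b: "b \<noteq> 0" by auto
    have "l x * metric N (\<phi> x) b b = metric M x (T_adj x b) (T_adj x b)"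
      by (simp add: adjoint l inner_form_scale_right[OF form_N])
    then have "l x * metric N (\<phi> x) b b \<ge> 0" using inner_form_nonneg[OF form_M] by simp
    then show ?thesis using inner_form_pos[OF form_N b, of "\<phi> x"]
      by (simp add: zero_le_mult_iff)
  qed
  define dil where "dil x = sqrt (l x)" for x
  have l': "T x (T_adj x \<beta>) = (dil x)\<^sup>2 *\<^sub>R \<beta>" for x \<beta> using l l0 by (simp add: dil_def)
  have dil: "has_dilation M N \<phi> dil"
    unfolding has_dilation_iff using l' l0 by (simp add: dil_def)
  have "differentiable_fun_at M dil x \<and> gradient M dil x \<in> vertical_space M N \<phi> x"
    if nc: "\<not> critical_point M N \<phi> x" for x
  proof -
    obtain A where A: "has_differential M dil x A" by (rule dilation_has_differential[OF dil nc])
    have dil0: "dil x \<noteq> 0" using dilation_nonzero[OF l' nc] by auto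
    have "A (T_adj x \<beta>) = 0" for \<beta>
    proof (cases "\<beta> = 0")
      case True
      then show ?thesis
        using linear_0[OF has_differential_linear[OF A]] linear_0[OF linear_T_adj] by simp
    next
      case False
      let ?d = "target_chart x"
      note d = chart_at_in[OF N, of "\<phi> x"]
      show ?thesis
      proof (rule eikonal_test_function[OF mor False, of x 0])
        fix V u P D c
        assume V: "open V" "target_point x \<in> V" "V \<subseteq> snd ?d ` fst ?d"
          and u: "Ck_on (Suc (Suc 0)) u V" and c: "c > 0"
          and g: "\<And>z. z \<in> fst ?d \<inter> snd ?d -` V \<Longrightarrow> grad_sq N (u \<circ> snd ?d) z = c"
          and 0: "differential M (grad_sq M (u \<circ> snd ?d \<circ> \<phi>)) x (T_adj x \<beta>) = 0"
        let ?U = "fst ?d \<inter> snd ?d -` V"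
        have openU: "open (\<phi> -` ?U)" by (rule open_preimage[OF open_chart_vimage[OF N d(1) V(1,3)]])
        have eqn: "c * (dil z)\<^sup>2 = grad_sq M (u \<circ> snd ?d \<circ> \<phi>) z" if z: "z \<in> \<phi> -` ?U" for z
        proof -
          have zU: "\<phi> z \<in> ?U" using z by blast
          have "has_differential N (u \<circ> snd ?d) (\<phi> z) (differential N (u \<circ> snd ?d) (\<phi> z))"
            by (rule Ck_fun_on_Suc_has_differential[OF N
                  Ck_fun_on_chart_function[OF N d(1) V(1,3) u] zU])
          from grad_sq_pullback[OF this l'] show ?thesis by (simp add: g[OF zU])
        qed
        have "has_differential M (\<lambda>z. c * (dil z)\<^sup>2) x (\<lambda>v. (2 * c * dil x) * A v)"
          by (rule has_differential_outer[OF M A, of "\<lambda>t. c * t\<^sup>2"])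
            (auto intro!: derivative_eq_intros)
        then have "has_differential M (grad_sq M (u \<circ> snd ?d \<circ> \<phi>)) x (\<lambda>v. (2 * c * dil x) * A v)"
          by (rule has_differential_cong[OF M openU _ eqn, rotated -1]) (use d V(2) in auto)
        then have "(2 * c * dil x) * A (T_adj x \<beta>) = 0"
          using 0 by (simp add: differential_eq)
        then show ?thesis using dil0 c by simp
      qed
    qed
    then show ?thesis
      using A gradient_vertical_iff[OF A] unfolding differentiable_fun_at_iff vertical_space_def by auto
  qed
  then show ?thesis using dil unfolding horizontally_homothetic_def by blast
qed

end

theorem theorem1p3:
  fixes M :: "('m::{t2_space, second_countable_topology}, 'a::euclidean_space) riemannian"
    and N :: "('n::{t2_space, second_countable_topology}, 'b::euclidean_space) riemannian"
    and \<phi> :: "'m \<Rightarrow> 'n"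
  assumes "riemannian_manifold M"
    and "riemannian_manifold N"
    and "Ck_map 2 M N \<phi>"
  shows "(infinity_harmonic_morphism M N \<phi> \<longleftrightarrow>
            horizontally_weakly_conformal M N \<phi> \<and> infinity_harmonic_map M N \<phi>) \<and>
         (horizontally_weakly_conformal M N \<phi> \<and> infinity_harmonic_map M N \<phi> \<longleftrightarrow>
            horizontally_homothetic M N \<phi>)"
  using morphism_imp_homothetic[OF assms] homothetic_imp_morphism[OF assms]
    homothetic_imp_infinity_harmonic[OF assms] infinity_harmonic_imp_homothetic[OF assms] by blast

end
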